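(* Let $G$ be a (possibly infinite) graph which is not cyclically connected. Then $G$ is $5$-ac if and only if $G$ (that is, $|G|$) is homeomorphic to one of the following graphs: (a) a finite path (equivalently, an arc), a ray or a double ray; (b) a lollipop with or without the endpoint; (c) the dumbbell graph; or (d) the figure-of-eight graph.
   Context: A graph $G=(V,E)$ consists of a (possibly infinite) vertex set $V$ and a set $E\subseteq[V]^2$ of edges (vertex degrees may be infinite). $|G|$ denotes the $1$-complex of $G$: the quotient of $V\oplus\bigoplus_{e\in E}[0,1]_e$ ($V$ discrete) in which, for each edge $e=\{v,w\}$, $0\in[0,1]_e$ is identified with $v$ and $1\in[0,1]_e$ with $w$. An arc is a homeomorphic copy of $[0,1]$. $G$ is $n$-ac if for any choice of at most $n$ points of $|G|$ there is an arc in $|G|$ containing them. $G$ is cyclically connected if every two vertices lie on a (finite) cycle of $G$. A ray is homeomorphic to $[0,1)$ and a double ray to $(0,1)$. The lollipop is a circle together with an arc meeting the circle in exactly one point, which is an endpoint of the arc; the endpoint of the lollipop is the other endpoint of that arc. The dumbbell is the union of two disjoint circles and an arc joining a point of one to a point of the other and otherwise disjoint from both. The figure-of-eight is the union of two circles meeting in exactly one point. *)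

theory Defs
  imports "HOL-Analysis.Analysis" "HOL-Library.Ramsey"
begin

subsection \<open>Graphs and cyclic connectedness\<close>

definition simple_graph :: "'v set \<Rightarrow> 'v set set \<Rightarrow> bool" where
  "simple_graph V E \<longleftrightarrow> E \<subseteq> [V]\<^bsup>2\<^esup>"

definition is_cycle :: "'v set set \<Rightarrow> 'v list \<Rightarrow> bool" where
  "is_cycle E c \<longleftrightarrow> 3 \<le> length c \<and> distinct c \<and>
     (\<forall>i<length c. {c ! i, c ! (Suc i mod length c)} \<in> E)"

definition cyclically_connected :: "'v set \<Rightarrow> 'v set set \<Rightarrow> bool" where
  "cyclically_connected V E \<longleftrightarrow>
     (\<forall>v\<in>V. \<forall>w\<in>V. v \<noteq> w \<longrightarrow> (\<exists>c. is_cycle E c \<and> v \<in> set c \<and> w \<in> set c))"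


subsection \<open>The 1-complex of a graph\<close>

text \<open>The topology on the image of \<open>q\<close> whose open sets are the sets with open preimage.\<close>

definition quotient_topology :: "'a topology \<Rightarrow> ('a \<Rightarrow> 'b) \<Rightarrow> 'b topology" where
  "quotient_topology X q =
     topology (\<lambda>U. U \<subseteq> q ` topspace X \<and> openin X {x \<in> topspace X. q x \<in> U})"

lemma istopology_quotient:
  "istopology (\<lambda>U. U \<subseteq> q ` topspace X \<and> openin X {x \<in> topspace X. q x \<in> U})"
proof -
  have 1: "{x \<in> topspace X. q x \<in> S \<inter> T} =
      {x \<in> topspace X. q x \<in> S} \<inter> {x \<in> topspace X. q x \<in> T}" for S T
    by auto
  have 2: "{x \<in> topspace X. q x \<in> \<Union>\<K>} = (\<Union>K\<in>\<K>. {x \<in> topspace X. q x \<in> K})" for \<K>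
    by auto
  show ?thesis
    unfolding istopology_def 1 2 by blast
qed

lemma openin_quotient_topology:
  "openin (quotient_topology X q) U \<longleftrightarrow>
     U \<subseteq> q ` topspace X \<and> openin X {x \<in> topspace X. q x \<in> U}"
  by (simp add: quotient_topology_def istopology_quotient)

lemma topspace_quotient_topology [simp]:
  "topspace (quotient_topology X q) = q ` topspace X"
proof
  show "topspace (quotient_topology X q) \<subseteq> q ` topspace X"
    by (meson openin_quotient_topology openin_topspace)
  have "{x \<in> topspace X. q x \<in> q ` topspace X} = topspace X"
    by auto
  then show "q ` topspace X \<subseteq> topspace (quotient_topology X q)"
    by (metis openin_quotient_topology openin_subset openin_topspace order_refl)
qed

lemma quotient_map_quotient_topology: "quotient_map X (quotient_topology X q) q"
  by (auto simp: quotient_map_def openin_quotient_topology)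

text \<open>An arbitrary orientation of the edges: \<open>edge_end0 e\<close> and \<open>edge_end1 e\<close> are the ends
  of \<open>e\<close> to which \<open>0\<close> and \<open>1\<close> of \<open>[0,1]\<close> are attached.\<close>

definition edge_end0 :: "'v set \<Rightarrow> 'v" where
  "edge_end0 e = (SOME v. v \<in> e)"

definition edge_end1 :: "'v set \<Rightarrow> 'v" where
  "edge_end1 e = (SOME w. e = {edge_end0 e, w})"

lemma edge_ends:
  assumes "simple_graph V E" "e \<in> E"
  shows "e = {edge_end0 e, edge_end1 e}" "edge_end0 e \<noteq> edge_end1 e"
    "edge_end0 e \<in> V" "edge_end1 e \<in> V"
proof -
  have "e \<in> [V]\<^bsup>2\<^esup>"
    using assms unfolding simple_graph_def by blast
  then obtain v w where vw: "e = {v, w}" "v \<noteq> w" "v \<in> V" "w \<in> V"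
    by (auto simp: nsets_2_eq)
  then have "edge_end0 e \<in> e"
    unfolding edge_end0_def by (metis insertI1 someI)
  then have "\<exists>u. e = {edge_end0 e, u}"
    using vw by auto
  then show *: "e = {edge_end0 e, edge_end1 e}"
    unfolding edge_end1_def by (rule someI_ex)
  show "edge_end0 e \<noteq> edge_end1 e" "edge_end0 e \<in> V" "edge_end1 e \<in> V"
    using vw * by (auto simp: doubleton_eq_iff)
qed

text \<open>The disjoint sum of the discrete space \<open>V\<close> and one copy of \<open>[0,1]\<close> per edge. The vertex
  \<open>v\<close> is the point \<open>(Inl v, 0)\<close>; the point \<open>t\<close> of the copy of \<open>[0,1]\<close> for \<open>e\<close> is
  \<open>(Inr e, t)\<close>.\<close>

definition cell_sum :: "'v set \<Rightarrow> 'v set set \<Rightarrow> (('v + 'v set) \<times> real) topology" where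
  "cell_sum V E =
     sum_topology (case_sum (\<lambda>v. top_of_set {0}) (\<lambda>e. top_of_set {0..1})) (V <+> E)"

text \<open>The identification of the ends of each interval with vertices, by sending every point
  to a canonical representative of its class.\<close>

definition glue :: "('v + 'v set) \<times> real \<Rightarrow> ('v + 'v set) \<times> real" where
  "glue p = (case p of
       (Inl v, t) \<Rightarrow> (Inl v, t)
     | (Inr e, t) \<Rightarrow>
         if t = 0 then (Inl (edge_end0 e), 0)
         else if t = 1 then (Inl (edge_end1 e), 0)
         else (Inr e, t))"

text \<open>The kernel of \<open>glue\<close> is the equivalence relation generated by the identifications.\<close>

lemma glue_eq_iff:
  "glue x = glue y \<longleftrightarrow>
     equivclp (\<lambda>x y. \<exists>e. x = (Inr e, 0) \<and> y = (Inl (edge_end0 e), 0) \<or>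
                       x = (Inr e, 1) \<and> y = (Inl (edge_end1 e), 0)) x y"
  (is "_ \<longleftrightarrow> equivclp ?r x y")
proof
  assume "equivclp ?r x y"
  then show "glue x = glue y"
    by (induction rule: equivclp_induct) (auto simp: glue_def)
next
  have *: "equivclp ?r x (glue x)" for x
  proof (cases "glue x = x")
    case True
    then show ?thesis by simp
  next
    case False
    then have "?r x (glue x)"
      by (auto simp: glue_def split: prod.splits sum.splits if_splits)
    then show ?thesis by (rule r_into_equivclp)
  qed
  assume "glue x = glue y"
  then show "equivclp ?r x y"
    using equivclp_trans[OF *[of x]] equivclp_sym[OF *[of y]] by simp
qed

definition one_complex :: "'v set \<Rightarrow> 'v set set \<Rightarrow> (('v + 'v set) \<times> real) topology" where
  "one_complex V E = quotient_topology (cell_sum V E) glue"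


subsection \<open>Arcs and \<open>n\<close>-arc-connectedness\<close>

definition is_arc_in :: "'a topology \<Rightarrow> 'a set \<Rightarrow> bool" where
  "is_arc_in X A \<longleftrightarrow> A \<subseteq> topspace X \<and> subtopology X A homeomorphic_space top_of_set {0..1::real}"

definition n_arc_connected :: "nat \<Rightarrow> 'a topology \<Rightarrow> bool" where
  "n_arc_connected n X \<longleftrightarrow>
     (\<forall>S. S \<subseteq> topspace X \<and> finite S \<and> card S \<le> n \<longrightarrow> (\<exists>A. is_arc_in X A \<and> S \<subseteq> A))"

definition n_ac :: "nat \<Rightarrow> 'v set \<Rightarrow> 'v set set \<Rightarrow> bool" where
  "n_ac n V E \<longleftrightarrow> n_arc_connected n (one_complex V E)"


subsection \<open>The model spaces\<close>

text \<open>The segment from 1 to 2 meets the unit circle in 1 only and the unit circle around 3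
  in 2 only; the unit circles around \<open>-1\<close> and 1 meet in 0 only.\<close>

definition lollipop :: "complex set" where
  "lollipop = sphere 0 1 \<union> closed_segment 1 2"

definition lollipop_without_endpoint :: "complex set" where
  "lollipop_without_endpoint = lollipop - {2}"

definition dumbbell :: "complex set" where
  "dumbbell = sphere 0 1 \<union> closed_segment 1 2 \<union> sphere 3 1"

definition figure_of_eight :: "complex set" where
  "figure_of_eight = sphere (-1) 1 \<union> sphere 1 1"

end

theory Submission
  imports Defs
begin

text \<open>If \<open>G\<close> is connected and not cyclically connected, then it is a single edge or has a cut vertex
  \<open>p\<close> (Whitney). An arc that meets both sides of \<open>p\<close> passes through \<open>p\<close> once, so spending one of the
  five points on the other side shows that any four points of a side lie on an arc of that side
  starting at \<open>p\<close>. If \<open>p\<close> has two neighbours on the side, points near \<open>p\<close> on both edges force the arc to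
  return to \<open>p\<close>, and two more points rule out a branch vertex on the resulting cycle, so the side
  is a cycle. Otherwise follow the side from \<open>p\<close> through vertices of degree two: this ends in a
  leaf, goes on for ever, or reaches a branch vertex, which is a cut vertex with a side of the
  first kind. Hence every side is an arc, a ray, a circle or a lollipop, and two sides glued at \<open>p\<close>
  give the spaces of the theorem. An arc in \<open>|G|\<close> meets only finitely many vertices, and
  between two consecutive ones it stays in one edge; this reduces everything to walks in \<open>G\<close>.\<close>

subsection \<open>Walks\<close>

text \<open>Why five: one edge beyond the cut vertex drives the walk through it, two edges at
  \<open>p\<close> make the remaining walk close up, and a supposed branch vertex costs two more,
  its third edge and the edge by which the cycle goes on. The edge by which the cycle arrives there
  is free, because the vertices before it are already known to have no third edge. On the
  topological side the obstacle is that degrees may be infinite, so \<open>|G|\<close> need be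
  neither locally compact nor metrizable. What helps is the weak topology: every set of vertices is
  closed, and closedness and continuity are tested edge by edge. The single edge is kept apart
  because it has neither a cycle nor a cut vertex. In the converse no graph occurs: each model space
  has arcs through any finite set, and this property is transported along the homeomorphism.\<close>

fun wedges :: "'v list \<Rightarrow> 'v set set" where
  "wedges (x # y # zs) = insert {x, y} (wedges (y # zs))"
| "wedges _ = {}"

text \<open>The vertex \<open>v\<close> is kept in both pieces, so the edges on either side of the
  cut survive; walks are cut and joined at a vertex in this form throughout.\<close>

lemma wedges_append_Cons: "wedges (xs @ v # ys) = wedges (xs @ [v]) \<union> wedges (v # ys)"
proof (induction xs)
  case (Cons x xs)
  then show ?case by (cases xs) auto
qed simp

lemma wedges_snoc: "wedges (xs @ [v]) = (if xs = [] then {} else insert {last xs, v} (wedges xs))"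
proof (induction xs)
  case (Cons x xs)
  then show ?case by (cases xs) auto
qed simp

lemma wedges_Cons: "wedges (v # ys) = (if ys = [] then {} else insert {v, hd ys} (wedges ys))"
  by (cases ys) auto

lemma wedges_rev: "wedges (rev xs) = wedges xs"
proof (induction xs)
  case (Cons x xs)
  then have "wedges (rev (x # xs)) = (if xs = [] then {} else insert {hd xs, x} (wedges xs))"
    by (simp add: wedges_snoc last_rev)
  then show ?case by (auto simp: wedges_Cons insert_commute)
qed simp

lemma wedges_subset: "e \<in> wedges xs \<Longrightarrow> e \<subseteq> set xs"
  by (induction xs rule: wedges.induct) auto

lemma wedges_nth: "e \<in> wedges xs \<longleftrightarrow> (\<exists>i. Suc i < length xs \<and> e = {xs ! i, xs ! Suc i})"
proof (induction xs rule: wedges.induct)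
  case (1 x y zs)
  show ?case (is "_ \<longleftrightarrow> (\<exists>i. ?P i)")
  proof -
    have "(\<exists>i. ?P i) \<longleftrightarrow> ?P 0 \<or> (\<exists>i. ?P (Suc i))"
      by (metis not0_implies_Suc)
    then show ?thesis using 1 by auto
  qed
qed auto

lemma Union_wedges: "2 \<le> length xs \<Longrightarrow> \<Union> (wedges xs) = set xs"
proof (induction xs rule: wedges.induct)
  case (1 x y zs)
  then show ?case by (cases zs) auto
qed auto

text \<open>With \<open>xs = []\<close> this says that a walk which never returns to its first
  vertex uses only one edge there, which is how \<open>closed_walk_at_root\<close> detects a
  return.\<close>

lemma wedges_neighbours:
  assumes "v \<notin> set xs" "v \<notin> set ys"
  shows "{v, y} \<in> wedges (xs @ v # ys) \<longleftrightarrow> xs \<noteq> [] \<and> y = last xs \<or> ys \<noteq> [] \<and> y = hd ys"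
proof -
  have "{v, y} \<notin> wedges xs" "{v, y} \<notin> wedges ys"
    using assms wedges_subset by blast+
  then show ?thesis
    using assms
    by (auto simp: wedges_append_Cons[of xs v ys] wedges_snoc wedges_Cons doubleton_eq_iff)
qed

lemma walk_stays:
  assumes "wedges ws \<subseteq> E" "ws \<noteq> []" "hd ws \<in> S" "\<And>x y. x \<in> S \<Longrightarrow> {x, y} \<in> E \<Longrightarrow> y \<in> S"
  shows "set ws \<subseteq> S"
  using assms(1-3)
proof (induction ws)
  case (Cons a ws)
  then show ?case using assms(4) by (cases ws) (auto simp: wedges_Cons)
qed simp

lemma wedges_rotate: "wedges (x # xs @ u # ys @ [x]) = wedges (u # ys @ x # xs @ [u])"
  using wedges_append_Cons[of "x # xs" u "ys @ [x]"] wedges_append_Cons[of "u # ys" x "xs @ [u]"]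
  by auto

text \<open>After the walk is rebased at \<open>z\<close>, the neighbours of \<open>z\<close> are
  the first and the last entry of the remaining list \<open>l\<close>; these differ because the
  cycle has at least three vertices.\<close>

lemma closed_walk_neighbours:
  assumes "distinct c" "3 \<le> length c" "z \<in> set c"
  shows "\<exists>a b. a \<noteq> b \<and> (\<forall>y. {z, y} \<in> wedges (c @ [hd c]) \<longleftrightarrow> y = a \<or> y = b)"
proof -
  obtain l where l: "distinct (z # l)" "2 \<le> length l" "wedges (c @ [hd c]) = wedges (z # l @ [z])"
  proof -
    obtain xs ys where c: "c = xs @ z # ys"
      using assms(3) by (meson split_list)
    show ?thesis
    proof (cases xs)
      case Nil
      then show ?thesis using that[of ys] c assms by auto
    next
      case (Cons x xs')
      have "wedges (c @ [hd c]) = wedges (z # (ys @ xs) @ [z])"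
        using wedges_rotate[of x xs' z ys] c Cons by simp
      then show ?thesis using that[of "ys @ xs"] c assms by auto
    qed
  qed
  obtain a b r where "l = a # b # r"
    using l(2) by (metis Suc_le_length_iff numeral_2_eq_2)
  then have "l \<noteq> []" "hd l \<noteq> last l"
    using l(1) last_in_set[of "b # r"] by auto
  have "{z, y} \<in> wedges (z # l @ [z]) \<longleftrightarrow> y = hd l \<or> y = last l" for y
    using l(1) \<open>l \<noteq> []\<close> wedges_subset[of "{z,y}" l]
    by (auto simp: wedges_Cons wedges_snoc doubleton_eq_iff)
  then show ?thesis
    using l(3) \<open>hd l \<noteq> last l\<close> by blast
qed

subsection \<open>Cut vertices\<close>

text \<open>The sides need not be connected: they are unions of components of the graph without
  \<open>p\<close>, so a cut vertex with many components is also covered by two sides.\<close>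

definition separation :: "'v set \<Rightarrow> 'v set set \<Rightarrow> 'v \<Rightarrow> 'v set \<Rightarrow> 'v set \<Rightarrow> bool" where
  "separation V E p A B \<longleftrightarrow> V = insert p (A \<union> B) \<and> p \<notin> A \<and> p \<notin> B \<and> A \<inter> B = {} \<and>
     A \<noteq> {} \<and> B \<noteq> {} \<and> (\<forall>x\<in>A. \<forall>y\<in>B. {x, y} \<notin> E)"

lemma separation_sym: "separation V E p A B \<Longrightarrow> separation V E p B A"
  unfolding separation_def by (metis Int_commute Un_commute insert_commute)

text \<open>Phrased with sets closed under adjacency, so that it is applied by exhibiting such a
  set, without producing paths.\<close>

definition connected_graph :: "'v set \<Rightarrow> 'v set set \<Rightarrow> bool" where
  "connected_graph V E \<longleftrightarrow>
     (\<forall>S \<subseteq> V. S \<noteq> {} \<and> (\<forall>x\<in>S. \<forall>y. {x, y} \<in> E \<longrightarrow> y \<in> S) \<longrightarrow> S = V)"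

lemma simple_graph_edgeD:
  assumes "simple_graph V E" "{x, y} \<in> E"
  shows "x \<in> V" "y \<in> V" "x \<noteq> y"
  using assms by (auto simp: simple_graph_def nsets_2_eq doubleton_eq_iff)

lemma simple_graph_edgeE:
  assumes "simple_graph V E" "e \<in> E"
  obtains x y where "e = {x, y}" "x \<in> V" "y \<in> V" "x \<noteq> y"
  using edge_ends[OF assms] by metis

lemma is_cycle_wedges:
  assumes "distinct c" "3 \<le> length c" "wedges (c @ [hd c]) \<subseteq> E"
  shows "is_cycle E c"
  unfolding is_cycle_def
proof (intro conjI allI impI)
  fix i assume i: "i < length c"
  have "{(c @ [hd c]) ! i, (c @ [hd c]) ! Suc i} \<in> wedges (c @ [hd c])"
    using i by (auto simp: wedges_nth)
  moreover have "(c @ [hd c]) ! Suc i = c ! (Suc i mod length c)"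
  proof (cases "Suc i = length c")
    case True
    then show ?thesis using i by (simp add: nth_append hd_conv_nth flip: length_greater_0_conv)
  next
    case False
    then show ?thesis using i by (simp add: nth_append)
  qed
  ultimately show "{c ! i, c ! (Suc i mod length c)} \<in> E"
    using i assms(3) by (auto simp: nth_append)
qed (use assms in auto)

text \<open>The connection is stopped at its first vertex in \<open>T\<close> and freed of loops: if
  the vertex to be prepended is already on the path, the part before that occurrence is
  dropped.\<close>

lemma path_to_set:
  assumes "(w, x) \<in> {(a, b). {a, b} \<in> E \<and> a \<noteq> u \<and> b \<noteq> u}\<^sup>*" "x \<in> T" "w \<noteq> u"
  shows "\<exists>l z. distinct (l @ [z]) \<and> hd (l @ [z]) = w \<and> z \<in> T \<and> set l \<inter> T = {} \<and>
    wedges (l @ [z]) \<subseteq> E \<and> u \<notin> set (l @ [z])"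
  using assms
proof (induction rule: converse_rtrancl_induct)
  case base
  then show ?case by (intro exI[of _ "[]"] exI[of _ x]) auto
next
  case (step w w')
  then obtain l z where l: "distinct (l @ [z])" "hd (l @ [z]) = w'" "z \<in> T" "set l \<inter> T = {}"
    "wedges (l @ [z]) \<subseteq> E" "u \<notin> set (l @ [z])" by auto
  show ?case
  proof (cases "w \<in> T")
    case True
    then show ?thesis using step.prems by (intro exI[of _ "[]"] exI[of _ w]) auto
  next
    case F: False
    show ?thesis
    proof (cases "w \<in> set l")
      case True
      then obtain l1 l2 where "l = l1 @ w # l2" by (meson split_list)
      then show ?thesis using l
        by (intro exI[of _ "w # l2"] exI[of _ z]) (auto simp: wedges_append_Cons[of l1 w "l2 @ [z]"])
    next
      case False
      then show ?thesis using l F step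
        by (intro exI[of _ "w # l"] exI[of _ z]) (auto simp: wedges_Cons)
    qed
  qed
qed

text \<open>If no vertex separates, the set of vertices that share a cycle with \<open>v\<close> is closed under
  adjacency: a cycle through \<open>v\<close> and \<open>u\<close> is rerouted through a neighbour \<open>w\<close> of \<open>u\<close> along a path
  from \<open>w\<close> back to the cycle that avoids \<open>u\<close>.\<close>

lemma separation_exists:
  assumes G: "simple_graph V E" and con: "connected_graph V E" and nc: "\<not> cyclically_connected V E"
  shows "(\<exists>u v. u \<noteq> v \<and> V = {u, v} \<and> E = {{u, v}}) \<or> (\<exists>p A B. separation V E p A B)"
proof (rule ccontr)
  assume neg: "\<not> ?thesis"
  then have nosep: "\<not> separation V E p A B" for p A B by blast
  \<comment> \<open>If \<open>x\<close> could not be reached from \<open>w\<close> without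
    \<open>u\<close>, the vertices reachable from \<open>w\<close> would form one side of a
    separation at \<open>u\<close>.\<close>
  have reach: "(w, x) \<in> {(a, b). {a, b} \<in> E \<and> a \<noteq> u \<and> b \<noteq> u}\<^sup>*" (is "_ \<in> ?R\<^sup>*")
    if "u \<in> V" "w \<in> V" "x \<in> V" "w \<noteq> u" "x \<noteq> u" for u w x
  proof (rule ccontr)
    assume n: "(w, x) \<notin> ?R\<^sup>*"
    define A where "A = {a \<in> V - {u}. (w, a) \<in> ?R\<^sup>*}"
    have "separation V E u A (V - {u} - A)"
      unfolding separation_def
    proof (intro conjI ballI notI)
      fix a b assume a: "a \<in> A" and b: "b \<in> V - {u} - A" and "{a, b} \<in> E"
      then have "(a, b) \<in> ?R" by (auto simp: A_def)
      then have "(w, b) \<in> ?R\<^sup>*" using a by (auto simp: A_def intro: rtrancl_into_rtrancl)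
      then show False using a b by (auto simp: A_def)
    next
      assume "A = {}"
      then show False using that by (auto simp: A_def)
    next
      assume "V - {u} - A = {}"
      then show False using that n by (auto simp: A_def)
    qed (use that in \<open>auto simp: A_def\<close>)
    then show False using nosep by blast
  qed
  obtain v w0 where vw0: "v \<in> V" "w0 \<in> V" "v \<noteq> w0" "\<And>c. is_cycle E c \<Longrightarrow> v \<in> set c \<Longrightarrow> w0 \<notin> set c"
    using nc by (auto simp: cyclically_connected_def)
  define S where "S = {w \<in> V. w = v \<or> (\<exists>c. distinct c \<and> 3 \<le> length c \<and>
    wedges (c @ [hd c]) \<subseteq> E \<and> v \<in> set c \<and> w \<in> set c)}"
  have "\<forall>u\<in>S. \<forall>w. {u, w} \<in> E \<longrightarrow> w \<in> S"
  proof (intro ballI allI impI)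
    fix u w assume u: "u \<in> S" and uw: "{u, w} \<in> E"
    have [simp]: "u \<in> V" "w \<in> V" "u \<noteq> w" using simple_graph_edgeD[OF G uw] by auto
    show "w \<in> S"
    proof (cases "u = v")
      case True
      \<comment> \<open>If \<open>w\<close> is the only neighbour of \<open>v\<close>, then either
        the graph is the single edge or \<open>w\<close> cuts off \<open>v\<close>;
        \<open>neg\<close> excludes both.\<close>
      have "\<exists>z. {v, z} \<in> E \<and> z \<noteq> w"
      proof (rule ccontr)
        assume n: "\<nexists>z. {v, z} \<in> E \<and> z \<noteq> w"
        have "\<exists>z\<in>V. z \<noteq> v \<and> z \<noteq> w"
        proof (rule ccontr)
          assume "\<not> (\<exists>z\<in>V. z \<noteq> v \<and> z \<noteq> w)"
          then have V: "V = {v, w}" using vw0 True by (auto intro: simp del: \<open>u \<in> V\<close>)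
          moreover have "E = {{v, w}}"
          proof -
            have "e = {v, w}" if "e \<in> E" for e
              using simple_graph_edgeE[OF G that] V by (metis doubleton_eq_iff empty_iff insert_iff)
            then show ?thesis using uw True by blast
          qed
          ultimately show False using neg True \<open>u \<noteq> w\<close> by blast
        qed
        then obtain z where z: "z \<in> V" "z \<noteq> v" "z \<noteq> w" by blast
        have "separation V E w {v} (V - {w} - {v})"
          unfolding separation_def using n z True vw0 \<open>u \<noteq> w\<close> \<open>w \<in> V\<close> by auto
        then show False using nosep by blast
      qed
      then obtain z where z: "{v, z} \<in> E" "z \<noteq> w" by blast
      have zv: "z \<in> V" "z \<noteq> v" using simple_graph_edgeD[OF G z(1)] by auto
      obtain l x where l: "distinct (l @ [x])" "hd (l @ [x]) = z" "x = w" "wedges (l @ [x]) \<subseteq> E"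
        "v \<notin> set (l @ [x])"
        using path_to_set[OF reach[of v z w], of "{w}"] zv vw0(1) \<open>w \<in> V\<close> \<open>u \<noteq> w\<close>[unfolded True] by auto
      have "l \<noteq> []" using l z by auto
      then have "3 \<le> length (v # l @ [w])" by (cases l) auto
      moreover have "wedges ((v # l @ [w]) @ [hd (v # l @ [w])]) \<subseteq> E"
        using l(2-4) z uw True wedges_append_Cons[of "v # l" w "[v]"]
        by (auto simp: wedges_Cons insert_commute)
      ultimately show ?thesis
        using l by (auto simp: S_def intro!: exI[of _ "v # l @ [w]"])
    next
      case False
      then obtain c0 where c0: "distinct c0" "3 \<le> length c0" "wedges (c0 @ [hd c0]) \<subseteq> E" "v \<in> set c0"
        "u \<in> set c0" using u by (auto simp: S_def)
      obtain d where d: "distinct (u # d)" "2 \<le> length d" "wedges (u # d @ [u]) \<subseteq> E" "v \<in> set d"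
      proof -
        obtain xs ys where c: "c0 = xs @ u # ys"
          using c0 by (meson split_list)
        show ?thesis
        proof (cases xs)
          case Nil
          then show ?thesis using that[of ys] c c0 False by auto
        next
          case (Cons x xs')
          have "wedges (c0 @ [hd c0]) = wedges (u # (ys @ xs) @ [u])"
            using wedges_rotate[of x xs' u ys] c Cons by simp
          then show ?thesis using that[of "ys @ xs"] c c0 False by auto
        qed
      qed
      show ?thesis
      proof (cases "w \<in> set d")
        case True
        then show ?thesis using d by (auto simp: S_def intro!: exI[of _ "u # d"])
      next
        case wd: False
        obtain l x where l: "distinct (l @ [x])" "hd (l @ [x]) = w" "x \<in> set d" "set l \<inter> set d = {}"
          "wedges (l @ [x]) \<subseteq> E" "u \<notin> set (l @ [x])"
          using path_to_set[OF reach[of u w v], of "set d"] d(4) vw0(1) False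
          \<open>u \<noteq> w\<close>[symmetric] by auto
        have ne: "l \<noteq> []" using l wd by auto
        \<comment> \<open>The detour runs from \<open>u\<close> through \<open>w\<close> to
          \<open>x\<close> and back to \<open>u\<close> along \<open>d2\<close>. The cycle is
          reversed if necessary, so that \<open>v\<close> lies on this part and not on the discarded
          \<open>d1\<close>.\<close>
        obtain d1 d2 where d': "distinct (u # d1 @ x # d2)" "set (d1 @ x # d2) = set d"
          "wedges (u # d1 @ x # d2 @ [u]) \<subseteq> E" "v \<in> set (x # d2)"
        proof -
          obtain d1 d2 where e: "d = d1 @ x # d2" using l(3) by (meson split_list)
          show ?thesis
          proof (cases "v \<in> set (x # d2)")
            case True
            then show ?thesis using that[of d1 d2] e d by auto
          next
            case False
            have "wedges (u # rev d @ [u]) \<subseteq> E"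
              using d(3) wedges_rev[of "u # d @ [u]"] by simp
            then show ?thesis using False that[of "rev d2" "rev d1"] e d by auto
          qed
        qed
        let ?c = "u # l @ x # d2"
        have "wedges (x # d2 @ [u]) \<subseteq> E"
          using d'(3) wedges_append_Cons[of "u # d1" x "d2 @ [u]"] by simp
        moreover have "wedges (u # l @ [x]) \<subseteq> E"
          using l ne uw by (auto simp: wedges_Cons)
        ultimately have "wedges (?c @ [hd ?c]) \<subseteq> E"
          using wedges_append_Cons[of "u # l" x "d2 @ [u]"] by simp
        moreover have "3 \<le> length ?c" using ne by (cases l) auto
        moreover have "distinct ?c" using l d' by auto
        moreover have "w \<in> set l" using ne l(2) by (cases l) auto
        ultimately show ?thesis
          using d'(4) by (auto simp: S_def intro!: exI[of _ "?c"])
      qed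
    qed
  qed
  moreover have "S \<subseteq> V" "v \<in> S" using vw0 by (auto simp: S_def)
  ultimately have "S = V" using con unfolding connected_graph_def by blast
  then have "w0 \<in> S" using vw0 by simp
  then show False using vw0 is_cycle_wedges unfolding S_def by blast
qed

subsection \<open>Graphs whose edges lie on walks\<close>

text \<open>\<open>walk_connected n V E\<close> and \<open>rooted_walk_connected n p E\<close> are what is left of \<open>n\<close>-arc-connectedness,
  and of its variant with arcs starting at \<open>p\<close>, when the points are interior points of edges.
  The first and last edge of the walk may be met by the arc only partially, hence the walk
  may return to itself there.\<close>

definition walk_connected :: "nat \<Rightarrow> 'v set set \<Rightarrow> bool" where
  "walk_connected n E \<longleftrightarrow> (\<forall>F \<subseteq> E. finite F \<and> F \<noteq> {} \<and> card F \<le> n \<longrightarrow>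
     (\<exists>s m t. distinct m \<and> m \<noteq> [] \<and> wedges (s # m @ [t]) \<subseteq> E \<and> F \<subseteq> wedges (s # m @ [t])))"

definition rooted_walk_connected :: "nat \<Rightarrow> 'v \<Rightarrow> 'v set set \<Rightarrow> bool" where
  "rooted_walk_connected n p E \<longleftrightarrow> (\<forall>F \<subseteq> E. finite F \<and> F \<noteq> {} \<and> card F \<le> n \<longrightarrow>
     (\<exists>m t. distinct (p # m) \<and> wedges (p # m @ [t]) \<subseteq> E \<and> F \<subseteq> wedges (p # m @ [t])))"

definition induced_edges :: "'v set set \<Rightarrow> 'v set \<Rightarrow> 'v set set" where
  "induced_edges E W = {e \<in> E. e \<subseteq> W}"

lemma simple_graph_induced: "simple_graph V E \<Longrightarrow> simple_graph W (induced_edges E W)"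
  by (auto simp: simple_graph_def induced_edges_def nsets_def)

section \<open>The two sides of a cut vertex\<close>

lemma separation_edges:
  assumes "simple_graph V E" "separation V E p A B"
  shows "E = induced_edges E (insert p A) \<union> induced_edges E (insert p B)"
    "induced_edges E (insert p A) \<inter> induced_edges E (insert p B) = {}"
proof -
  have "e \<in> induced_edges E (insert p A) \<union> induced_edges E (insert p B) \<and>
    e \<notin> induced_edges E (insert p A) \<inter> induced_edges E (insert p B)" if e: "e \<in> E" for e
  proof -
    obtain x y where "e = {x, y}" "x \<in> V" "y \<in> V" "x \<noteq> y"
      using simple_graph_edgeE[OF assms(1) e] .
    then show ?thesis
      using assms(2) e unfolding separation_def induced_edges_def
      by (auto simp: insert_commute)
  qed
  then show "E = induced_edges E (insert p A) \<union> induced_edges E (insert p B)"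
    "induced_edges E (insert p A) \<inter> induced_edges E (insert p B) = {}"
    by (auto simp: induced_edges_def)
qed

text \<open>Consecutive edges share an interior vertex of the walk. It is not \<open>p\<close>,
  hence belongs to one side only, and the walk cannot change sides there. The ends \<open>x\<close>
  and \<open>y\<close> may be \<open>p\<close>.\<close>

lemma walk_on_one_side:
  assumes "simple_graph V E" "separation V E p A B" "wedges (x # m @ [y]) \<subseteq> E" "p \<notin> set m"
  shows "wedges (x # m @ [y]) \<subseteq> induced_edges E (insert p A) \<or>
    wedges (x # m @ [y]) \<subseteq> induced_edges E (insert p B)"
  using assms(3,4)
proof (induction m arbitrary: x)
  case Nil
  then show ?case using separation_edges(1)[OF assms(1,2)] by auto
next
  case (Cons z m)
  have "{x, z} \<in> induced_edges E (insert p A) \<or> {x, z} \<in> induced_edges E (insert p B)"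
    using separation_edges(1)[OF assms(1,2)] Cons.prems by auto
  moreover have z: "z \<noteq> p" "{z, hd (m @ [y])} \<in> wedges (z # m @ [y])"
    using Cons.prems by (auto simp: wedges_Cons)
  moreover have "\<not> (z \<in> insert p A \<and> z \<in> insert p B)"
    using assms(2) z(1) by (auto simp: separation_def)
  ultimately show ?case using Cons.IH[of z] Cons.prems unfolding induced_edges_def by auto
qed

text \<open>An edge \<open>f\<close> of the other side forces \<open>p\<close> into the interior
  \<open>m\<close> of the walk, where it occurs once. Each half at \<open>p\<close> stays on one
  side, and the half that carries \<open>f\<close> carries nothing of \<open>F\<close>, so the other
  half carries all of it. If that is the first half, it is reversed to start at
  \<open>p\<close>.\<close>

lemma rooted_walk_connected_side:
  assumes G: "simple_graph V E" and con: "connected_graph V E" and W: "walk_connected 5 E"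
    and sep: "separation V E p A B"
  shows "rooted_walk_connected 4 p (induced_edges E (insert p A))"
  unfolding rooted_walk_connected_def
proof (intro allI impI)
  let ?EA = "induced_edges E (insert p A)" and ?EB = "induced_edges E (insert p B)"
  fix F assume F: "F \<subseteq> ?EA" "finite F \<and> F \<noteq> {} \<and> card F \<le> 4"
  obtain f where f: "f \<in> ?EB"
  proof -
    obtain b where b: "b \<in> B" using sep by (auto simp: separation_def)
    have "\<exists>y. {b, y} \<in> E"
    proof (rule ccontr)
      assume "\<nexists>y. {b, y} \<in> E"
      moreover have "{b} \<subseteq> V" using sep b by (auto simp: separation_def)
      ultimately have "{b} = V" using con unfolding connected_graph_def by blast
      then show False using sep b by (auto simp: separation_def)
    qed
    then obtain y where y: "{b, y} \<in> E" by blast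
    then have "{b, y} \<in> induced_edges E (insert p A) \<union> ?EB"
      using separation_edges(1)[OF G sep] by blast
    moreover have "b \<notin> insert p A" using sep b by (auto simp: separation_def)
    ultimately show ?thesis using that by (auto simp: induced_edges_def)
  qed
  have "insert f F \<subseteq> E"
    using F(1) f by (auto simp: induced_edges_def)
  moreover have "finite (insert f F)" "card (insert f F) \<le> 5"
    using F(2) card_insert_le_m1[of 5 F f] by auto
  ultimately obtain s m t
    where m: "distinct m" "wedges (s # m @ [t]) \<subseteq> E" "insert f F \<subseteq> wedges (s # m @ [t])"
    using W[unfolded walk_connected_def, rule_format, of "insert f F"] by blast
  have disj: "?EA \<inter> ?EB = {}" by (rule separation_edges[OF G sep])
  obtain g where g: "g \<in> F" using F by auto
  have "p \<in> set m"
  proof (rule ccontr)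
    assume "p \<notin> set m"
    then show False
      using walk_on_one_side[OF G sep m(2)] disj g f F(1) m(3) by blast
  qed
  then obtain l r where lr: "m = l @ p # r" by (meson split_list)
  then have p: "p \<notin> set l" "p \<notin> set r" using m by auto
  have w: "wedges (s # m @ [t]) = wedges (s # l @ [p]) \<union> wedges (p # r @ [t])"
    using wedges_append_Cons[of "s # l" p "r @ [t]"] lr by simp
  have 1: "wedges (s # l @ [p]) \<subseteq> ?EA \<or> wedges (s # l @ [p]) \<subseteq> ?EB"
    using walk_on_one_side[OF G sep _ p(1)] w m(2) by blast
  have 2: "wedges (p # r @ [t]) \<subseteq> ?EA \<or> wedges (p # r @ [t]) \<subseteq> ?EB"
    using walk_on_one_side[OF G sep _ p(2)] w m(2) by blast
  have "(F \<subseteq> wedges (s # l @ [p]) \<and> wedges (s # l @ [p]) \<subseteq> ?EA) \<or>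
    (F \<subseteq> wedges (p # r @ [t]) \<and> wedges (p # r @ [t]) \<subseteq> ?EA)"
  proof -
    have "F \<subseteq> wedges (s # l @ [p]) \<union> wedges (p # r @ [t])" "f \<in> wedges (s # l @ [p]) \<union> wedges (p # r @ [t])"
      using m(3) w by auto
    then show ?thesis using 1 2 disj f g F(1) by blast
  qed
  then show "\<exists>m t. distinct (p # m) \<and> wedges (p # m @ [t]) \<subseteq> ?EA \<and> F \<subseteq> wedges (p # m @ [t])"
  proof
    assume "F \<subseteq> wedges (s # l @ [p]) \<and> wedges (s # l @ [p]) \<subseteq> ?EA"
    then show ?thesis using wedges_rev[of "s # l @ [p]"] lr m(1) p
      by (intro exI[of _ "rev l"] exI[of _ s]) auto
  next
    assume "F \<subseteq> wedges (p # r @ [t]) \<and> wedges (p # r @ [t]) \<subseteq> ?EA"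
    then show ?thesis using lr m(1) p
      by (intro exI[of _ r] exI[of _ t]) auto
  qed
qed

text \<open>This serves as connectedness of a side: every edge is reached by a walk from
  \<open>p\<close>, and \<open>iso\<close> supplies an edge for each vertex.\<close>

lemma rooted_walk_connected_closed:
  assumes G: "simple_graph V E" and H: "rooted_walk_connected n p E" "1 \<le> n"
    and iso: "\<forall>x\<in>V. \<exists>y. {x, y} \<in> E"
    and S: "p \<in> S" "\<And>x y. x \<in> S \<Longrightarrow> {x, y} \<in> E \<Longrightarrow> y \<in> S"
  shows "V \<subseteq> S"
proof
  fix x assume "x \<in> V"
  then obtain y where xy: "{x, y} \<in> E" using iso by blast
  then obtain m t where m: "wedges (p # m @ [t]) \<subseteq> E" "{x, y} \<in> wedges (p # m @ [t])"
    using H unfolding rooted_walk_connected_def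
    by (metis (no_types, lifting) card.empty card_insert_disjoint empty_iff empty_subsetI finite.emptyI finite_insert
        insert_not_empty insert_subset One_nat_def)
  have "set (p # m @ [t]) \<subseteq> S"
    by (rule walk_stays[OF m(1)]) (use S in auto)
  then show "x \<in> S" using wedges_subset[OF m(2)] by auto
qed

text \<open>Since \<open>p\<close> does not occur in \<open>m\<close>, a walk that uses two edges at
  \<open>p\<close> can only do so by ending there, so \<open>t = p\<close>. This is the discrete
  form of an arc that comes back towards its starting point.\<close>

lemma closed_walk_at_root:
  assumes H: "rooted_walk_connected n p E" and F: "F \<subseteq> E" "finite F" "card F \<le> n"
    "{p, a} \<in> F" "{p, b} \<in> F" "a \<noteq> b"
  shows "\<exists>m. distinct (p # m) \<and> 2 \<le> length m \<and> wedges (p # m @ [p]) \<subseteq> E \<and>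
    F \<subseteq> wedges (p # m @ [p]) \<and> {hd m, last m} = {a, b}"
proof -
  obtain m t where m: "distinct (p # m)" "wedges (p # m @ [t]) \<subseteq> E" "F \<subseteq> wedges (p # m @ [t])"
    using H F unfolding rooted_walk_connected_def by (metis empty_iff)
  have "t = p"
  proof (rule ccontr)
    assume "t \<noteq> p"
    then have "{p, y} \<in> wedges (p # m @ [t]) \<Longrightarrow> y = hd (m @ [t])" for y
      using m(1) wedges_neighbours[of p "[]" "m @ [t]" y] by simp
    then show False using F m(3) by blast
  qed
  have p: "{p, y} \<in> wedges (p # m @ [p]) \<longleftrightarrow> m = [] \<and> y = p \<or> m \<noteq> [] \<and> (y = hd m \<or> y = last m)" for y
    using m(1) wedges_subset[of "{p, y}" m]
    by (auto simp: wedges_Cons wedges_snoc doubleton_eq_iff)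
  have ne: "m \<noteq> []" "a = hd m \<or> a = last m" "b = hd m \<or> b = last m"
    using p[of a] p[of b] F(4-6) m(3) \<open>t = p\<close> by auto
  have "2 \<le> length m"
  proof (rule ccontr)
    assume "\<not> 2 \<le> length m"
    moreover have "length m \<noteq> 0" using ne(1) by simp
    ultimately have "length m = 1" by linarith
    then obtain x where "m = [x]" by (auto simp: length_Suc_conv)
    then show False using ne F(6) by auto
  qed
  moreover have "{hd m, last m} = {a, b}" using ne F(6) by auto
  ultimately show ?thesis using m \<open>t = p\<close> by blast
qed

text \<open>A closed walk through three edges at \<open>p\<close> would have to leave or enter
  \<open>p\<close> by each of them, but it passes \<open>p\<close> only at its two ends.\<close>

lemma root_degree_le_2:
  assumes H: "rooted_walk_connected n p E" "3 \<le> n" 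
    and E: "{p, a} \<in> E" "{p, b} \<in> E" "{p, c} \<in> E" "a \<noteq> b"
  shows "c = a \<or> c = b"
proof -
  let ?F = "{{p, a}, {p, b}, {p, c}}"
  have "card ?F \<le> n" using H(2) card_length[of "[{p, a}, {p, b}, {p, c}]"] by simp
  then obtain m where m: "distinct (p # m)" "2 \<le> length m" "?F \<subseteq> wedges (p # m @ [p])" "{hd m, last m} = {a, b}"
    using closed_walk_at_root[OF H(1) _ _ _ _ _ E(4), of ?F] E(1-3) by fastforce
  have "{p, c} \<in> wedges (p # m @ [p])" "{p, c} \<notin> wedges m" using m wedges_subset[of "{p,c}" m] by auto
  then have "c = hd m \<or> c = last m"
    using m(1,2) by (auto simp: wedges_Cons wedges_snoc doubleton_eq_iff split: if_splits)
  then show ?thesis using m(4) by (auto simp: doubleton_eq_iff)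
qed

text \<open>The first vertex with a third edge on the cycle formed by a closed walk at the root would
  have degree three in every closed walk at the root through that edge and the next edge of
  the cycle.\<close>

lemma rooted_cycle:
  assumes G: "simple_graph V E" "p \<in> V" and H: "rooted_walk_connected 4 p E"
    and iso: "\<forall>x\<in>V. \<exists>y. {x, y} \<in> E"
    and ab: "{p, a} \<in> E" "{p, b} \<in> E" "a \<noteq> b"
  shows "\<exists>m. distinct (p # m) \<and> 2 \<le> length m \<and> V = set (p # m) \<and> E = wedges (p # m @ [p])"
proof -
  have "card {{p, a}, {p, b}} \<le> 4" using card_length[of "[{p, a}, {p, b}]"] by simp
  then obtain m where m: "distinct (p # m)" "2 \<le> length m" "wedges (p # m @ [p]) \<subseteq> E"
     "{hd m, last m} = {a, b}"
    using closed_walk_at_root[OF H _ _ _ _ _ ab(3), of "{{p, a}, {p, b}}"] ab(1,2) by fastforce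
  let ?W = "wedges (p # m @ [p])"
  have ne: "m \<noteq> []" using m(2) by auto
  have nb: "\<exists>y y'. y \<noteq> y' \<and> (\<forall>z. {x, z} \<in> wedges (p # k @ [p]) \<longleftrightarrow> z = y \<or> z = y')"
    if "distinct (p # k)" "2 \<le> length k" "x \<in> set (p # k)" for x k
    using closed_walk_neighbours[of "p # k" x] that by simp
  have inW: "{(p # m @ [p]) ! i, (p # m @ [p]) ! Suc i} \<in> ?W" if "i \<le> length m" for i
    unfolding wedges_nth using that by (intro exI[of _ i]) simp
  have main: "\<forall>y. {m ! j, y} \<in> E \<longrightarrow> {m ! j, y} \<in> ?W" if "j < length m" for j
    using that
  proof (induction j rule: less_induct)
    case (less j)
    show ?case
    proof (intro allI impI, rule ccontr)
      fix y assume y: "{m ! j, y} \<in> E" "{m ! j, y} \<notin> ?W"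
      define c where "c = p # m @ [p]"
      \<comment> \<open>The first two edges make the walk close up at \<open>p\<close>; the others
        are the edge by which the cycle leaves \<open>m ! j\<close> and the supposed third edge. The
        edge of arrival comes from \<open>cK\<close>. Indices in \<open>c\<close> are shifted by
        one: \<open>m ! j\<close> is \<open>c ! Suc j\<close>.\<close>
      let ?F = "{{p, a}, {p, b}, {c ! Suc j, c ! Suc (Suc j)}, {m ! j, y}}"
      have cW: "{c ! i, c ! Suc i} \<in> ?W" if "i \<le> length m" for i
        using inW[OF that] by (simp add: c_def)
      have cj: "c ! Suc i = m ! i" if "i < length m" for i using that by (simp add: c_def nth_append)
      have "?F \<subseteq> E" using ab y(1) cW[of "Suc j"] less.prems m(3) by auto
      moreover have "card ?F \<le> 4"
        using card_length[of "[{p, a}, {p, b}, {c ! Suc j, c ! Suc (Suc j)}, {m ! j, y}]"] by simp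
      ultimately obtain k where k: "distinct (p # k)" "2 \<le> length k" "wedges (p # k @ [p]) \<subseteq> E" 
        "?F \<subseteq> wedges (p # k @ [p])"
        using closed_walk_at_root[OF H _ _ _ _ _ ab(3), of ?F] by fastforce
      let ?K = "wedges (p # k @ [p])"
      \<comment> \<open>At each earlier vertex, \<open>less.IH\<close> places both edges of the new
        closed walk among the two edges of \<open>?W\<close>, so both walks use the same edges
        there. Hence the new one follows \<open>?W\<close> from \<open>p\<close> to
        \<open>m ! j\<close>.\<close>
      have cK: "{c ! i, c ! Suc i} \<in> ?K" if "i \<le> j" for i
        using that
      proof (induction i)
        case 0
        have "hd m \<in> {a, b}" using m(4) by auto
        then show ?case using k(4) ne by (auto simp: c_def nth_append hd_conv_nth)
      next
        case (Suc i)
        have z: "c ! Suc i = m ! i" using cj Suc less.prems by simp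
        have "m ! i \<in> set (p # k)" using Suc wedges_subset[of "{c ! i, c ! Suc i}"] z by fastforce
        then obtain y1 y2 where y12: "y1 \<noteq> y2" "\<forall>w. {m ! i, w} \<in> ?K \<longleftrightarrow> w = y1 \<or> w = y2"
          using nb[OF k(1,2)] by meson
        obtain z1 z2 where z12: "\<forall>w. {m ! i, w} \<in> ?W \<longleftrightarrow> w = z1 \<or> w = z2"
          using nb[OF m(1,2), of "m ! i"] Suc.prems less.prems by auto
        have "{m ! i, y1} \<in> ?W" "{m ! i, y2} \<in> ?W"
          using less.IH[of i] Suc.prems less.prems y12 k(3) by auto
        then have "{m ! i, w} \<in> ?W \<longleftrightarrow> {m ! i, w} \<in> ?K" for w
          using y12 z12 by metis
        then show ?case using cW[of "Suc i"] Suc.prems less.prems z by simp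
      qed
      have z: "c ! Suc j = m ! j" using cj less.prems by simp
      have K: "{m ! j, c ! j} \<in> ?K" "{m ! j, c ! Suc (Suc j)} \<in> ?K" "{m ! j, y} \<in> ?K"
        using cK[of j] k(4) z by (auto simp: insert_commute)
      have "m ! j \<in> set (p # k)" using wedges_subset[OF K(1)] by auto
      \<comment> \<open>Distinctness of \<open>p # m\<close> suffices except at the last vertex,
        whose successor on the cycle is \<open>p\<close> again; there
        \<open>2 \<le> length m\<close> makes its predecessor differ from \<open>p\<close>.\<close>
      moreover have "c ! j \<noteq> c ! Suc (Suc j)"
      proof
        assume eq: "c ! j = c ! Suc (Suc j)"
        show False
        proof (cases "Suc j = length m")
          case True
          then obtain i where "j = Suc i" using m(2) by (cases j) auto
          then show False using eq True m(1) less.prems by (auto simp: c_def nth_append)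
        next
          case False
          then have "(p # m) ! j = (p # m) ! Suc (Suc j)"
            using eq less.prems by (auto simp: c_def nth_append nth_Cons split: nat.splits)
          then show False using m(1) False less.prems nth_eq_iff_index_eq[OF m(1), of j "Suc (Suc j)"] by simp
        qed
      qed
      moreover have "y \<noteq> c ! j" "y \<noteq> c ! Suc (Suc j)"
        using y(2) cW[of j] cW[of "Suc j"] less.prems z by (auto simp: insert_commute)
      ultimately show False using nb[OF k(1,2), of "m ! j"] K by metis
    qed
  qed
  have mainp: "{p, y} \<in> ?W" if "{p, y} \<in> E" for y
    using root_degree_le_2[OF H _ ab(1,2) that ab(3)] m(4) ne
    by (auto simp: wedges_Cons wedges_snoc doubleton_eq_iff insert_commute)
  have all: "{x, y} \<in> ?W" if "{x, y} \<in> E" "x \<in> set (p # m)" for x y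
    using that main mainp by (auto simp: in_set_conv_nth)
  have "V \<subseteq> set (p # m)"
    using rooted_walk_connected_closed[OF G(1) H _ iso, of "set (p # m)"] all wedges_subset by fastforce
  moreover have "set (p # m) \<subseteq> V"
  proof
    fix x assume "x \<in> set (p # m)"
    then obtain y where "{x, y} \<in> ?W" using nb[OF m(1,2)] by blast
    then show "x \<in> V" using m(3) simple_graph_edgeD(1)[OF G(1)] by blast
  qed
  moreover have "E \<subseteq> ?W"
    using all simple_graph_edgeE[OF G(1)] calculation by (metis subsetI subset_antisym)
  ultimately show ?thesis using m by blast
qed

text \<open>Only the last vertex may have edges off the list: a stem records how far the graph,
  followed from \<open>p\<close>, is forced to be a path.\<close>

definition stem :: "'v \<Rightarrow> 'v set set \<Rightarrow> 'v list \<Rightarrow> bool" where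
  "stem p E vs \<longleftrightarrow> distinct vs \<and> 2 \<le> length vs \<and> hd vs = p \<and> wedges vs \<subseteq> E \<and>
     (\<forall>x\<in>set (butlast vs). \<forall>y. {x, y} \<in> E \<longrightarrow> {x, y} \<in> wedges vs)"

definition cycle_at :: "'v \<Rightarrow> 'v set \<Rightarrow> 'v set set \<Rightarrow> bool" where
  "cycle_at p V E \<longleftrightarrow>
     (\<exists>m. distinct (p # m) \<and> 2 \<le> length m \<and> V = set (p # m) \<and> E = wedges (p # m @ [p]))"

definition path_from_to :: "'v \<Rightarrow> 'v \<Rightarrow> 'v set \<Rightarrow> 'v set set \<Rightarrow> bool" where
  "path_from_to p q V E \<longleftrightarrow>
     (\<exists>vs. distinct vs \<and> 2 \<le> length vs \<and> hd vs = p \<and> last vs = q \<and> V = set vs \<and> E = wedges vs)"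

definition ray_from :: "'v \<Rightarrow> 'v set \<Rightarrow> 'v set set \<Rightarrow> bool" where
  "ray_from p V E \<longleftrightarrow>
     (\<exists>v :: nat \<Rightarrow> 'v. inj v \<and> v 0 = p \<and> V = range v \<and> E = range (\<lambda>i. {v i, v (Suc i)}))"

text \<open>The complex of such a graph is the wedge of the two complexes at \<open>p\<close>. Two
  simple graphs with one common vertex have no common edge.\<close>

definition amalgam :: "'v \<Rightarrow> 'v set \<Rightarrow> 'v set set \<Rightarrow> 'v set \<Rightarrow> 'v set set \<Rightarrow> 'v set \<Rightarrow> 'v set set \<Rightarrow> bool" where
  "amalgam p V1 E1 V2 E2 V E \<longleftrightarrow> V = V1 \<union> V2 \<and> E = E1 \<union> E2 \<and> V1 \<inter> V2 = {p} \<and>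
     simple_graph V1 E1 \<and> simple_graph V2 E2"

text \<open>Here \<open>p\<close> is the endpoint of the lollipop and \<open>a\<close> the point
  where stick and circle meet; they differ because the path has an edge.\<close>

definition lollipop_from :: "'v \<Rightarrow> 'v set \<Rightarrow> 'v set set \<Rightarrow> bool" where
  "lollipop_from p V E \<longleftrightarrow>
     (\<exists>a V1 E1 V2 E2. path_from_to p a V1 E1 \<and> cycle_at a V2 E2 \<and> amalgam a V1 E1 V2 E2 V E)"

text \<open>The vertex \<open>b\<close> is new, because all edges at earlier vertices already lie on
  the stem.\<close>

lemma stem_snoc:
  assumes G: "simple_graph V E" and vs: "stem p E vs" and b: "{last vs, b} \<in> E" "{last vs, b} \<notin> wedges vs"
    and unique: "\<And>y. {last vs, y} \<in> E \<Longrightarrow> {last vs, y} \<notin> wedges vs \<Longrightarrow> y = b"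
  shows "stem p E (vs @ [b])"
proof -
  have ne: "vs \<noteq> []" using vs by (auto simp: stem_def)
  have set: "set vs = insert (last vs) (set (butlast vs))"
    using ne by (metis append_butlast_last_id list.simps(15) rotate1.simps(2) set_rotate1)
  have "b \<noteq> last vs" using simple_graph_edgeD(3)[OF G b(1)] by simp
  moreover have "b \<notin> set (butlast vs)"
    using vs b unfolding stem_def by (metis insert_commute)
  ultimately have "b \<notin> set vs" using set by simp
  then show ?thesis
    using vs b(1) ne set unfolding stem_def by (auto simp: wedges_snoc dest: unique)
qed

text \<open>A stem stops at a vertex with no further edge or at one with at least two. If neither
  ever happened, every stem would extend by one vertex and the chain of stems would yield a ray.
  That the path or the ray exhausts the graph follows from connectedness to
  \<open>p\<close>.\<close>

lemma rooted_stem: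
  assumes G: "simple_graph V E" "p \<in> V" and H: "rooted_walk_connected n p E" "1 \<le> n"
    and iso: "\<forall>x\<in>V. \<exists>y. {x, y} \<in> E"
    and q: "{p, q} \<in> E" "\<And>y. {p, y} \<in> E \<Longrightarrow> y = q"
  shows "(\<exists>a. path_from_to p a V E) \<or> ray_from p V E \<or>
    (\<exists>vs b b'. stem p E vs \<and> {last vs, b} \<in> E - wedges vs \<and> {last vs, b'} \<in> E - wedges vs \<and> b \<noteq> b')"
proof (rule ccontr)
  assume neg: "\<not> ?thesis"
  have closed: "V \<subseteq> S" if "p \<in> S" "\<And>x y. x \<in> S \<Longrightarrow> {x, y} \<in> E \<Longrightarrow> y \<in> S" for S
    using rooted_walk_connected_closed[OF G(1) H iso that] .
  have ext: "\<exists>b. stem p E (vs @ [b])" if vs: "stem p E vs" for vs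
  proof -
    have "vs \<noteq> []" using vs by (auto simp: stem_def)
    then have ne: "vs \<noteq> []" "p \<in> set vs" using vs hd_in_set unfolding stem_def by blast+
    have set: "set vs = insert (last vs) (set (butlast vs))"
      using ne by (metis append_butlast_last_id list.simps(15) rotate1.simps(2) set_rotate1)
    have "\<exists>b. {last vs, b} \<in> E \<and> {last vs, b} \<notin> wedges vs"
    proof (rule ccontr)
      assume n: "\<nexists>b. {last vs, b} \<in> E \<and> {last vs, b} \<notin> wedges vs"
      have all: "{x, y} \<in> wedges vs" if "x \<in> set vs" "{x, y} \<in> E" for x y
      proof (cases "x = last vs")
        case True
        then show ?thesis using that n by blast
      next
        case False
        then have "x \<in> set (butlast vs)" using that(1) set by blast
        then show ?thesis using that(2) vs unfolding stem_def by blast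
      qed
      have "V \<subseteq> set vs"
        using closed[of "set vs"] ne all wedges_subset by fastforce
      moreover have "E \<subseteq> wedges vs"
        using all simple_graph_edgeE[OF G(1)] calculation by (metis subset_iff)
      moreover have "set vs \<subseteq> V"
      proof -
        have "\<Union> E \<subseteq> V" using G(1) by (auto simp: simple_graph_def nsets_def)
        then show ?thesis using Union_wedges[of vs] vs unfolding stem_def by blast
      qed
      ultimately show False
        using neg vs unfolding path_from_to_def stem_def by blast
    qed
    then show ?thesis using stem_snoc[OF G(1) vs] neg vs by blast
  qed
  have "p \<noteq> q" using simple_graph_edgeD(3)[OF G(1) q(1)] .
  have "\<exists>L. \<forall>n. (stem p E (L n) \<and> length (L n) = Suc (Suc n)) \<and> (\<exists>b. L (Suc n) = L n @ [b])"
  proof (rule dependent_nat_choice)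
    show "\<exists>x. stem p E x \<and> length x = Suc (Suc 0)"
      using q(1) \<open>p \<noteq> q\<close> by (intro exI[of _ "[p, q]"]) (auto simp: stem_def dest: q(2))
  next
    fix x n assume x: "stem p E x \<and> length x = Suc (Suc n)"
    then obtain b where "stem p E (x @ [b])" using ext by blast
    then show "\<exists>y. (stem p E y \<and> length y = Suc (Suc (Suc n))) \<and> (\<exists>b. y = x @ [b])"
      using x by (intro exI[of _ "x @ [b]"]) auto
  qed
  then obtain L where L: "\<And>n. stem p E (L n)" "\<And>n. length (L n) = Suc (Suc n)"
    "\<And>n. \<exists>b. L (Suc n) = L n @ [b]" by metis
  \<comment> \<open>Each list extends the previous ones, so entry \<open>i\<close> of
    \<open>L i\<close> is entry \<open>i\<close> of all later lists; the diagonal is the limit of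
    the chain.\<close>
  define v where "v = (\<lambda>i. L i ! i)"
  have nth: "L n ! i = v i" if "i \<le> Suc n" for n i
  proof -
    have "L (n + k) ! j = L n ! j" if "j < length (L n)" for n k j
      using that
    proof (induction k)
      case (Suc k)
      obtain b where "L (Suc (n + k)) = L (n + k) @ [b]" using L(3) by blast
      then show ?case using Suc L(2) by (simp add: nth_append)
    qed simp
    note * = this
    show ?thesis
    proof (cases "i = Suc n")
      case True
      then show ?thesis using *[of i n 1] L(2) by (simp add: v_def)
    next
      case False
      then show ?thesis using *[of i i "n - i"] L(2) that by (simp add: v_def)
    qed
  qed
  have "inj v"
  proof (rule injI)
    fix i j assume "v i = v j"
    then have "L (max i j) ! i = L (max i j) ! j" by (simp add: nth)
    then show "i = j" using L(1)[of "max i j"] L(2)[of "max i j"]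
      by (simp add: stem_def nth_eq_iff_index_eq)
  qed
  have we: "wedges (L n) \<subseteq> range (\<lambda>i. {v i, v (Suc i)})" for n
  proof
    fix e assume "e \<in> wedges (L n)"
    then obtain i where "Suc i < length (L n)" "e = {L n ! i, L n ! Suc i}" by (auto simp: wedges_nth)
    then show "e \<in> range (\<lambda>i. {v i, v (Suc i)})" using L(2) by (auto simp: nth)
  qed
  have edges: "{v i, y} \<in> range (\<lambda>i. {v i, v (Suc i)})" if "{v i, y} \<in> E" for i y
  proof -
    have "butlast (L i) ! i = v i" "i < length (butlast (L i))" using L(2)[of i] by (auto simp: nth_butlast v_def)
    then have "v i \<in> set (butlast (L i))" by (metis nth_mem)
    then have "{v i, y} \<in> wedges (L i)" using L(1)[of i] that by (auto simp: stem_def)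
    then show ?thesis using we by blast
  qed
  have ve: "{v i, v (Suc i)} \<in> E" for i
  proof -
    have "{L i ! i, L i ! Suc i} \<in> wedges (L i)" using L(2)[of i] by (auto simp: wedges_nth)
    then show ?thesis using L(1)[of i] by (auto simp: stem_def nth)
  qed
  have "v 0 = p" using L(1)[of 0] L(2)[of 0] unfolding stem_def v_def
    by (metis hd_conv_nth list.size(3) nat.distinct(1))
  have "V \<subseteq> range v"
  proof (rule closed)
    show "p \<in> range v" using \<open>v 0 = p\<close> by blast
    fix x y assume "x \<in> range v" "{x, y} \<in> E"
    then show "y \<in> range v" using edges by (fastforce simp: doubleton_eq_iff)
  qed
  moreover have "range v \<subseteq> V" using ve simple_graph_edgeD(1)[OF G(1)] by blast
  moreover have "E \<subseteq> range (\<lambda>i. {v i, v (Suc i)})"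
  proof
    fix e assume "e \<in> E"
    then obtain x y where "e = {x, y}" "x \<in> V" using simple_graph_edgeE[OF G(1)] by metis
    then show "e \<in> range (\<lambda>i. {v i, v (Suc i)})" using edges \<open>e \<in> E\<close> \<open>V \<subseteq> range v\<close> by blast
  qed
  ultimately have "ray_from p V E"
    unfolding ray_from_def using \<open>inj v\<close> \<open>v 0 = p\<close> ve by blast
  then show False using neg by blast
qed

text \<open>For vertices of \<open>A\<close> the edge comes from connectedness of the whole graph,
  for \<open>p\<close> it is the first edge of any rooted walk.\<close>

lemma side_no_isolated:
  assumes G: "simple_graph V E" and con: "connected_graph V E" and sep: "separation V E p A B"
    and H: "rooted_walk_connected n p (induced_edges E (insert p A))" "1 \<le> n"
  shows "\<forall>x\<in>insert p A. \<exists>y. {x, y} \<in> induced_edges E (insert p A)" (is "\<forall>x\<in>_. \<exists>y. _ \<in> ?EA")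
proof -
  have A: "\<exists>y. {x, y} \<in> ?EA" if x: "x \<in> A" for x
  proof -
    have "\<exists>y. {x, y} \<in> E"
    proof (rule ccontr)
      assume "\<nexists>y. {x, y} \<in> E"
      moreover have "{x} \<subseteq> V" using sep x by (auto simp: separation_def)
      ultimately have "{x} = V" using con unfolding connected_graph_def by blast
      then show False using sep x by (auto simp: separation_def)
    qed
    then obtain y where "{x, y} \<in> E" by blast
    then have "{x, y} \<in> ?EA \<union> induced_edges E (insert p B)"
      using separation_edges(1)[OF G sep] by blast
    moreover have "x \<notin> insert p B" using sep x by (auto simp: separation_def)
    ultimately show ?thesis by (auto simp: induced_edges_def)
  qed
  obtain x where "x \<in> A" using sep by (auto simp: separation_def)
  then obtain e where "e \<in> ?EA" using A by blast
  then obtain m t where "wedges (p # m @ [t]) \<subseteq> ?EA"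
    using H(1)[unfolded rooted_walk_connected_def, rule_format, of "{e}"] H(2) by auto
  then have "{p, hd (m @ [t])} \<in> ?EA" by (simp add: wedges_Cons)
  then show ?thesis using A by blast
qed

lemma side_cycle:
  assumes G: "simple_graph V E" and con: "connected_graph V E" and W: "walk_connected 5 E"
    and sep: "separation V E p A B"
    and ab: "{p, a} \<in> induced_edges E (insert p A)" "{p, b} \<in> induced_edges E (insert p A)" "a \<noteq> b"
  shows "cycle_at p (insert p A) (induced_edges E (insert p A))"
proof -
  note H = rooted_walk_connected_side[OF G con W sep]
  show ?thesis
    unfolding cycle_at_def
    using rooted_cycle[OF simple_graph_induced[OF G] _ H side_no_isolated[OF G con sep H] ab] by simp
qed

text \<open>A branch vertex \<open>a\<close> at the end of the stem cuts off what lies beyond it,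
  and its two further edges make that part a cycle by \<open>side_cycle\<close>. The new separation
  belongs to the conclusion, because \<open>walk_connected_cases\<close> needs to know that a
  lollipop side provides a cut vertex with a cyclic side.\<close>

lemma side_cases:
  assumes G: "simple_graph V E" and con: "connected_graph V E" and W: "walk_connected 5 E"
    and sep: "separation V E p A B"
  defines "VA \<equiv> insert p A" and "EA \<equiv> induced_edges E (insert p A)"
  shows "cycle_at p VA EA \<or> (\<exists>a. path_from_to p a VA EA) \<or> ray_from p VA EA \<or>
    lollipop_from p VA EA \<and>
      (\<exists>a A' B'. separation V E a A' B' \<and> cycle_at a (insert a A') (induced_edges E (insert a A')))"
proof -
  note H = rooted_walk_connected_side[OF G con W sep, folded EA_def]
  note GA = simple_graph_induced[OF G, of "insert p A", folded VA_def EA_def, unfolded VA_def[symmetric]]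
  have iso: "\<forall>x\<in>VA. \<exists>y. {x, y} \<in> EA"
    using side_no_isolated[OF G con sep] H unfolding VA_def EA_def by simp
  have pV: "p \<in> VA" by (simp add: VA_def)
  then obtain q where q: "{p, q} \<in> EA" using iso by blast
  show ?thesis
  proof (cases "\<exists>y. {p, y} \<in> EA \<and> y \<noteq> q")
    case True
    then show ?thesis using side_cycle[OF G con W sep] q unfolding VA_def EA_def by blast
  next
    case False
    then have q': "y = q" if "{p, y} \<in> EA" for y using that by blast
    consider "(\<exists>a. path_from_to p a VA EA) \<or> ray_from p VA EA"
      | vs b b' where "stem p EA vs" "{last vs, b} \<in> EA - wedges vs" "{last vs, b'} \<in> EA - wedges vs" "b \<noteq> b'"
      using rooted_stem[OF GA[unfolded EA_def VA_def, folded EA_def VA_def] pV H _ iso q q'] by fastforce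
    then show ?thesis
    proof cases
      case 1
      then show ?thesis by blast
    next
      case 2
      define a where "a = last vs"
      note vs = 2(1)[unfolded stem_def]
      have "vs \<noteq> []" using vs by auto
      then have ne: "vs \<noteq> []" "p \<in> set vs" using vs hd_in_set by blast+
      have set: "x \<in> set vs \<longleftrightarrow> x = a \<or> x \<in> set (butlast vs)" "a \<notin> set (butlast vs)" for x
      proof -
        have "vs = butlast vs @ [a]" using ne by (simp add: a_def)
        then have "set vs = set (butlast vs @ [a])" "distinct (butlast vs @ [a])" using vs by metis+
        then show "x \<in> set vs \<longleftrightarrow> x = a \<or> x \<in> set (butlast vs)" "a \<notin> set (butlast vs)" for x by auto
      qed
      have pb: "p \<in> set (butlast vs)"
        using vs by (cases vs) (auto split: if_splits)
      have vsV: "set vs \<subseteq> VA"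
      proof -
        have "\<Union> EA \<subseteq> VA" by (auto simp: EA_def VA_def induced_edges_def)
        then show ?thesis using Union_wedges[of vs] vs by blast
      qed
      have out: "b \<notin> set vs" if "{a, b} \<in> EA - wedges vs" for b
      proof -
        have "a \<noteq> b" using that simple_graph_edgeD(3)[OF G] unfolding EA_def induced_edges_def by blast
        moreover have "b \<notin> set (butlast vs)" using that vs by (metis Diff_iff insert_commute)
        ultimately show ?thesis by (simp add: set(1))
      qed
      \<comment> \<open>\<open>A'\<close> is what lies beyond the stem. All the rest except
        \<open>a\<close>, including \<open>p\<close> and the old other side, goes into
        \<open>B'\<close>.\<close>
      define A' where "A' = VA - set vs"
      define B' where "B' = V - {a} - A'"
      have bA: "b \<in> A'" "b' \<in> A'"
        using out 2(2,3) unfolding A'_def a_def EA_def VA_def induced_edges_def by auto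
      have VA: "VA \<subseteq> V" using sep by (auto simp: VA_def separation_def)
      have aV: "a \<in> VA" using set vsV by blast
      \<comment> \<open>A neighbour of \<open>x\<close> in \<open>B'\<close> would lie on the stem
        before \<open>a\<close>, where every edge of the side belongs to the stem.\<close>
      have noedge: "{x, y} \<notin> E" if "x \<in> A'" "y \<in> B'" for x y
      proof
        assume xy: "{x, y} \<in> E"
        have "x \<in> A" using that(1) ne unfolding A'_def VA_def by blast
        moreover have "y \<in> V" using that(2) by (simp add: B'_def)
        ultimately have "y \<in> VA" using sep xy unfolding separation_def VA_def by blast
        then have "y \<in> set (butlast vs)" using that(2) set by (auto simp: B'_def A'_def)
        moreover have "{y, x} \<in> EA"
          using xy \<open>y \<in> VA\<close> \<open>x \<in> A\<close> by (auto simp: EA_def VA_def induced_edges_def insert_commute)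
        ultimately have "{y, x} \<in> wedges vs" using vs by blast
        then show False using that(1) wedges_subset unfolding A'_def by blast
      qed
      have sep': "separation V E a A' B'"
        unfolding separation_def
      proof (intro conjI ballI)
        show "V = insert a (A' \<union> B')" using VA aV by (auto simp: A'_def B'_def)
        show "a \<notin> A'" by (simp add: A'_def set(1))
        show "A' \<noteq> {}" using bA by blast
        have "p \<in> B'" using VA pV ne(2) pb set(2) by (auto simp: A'_def B'_def)
        then show "B' \<noteq> {}" by blast
      qed (use noedge in \<open>auto simp: B'_def\<close>)
      let ?E' = "induced_edges E (insert a A')"
      have "{a, b} \<in> ?E'" "{a, b'} \<in> ?E'"
        using 2(2,3) bA unfolding EA_def induced_edges_def a_def by auto
      then have cyc: "cycle_at a (insert a A') ?E'"
        using side_cycle[OF G con W sep' _ _ 2(4)] by blast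
      have "path_from_to p a (set vs) (wedges vs)"
        using vs unfolding path_from_to_def a_def by blast
      moreover have "amalgam a (set vs) (wedges vs) (insert a A') ?E' VA EA"
        unfolding amalgam_def
      proof (intro conjI)
        show "VA = set vs \<union> insert a A'" using vsV set unfolding A'_def by blast
        show "set vs \<inter> insert a A' = {a}" using set unfolding A'_def by blast
        show "simple_graph (insert a A') ?E'" by (rule simple_graph_induced[OF G])
        show "simple_graph (set vs) (wedges vs)"
        proof -
          have "wedges vs \<subseteq> E" using vs unfolding EA_def induced_edges_def by auto
          then show ?thesis using G wedges_subset unfolding simple_graph_def nsets_def by blast
        qed
        show "EA = wedges vs \<union> ?E'"
        proof
          show "wedges vs \<union> ?E' \<subseteq> EA"
            using vs aV unfolding EA_def induced_edges_def A'_def VA_def by blast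
          show "EA \<subseteq> wedges vs \<union> ?E'"
          proof
            fix e assume e: "e \<in> EA"
            then obtain x y where xy: "e = {x, y}"
              using simple_graph_edgeE[OF G] unfolding EA_def induced_edges_def by blast
            show "e \<in> wedges vs \<union> ?E'"
            proof (cases "x \<in> set (butlast vs) \<or> y \<in> set (butlast vs)")
              case True
              then show ?thesis using vs e xy by (metis UnI1 insert_commute)
            next
              case False
              then show ?thesis using e xy set unfolding EA_def VA_def A'_def induced_edges_def by blast
            qed
          qed
        qed
      qed
      ultimately have "lollipop_from p VA EA"
        unfolding lollipop_from_def using cyc by blast
      then show ?thesis using sep' cyc by blast
    qed
  qed
qed

lemma separation_amalgam:
  assumes "simple_graph V E" "separation V E p A B"
  shows "amalgam p (insert p A) (induced_edges E (insert p A)) (insert p B) (induced_edges E (insert p B)) V E"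
  using assms separation_edges(1)[OF assms] simple_graph_induced[OF assms(1)]
  unfolding amalgam_def separation_def by auto

text \<open>A cut vertex with a cyclic side is preferred. If there is none, lollipop sides are
  excluded as well, since each of them provides such a cut vertex; so two lollipops, or a lollipop
  and a path, need no case of their own.\<close>

proposition walk_connected_cases:
  assumes G: "simple_graph V E" and con: "connected_graph V E" and nc: "\<not> cyclically_connected V E"
    and W: "walk_connected 5 E"
  obtains u v where "path_from_to u v V E"
  | p V1 E1 V2 E2 where "amalgam p V1 E1 V2 E2 V E" "cycle_at p V1 E1"
      "cycle_at p V2 E2 \<or> (\<exists>a. path_from_to p a V2 E2) \<or> ray_from p V2 E2 \<or> lollipop_from p V2 E2"
  | p V1 E1 V2 E2 where "amalgam p V1 E1 V2 E2 V E"
      "(\<exists>a. path_from_to p a V1 E1) \<or> ray_from p V1 E1" "(\<exists>a. path_from_to p a V2 E2) \<or> ray_from p V2 E2"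
proof (cases "\<exists>p A B. separation V E p A B")
  case False
  then obtain u v where uv: "u \<noteq> v" "V = {u, v}" "E = {{u, v}}"
    using separation_exists[OF G con nc] by blast
  then have "path_from_to u v V E"
    unfolding path_from_to_def by (intro exI[of _ "[u, v]"]) auto
  then show ?thesis by (rule that(1))
next
  case True
  show ?thesis
  proof (cases "\<exists>p A B. separation V E p A B \<and> cycle_at p (insert p A) (induced_edges E (insert p A))")
    case True
    then obtain p A B where 1: "separation V E p A B" "cycle_at p (insert p A) (induced_edges E (insert p A))"
      by blast
    show ?thesis
      by (rule that(2)[OF separation_amalgam[OF G 1(1)] 1(2)])
        (use side_cases[OF G con W separation_sym[OF 1(1)]] in blast)
  next
    case False
    obtain p A B where 1: "separation V E p A B" using True by blast
    show ?thesis
      by (rule that(3)[OF separation_amalgam[OF G 1]])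
        (use False side_cases[OF G con W 1] side_cases[OF G con W separation_sym[OF 1]] 1 separation_sym[OF 1] in blast)+
  qed
qed

subsection \<open>The topology of the 1-complex\<close>

definition vertex_pt :: "'v \<Rightarrow> ('v + 'v set) \<times> real" where
  "vertex_pt v = (Inl v, 0)"

text \<open>The characteristic map of the closed edge; at 0 and 1 its values are vertices.
  \<open>open_edge\<close> is its image without the ends.\<close>

definition edge_pt :: "'v set \<Rightarrow> real \<Rightarrow> ('v + 'v set) \<times> real" where
  "edge_pt e t = glue (Inr e, t)"

definition open_edge :: "'v set \<Rightarrow> (('v + 'v set) \<times> real) set" where
  "open_edge e = Pair (Inr e) ` {0<..<1}"

lemma edge_pt_simps [simp]:
  "edge_pt e 0 = vertex_pt (edge_end0 e)"
  "edge_pt e 1 = vertex_pt (edge_end1 e)"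
  "0 < t \<Longrightarrow> t < 1 \<Longrightarrow> edge_pt e t = (Inr e, t)"
  by (auto simp: edge_pt_def vertex_pt_def glue_def)

lemma vertex_pt_eq [simp]: "vertex_pt v = vertex_pt w \<longleftrightarrow> v = w"
  by (auto simp: vertex_pt_def)

lemma vertex_pt_notin_open_edge [simp]: "vertex_pt v \<notin> open_edge e"
  by (auto simp: vertex_pt_def open_edge_def)

lemma mem_open_edge [simp]:
  "(Inr e', t) \<in> open_edge e \<longleftrightarrow> e' = e \<and> 0 < t \<and> t < 1" "(Inl v, t) \<notin> open_edge e"
  by (auto simp: open_edge_def)

lemma mem_vertex_pts [simp]: "(Inr e, t) \<notin> vertex_pt ` V" "(Inl v, t) \<in> vertex_pt ` V \<longleftrightarrow> t = 0 \<and> v \<in> V"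
  by (auto simp: vertex_pt_def)

lemma open_edge_disjoint: "x \<in> open_edge e \<Longrightarrow> x \<in> open_edge e' \<Longrightarrow> e = e'"
  by (auto simp: open_edge_def)

lemma edge_pt_cases:
  assumes "t \<in> {0..1}"
  shows "t = 0 \<and> edge_pt e t = vertex_pt (edge_end0 e) \<or> t = 1 \<and> edge_pt e t = vertex_pt (edge_end1 e) \<or>
    0 < t \<and> t < 1 \<and> edge_pt e t = (Inr e, t)"
  using assms edge_pt_simps by (metis atLeastAtMost_iff order_le_less)

lemma topspace_one_complex:
  assumes "simple_graph V E"
  shows "topspace (one_complex V E) = vertex_pt ` V \<union> (\<Union>e\<in>E. open_edge e)"
proof -
  have "topspace (cell_sum V E) = (\<lambda>v. (Inl v, 0)) ` V \<union> (\<Union>e\<in>E. Pair (Inr e) ` {0..1})"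
    by (auto simp: cell_sum_def)
  then have "topspace (one_complex V E) = vertex_pt ` V \<union> (\<Union>e\<in>E. edge_pt e ` {0..1})"
    unfolding one_complex_def topspace_quotient_topology
    by (simp add: image_Un image_UN image_image vertex_pt_def edge_pt_def glue_def[of "(Inl _, _)"])
  also have "\<dots> = vertex_pt ` V \<union> (\<Union>e\<in>E. open_edge e)"
  proof -
    have 1: "edge_pt e t \<in> vertex_pt ` V \<union> open_edge e" if "e \<in> E" "t \<in> {0..1}" for e t
      using edge_pt_cases[OF that(2), of e] edge_ends(3,4)[OF assms that(1)]
      by (elim disjE) (auto simp: open_edge_def)
    have 2: "open_edge e \<subseteq> edge_pt e ` {0..1}" for e :: "'a set"
    proof
      fix x assume "x \<in> open_edge e"
      then obtain t where "x = (Inr e, t)" "0 < t" "t < 1" by (auto simp: open_edge_def)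
      then have "x = edge_pt e t" "t \<in> {0..1}" by auto
      then show "x \<in> edge_pt e ` {0..1}" by blast
    qed
    have "edge_pt e ` {0..1} \<subseteq> vertex_pt ` V \<union> open_edge e" if "e \<in> E" for e
      using 1[OF that] by blast
    then have "(\<Union>e\<in>E. edge_pt e ` {0..1}) \<subseteq> vertex_pt ` V \<union> (\<Union>e\<in>E. open_edge e)" by blast
    moreover have "(\<Union>e\<in>E. open_edge e) \<subseteq> (\<Union>e\<in>E. edge_pt e ` {0..1})"
      by (rule UN_mono[OF order_refl 2])
    moreover have "P \<union> Q = P \<union> R" if "Q \<subseteq> P \<union> R" "R \<subseteq> Q" for P Q R :: "(('a + 'a set) \<times> real) set"
      using that by blast
    ultimately show ?thesis by presburger
  qed
  finally show ?thesis .
qed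

lemma edge_pt_in_topspace:
  assumes "simple_graph V E" "e \<in> E" "t \<in> {0..1}"
  shows "edge_pt e t \<in> topspace (one_complex V E)"
  using edge_pt_cases[OF assms(3), of e] edge_ends(3,4)[OF assms(1,2)] assms(2)
  unfolding topspace_one_complex[OF assms(1)] open_edge_def
  by (elim disjE) (auto intro!: bexI[of _ e])

text \<open>The weak topology in usable form: vertices are discrete in the sum, so only the edges
  impose conditions.\<close>

lemma closedin_one_complex:
  assumes "simple_graph V E"
  shows "closedin (one_complex V E) K \<longleftrightarrow>
    K \<subseteq> topspace (one_complex V E) \<and> (\<forall>e\<in>E. closed {t \<in> {0..1}. edge_pt e t \<in> K})"
proof -
  have q: "quotient_map (cell_sum V E) (one_complex V E) glue"
    unfolding one_complex_def by (rule quotient_map_quotient_topology)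
  have "closedin (one_complex V E) K \<longleftrightarrow> K \<subseteq> topspace (one_complex V E) \<and>
     closedin (cell_sum V E) {x \<in> topspace (cell_sum V E). glue x \<in> K}"
    using q closedin_subset unfolding quotient_map_closedin by (metis (no_types, lifting))
  moreover have "closedin (cell_sum V E) {x \<in> topspace (cell_sum V E). glue x \<in> K} \<longleftrightarrow>
    (\<forall>e\<in>E. closed {t \<in> {0..1}. edge_pt e t \<in> K})"
  proof -
    have "closedin (top_of_set {0}) {x. x = 0 \<and> P x}" for P :: "real \<Rightarrow> bool"
    proof (cases "P 0")
      case True
      then have "{x. x = 0 \<and> P x} = {0}" by auto
      then show ?thesis by simp
    next
      case False
      then have "{x. x = 0 \<and> P x} = {}" by auto
      then show ?thesis by (simp only: closedin_empty)
    qed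
    moreover have "closedin (top_of_set {0..1}) {t. 0 \<le> t \<and> t \<le> 1 \<and> glue (Inr e, t) \<in> K} \<longleftrightarrow>
      closed {t \<in> {0..1}. edge_pt e t \<in> K}" for e
    proof -
      have "{t. 0 \<le> t \<and> t \<le> 1 \<and> glue (Inr e, t) \<in> K} = {t \<in> {0..1}. edge_pt e t \<in> K}"
        by (auto simp: edge_pt_def)
      then show ?thesis by (auto simp: closedin_closed_eq)
    qed
    ultimately show ?thesis
      by (auto simp: cell_sum_def closedin_sum_topology ball_Un Plus_def)
  qed
  ultimately show ?thesis by simp
qed

text \<open>Every edge meets such a set at most in its two ends. As all subsets are covered, the
  vertices form a closed discrete subspace, whatever their degrees.\<close>

lemma closedin_vertices:
  assumes "simple_graph V E" "U \<subseteq> V"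
  shows "closedin (one_complex V E) (vertex_pt ` U)"
  unfolding closedin_one_complex[OF assms(1)]
proof (intro conjI ballI)
  show "vertex_pt ` U \<subseteq> topspace (one_complex V E)"
    using assms(2) topspace_one_complex[OF assms(1)] by blast
  fix e assume "e \<in> E"
  have "{t \<in> {0..1}. edge_pt e t \<in> vertex_pt ` U} \<subseteq> {0, 1}"
  proof
    fix t assume "t \<in> {t \<in> {0..1}. edge_pt e t \<in> vertex_pt ` U}"
    then show "t \<in> {0, 1}"
      using edge_pt_cases[of t e] by (auto simp: vertex_pt_def)
  qed
  then show "closed {t \<in> {0..1}. edge_pt e t \<in> vertex_pt ` U}"
    by (meson finite.emptyI finite.insertI finite_imp_closed finite_subset)
qed

text \<open>An edge outside the subcomplex meets \<open>K\<close> at most in its ends, and finite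
  traces are closed.\<close>

lemma closedin_subcomplex:
  assumes G: "simple_graph V E" and G': "simple_graph V' E'" and sub: "V' \<subseteq> V" "E' \<subseteq> E"
  shows "closedin (one_complex V' E') K \<longleftrightarrow>
    closedin (one_complex V E) K \<and> K \<subseteq> topspace (one_complex V' E')"
proof
  assume K: "closedin (one_complex V' E') K"
  have K': "K \<subseteq> topspace (one_complex V' E')" using K by (rule closedin_subset)
  have "closed {t \<in> {0..1}. edge_pt e t \<in> K}" if e: "e \<in> E" for e
  proof (cases "e \<in> E'")
    case True
    then show ?thesis using K closedin_one_complex[OF G'] by blast
  next
    case False
    have "{t \<in> {0..1}. edge_pt e t \<in> K} \<subseteq> {0, 1}"
    proof
      fix t assume t: "t \<in> {t \<in> {0..1}. edge_pt e t \<in> K}"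
      have "(Inr e, t) \<notin> K" using K' False
        by (auto simp: topspace_one_complex[OF G'] vertex_pt_def open_edge_def)
      then show "t \<in> {0, 1}"
        using edge_pt_cases[of t e] t by (metis (no_types, lifting) insertI1 insertI2 mem_Collect_eq)
    qed
    then show ?thesis
      by (meson finite.emptyI finite.insertI finite_imp_closed finite_subset)
  qed
  moreover have "K \<subseteq> topspace (one_complex V E)"
    using K' sub unfolding topspace_one_complex[OF G] topspace_one_complex[OF G'] by blast
  ultimately show "closedin (one_complex V E) K \<and> K \<subseteq> topspace (one_complex V' E')"
    using K' closedin_one_complex[OF G] by blast
next
  assume K: "closedin (one_complex V E) K \<and> K \<subseteq> topspace (one_complex V' E')"
  then have "\<forall>e\<in>E. closed {t \<in> {0..1}. edge_pt e t \<in> K}"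
    using closedin_one_complex[OF G] by blast
  then show "closedin (one_complex V' E') K"
    unfolding closedin_one_complex[OF G'] using K sub(2) by blast
qed

lemma subtopology_subcomplex:
  assumes G: "simple_graph V E" and G': "simple_graph V' E'" and sub: "V' \<subseteq> V" "E' \<subseteq> E"
  shows "closedin (one_complex V E) (topspace (one_complex V' E'))"
    and "subtopology (one_complex V E) (topspace (one_complex V' E')) = one_complex V' E'"
proof -
  show 1: "closedin (one_complex V E) (topspace (one_complex V' E'))"
    using closedin_subcomplex[OF assms] closedin_topspace by blast
  show "subtopology (one_complex V E) (topspace (one_complex V' E')) = one_complex V' E'"
  proof -
    have top: "topspace (subtopology (one_complex V E) (topspace (one_complex V' E'))) = topspace (one_complex V' E')"
      using closedin_subset[OF 1] by (simp add: Int_absorb1)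
    show ?thesis
      unfolding topology_eq openin_closedin_eq top closedin_closed_subtopology[OF 1]
        closedin_subcomplex[OF assms] by blast
  qed
qed

text \<open>The complement is the subcomplex obtained by deleting the edges of
  \<open>F\<close>.\<close>

lemma openin_open_edge:
  assumes "simple_graph V E" "F \<subseteq> E"
  shows "openin (one_complex V E) (\<Union>e\<in>F. open_edge e)"
proof -
  have G': "simple_graph V (E - F)" using assms by (auto simp: simple_graph_def)
  have "(\<Union>e\<in>F. open_edge e) = topspace (one_complex V E) - topspace (one_complex V (E - F))"
  proof (rule set_eqI)
    fix x :: "('a + 'a set) \<times> real"
    obtain a t where "x = (a, t)" by fastforce
    then show "x \<in> (\<Union>e\<in>F. open_edge e) \<longleftrightarrow> x \<in> topspace (one_complex V E) - topspace (one_complex V (E - F))"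
      using assms(2)
      by (cases a) (auto simp: topspace_one_complex[OF assms(1)] topspace_one_complex[OF G'])
  qed
  then show ?thesis
    using subtopology_subcomplex(1)[OF assms(1) G'] by (simp add: openin_diff)
qed

lemma closedin_closed_edge:
  assumes "simple_graph V E" "e \<in> E"
  shows "closedin (one_complex V E) (vertex_pt ` e \<union> open_edge e)"
proof -
  have "simple_graph e {e}" "e \<subseteq> V"
    using assms by (auto simp: simple_graph_def nsets_def)
  then show ?thesis
    using subtopology_subcomplex(1)[OF assms(1), of e "{e}"] assms(2)
      topspace_one_complex[of e "{e}"] by simp
qed

lemma continuous_map_one_complex:
  assumes G: "simple_graph V E"
    and im: "f \<in> topspace (one_complex V E) \<rightarrow> topspace Y"
    and cont: "\<And>e. e \<in> E \<Longrightarrow> continuous_map (top_of_set {0..1}) Y (f \<circ> edge_pt e)"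
  shows "continuous_map (one_complex V E) Y f"
  unfolding continuous_map_closedin
proof (intro conjI im allI impI)
  fix C assume C: "closedin Y C"
  show "closedin (one_complex V E) {x \<in> topspace (one_complex V E). f x \<in> C}"
    unfolding closedin_one_complex[OF G]
  proof (intro conjI ballI)
    fix e assume e: "e \<in> E"
    have "{t \<in> {0..1}. edge_pt e t \<in> {x \<in> topspace (one_complex V E). f x \<in> C}} =
      {t \<in> topspace (top_of_set {0..1}). (f \<circ> edge_pt e) t \<in> C}"
      using edge_pt_in_topspace[OF G e] by auto
    moreover have "closedin (top_of_set {0..1}) \<dots>"
      using cont[OF e] C unfolding continuous_map_closedin by blast
    ultimately show "closed {t \<in> {0..1}. edge_pt e t \<in> {x \<in> topspace (one_complex V E). f x \<in> C}}"
      by (metis closedin_closed_eq closed_real_atLeastAtMost)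
  qed blast
qed

text \<open>Closedness of the pieces on both sides makes the pasted map continuous and closed.
  Injectivity needs \<open>int\<close>: a point in both images must come from a common point of both
  pieces.\<close>

lemma homeomorphic_map_paste:
  assumes AB: "closedin X A" "closedin X B" "A \<union> B = topspace X"
    and CD: "closedin Y C" "closedin Y D" "C \<union> D = topspace Y"
    and f: "homeomorphic_map (subtopology X A) (subtopology Y C) f"
    and g: "homeomorphic_map (subtopology X B) (subtopology Y D) g"
    and eq: "\<And>x. x \<in> A \<Longrightarrow> x \<in> B \<Longrightarrow> f x = g x" and int: "C \<inter> D \<subseteq> f ` (A \<inter> B)"
  shows "homeomorphic_map X Y (\<lambda>x. if x \<in> A then f x else g x)" (is "homeomorphic_map X Y ?h")
proof (rule bijective_closed_imp_homeomorphic_map)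
  have top: "topspace (subtopology X A) = A" "topspace (subtopology X B) = B"
    "topspace (subtopology Y C) = C" "topspace (subtopology Y D) = D"
    using AB CD by (auto dest: closedin_subset)
  have im: "f ` A = C" "g ` B = D"
    using f g homeomorphic_imp_surjective_map top by metis+
  have inj: "inj_on f A" "inj_on g B"
    using f g homeomorphic_eq_everything_map top by metis+
  have hA: "?h x = f x" if "x \<in> A" for x using that by simp
  have hB: "?h x = g x" if "x \<in> B" for x using that eq by simp
  show "continuous_map X Y ?h"
    unfolding continuous_map_closedin
  proof (intro conjI allI impI)
    have fC: "f x \<in> C" if "x \<in> A" for x using that im by blast
    have gD: "g x \<in> D" if "x \<in> B" for x using that im by blast
    show "?h \<in> topspace X \<rightarrow> topspace Y"
      using fC gD AB(3) CD(3) by (auto simp flip: AB(3) CD(3))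
    fix K assume K: "closedin Y K"
    have "closedin (subtopology X A) {x \<in> A. f x \<in> K \<inter> C}"
      using homeomorphic_imp_continuous_map[OF f] K unfolding continuous_map_closedin top
      by (metis closedin_subtopology)
    moreover have "closedin (subtopology X B) {x \<in> B. g x \<in> K \<inter> D}"
      using homeomorphic_imp_continuous_map[OF g] K unfolding continuous_map_closedin top
      by (metis closedin_subtopology)
    ultimately have "closedin X ({x \<in> A. f x \<in> K \<inter> C} \<union> {x \<in> B. g x \<in> K \<inter> D})"
      using AB closedin_trans_full by (metis closedin_Un)
    moreover have "{x \<in> topspace X. ?h x \<in> K} = {x \<in> A. f x \<in> K \<inter> C} \<union> {x \<in> B. g x \<in> K \<inter> D}"
      by (auto simp flip: AB(3) simp: fC gD eq)
    ultimately show "closedin X {x \<in> topspace X. ?h x \<in> K}" by simp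
  qed
  show "closed_map X Y ?h"
    unfolding closed_map_def
  proof (intro allI impI)
    fix K assume K: "closedin X K"
    have "closedin (subtopology Y C) (f ` (K \<inter> A))"
      using homeomorphic_imp_closed_map[OF f] K unfolding closed_map_def by (metis closedin_subtopology)
    moreover have "closedin (subtopology Y D) (g ` (K \<inter> B))"
      using homeomorphic_imp_closed_map[OF g] K unfolding closed_map_def by (metis closedin_subtopology)
    ultimately have "closedin Y (f ` (K \<inter> A) \<union> g ` (K \<inter> B))"
      using CD closedin_trans_full by (metis closedin_Un)
    moreover have "?h ` K = f ` (K \<inter> A) \<union> g ` (K \<inter> B)"
    proof -
      have "K = (K \<inter> A) \<union> (K \<inter> B)" using closedin_subset[OF K] AB(3) by blast
      then have "?h ` K = ?h ` (K \<inter> A) \<union> ?h ` (K \<inter> B)" by (metis image_Un)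
      also have "\<dots> = f ` (K \<inter> A) \<union> g ` (K \<inter> B)" using hA hB by (intro arg_cong2[where f = "(\<union>)"] image_cong) auto
      finally show ?thesis .
    qed
    ultimately show "closedin Y (?h ` K)" by simp
  qed
  have "?h ` topspace X = ?h ` A \<union> ?h ` B" using AB(3) by blast
  also have "\<dots> = f ` A \<union> g ` B" using hA hB by (intro arg_cong2[where f = "(\<union>)"] image_cong) auto
  finally show "?h ` topspace X = topspace Y" using im CD(3) by simp
  have cross: "x = y" if "x \<in> A" "y \<in> B" "f x = g y" for x y
  proof -
    have "f x \<in> C" "g y \<in> D" using that(1,2) im by blast+
    then have "f x \<in> C \<inter> D" using that(3) by simp
    then obtain z where z: "z \<in> A" "z \<in> B" "f x = f z" using int by blast
    then show ?thesis using that eq inj by (metis inj_onD)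
  qed
  show "inj_on ?h (topspace X)"
  proof (rule inj_onI)
    fix x y assume xy: "x \<in> topspace X" "y \<in> topspace X" "?h x = ?h y"
    consider "x \<in> A" "y \<in> A" | "x \<in> A" "y \<in> B" | "x \<in> B" "y \<in> A" | "x \<in> B" "y \<in> B"
      using xy AB(3) by blast
    then show "x = y"
    proof cases
      case 1 then show ?thesis using xy(3) hA inj(1) by (metis inj_onD)
    next
      case 2 then show ?thesis using xy(3) hA[of x] hB[of y] cross by metis
    next
      case 3 then show ?thesis using xy(3) hA[of y] hB[of x] cross by metis
    next
      case 4 then show ?thesis using xy(3) hB inj(2) by (metis inj_onD)
    qed
  qed
qed

lemma topspace_Int_one_complex:
  assumes "simple_graph V1 E1" "simple_graph V2 E2" "E1 \<inter> E2 = {}"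
  shows "topspace (one_complex V1 E1) \<inter> topspace (one_complex V2 E2) = vertex_pt ` (V1 \<inter> V2)"
proof (rule set_eqI)
  fix x :: "('a + 'a set) \<times> real"
  obtain a t where "x = (a, t)" by fastforce
  then show "x \<in> topspace (one_complex V1 E1) \<inter> topspace (one_complex V2 E2) \<longleftrightarrow>
    x \<in> vertex_pt ` (V1 \<inter> V2)"
    using assms(3)
    by (cases a) (auto simp: topspace_one_complex[OF assms(1)] topspace_one_complex[OF assms(2)])
qed

lemma homeomorphic_map_union_graph:
  assumes G: "simple_graph V1 E1" "simple_graph V2 E2" and disj: "E1 \<inter> E2 = {}"
    and f: "homeomorphic_map (one_complex V1 E1) (top_of_set C) f"
    and g: "homeomorphic_map (one_complex V2 E2) (top_of_set D) g"
    and eq: "\<And>v. v \<in> V1 \<inter> V2 \<Longrightarrow> f (vertex_pt v) = g (vertex_pt v)"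
    and int: "C \<inter> D \<subseteq> f ` vertex_pt ` (V1 \<inter> V2)"
    and CD: "closedin (top_of_set (C \<union> D)) C" "closedin (top_of_set (C \<union> D)) D"
  shows "\<exists>h. homeomorphic_map (one_complex (V1 \<union> V2) (E1 \<union> E2)) (top_of_set (C \<union> D)) h \<and>
    (\<forall>v\<in>V1. h (vertex_pt v) = f (vertex_pt v)) \<and> (\<forall>v\<in>V2. h (vertex_pt v) = g (vertex_pt v))"
proof -
  let ?X = "one_complex (V1 \<union> V2) (E1 \<union> E2)"
  let ?A = "topspace (one_complex V1 E1)" and ?B = "topspace (one_complex V2 E2)"
  have G12: "simple_graph (V1 \<union> V2) (E1 \<union> E2)"
    using G by (auto simp: simple_graph_def nsets_def)
  note A = subtopology_subcomplex[OF G12 G(1)] and B = subtopology_subcomplex[OF G12 G(2)]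
  have C: "subtopology (top_of_set (C \<union> D)) C = top_of_set C" "subtopology (top_of_set (C \<union> D)) D = top_of_set D"
    by (simp_all add: subtopology_subtopology Int_absorb1)
  note AB = topspace_Int_one_complex[OF G disj]
  have "homeomorphic_map ?X (top_of_set (C \<union> D)) (\<lambda>x. if x \<in> ?A then f x else g x)"
  proof (rule homeomorphic_map_paste)
    show "?A \<union> ?B = topspace ?X"
      by (auto simp: topspace_one_complex G G12)
    show "f x = g x" if "x \<in> ?A" "x \<in> ?B" for x
    proof -
      have "x \<in> vertex_pt ` (V1 \<inter> V2)" using that AB by blast
      then show ?thesis using eq by auto
    qed
    show "C \<inter> D \<subseteq> f ` (?A \<inter> ?B)" using int AB by simp
    show "homeomorphic_map (subtopology ?X ?A) (subtopology (top_of_set (C \<union> D)) C) f"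
      "homeomorphic_map (subtopology ?X ?B) (subtopology (top_of_set (C \<union> D)) D) g"
      using f g A(2) B(2) C by simp_all
    show "closedin ?X ?A" "closedin ?X ?B" using A(1) B(1) by simp_all
  qed (use CD in simp_all)
  moreover have "vertex_pt v \<in> ?A \<longleftrightarrow> v \<in> V1" for v
    by (auto simp: topspace_one_complex[OF G(1)])
  ultimately show ?thesis using eq by (intro exI[of _ "\<lambda>x. if x \<in> ?A then f x else g x"]) auto
qed

subsection \<open>Arcs in the 1-complex\<close>

text \<open>Suppose the vertex times accumulate at \<open>l\<close>. By injectivity the vertex times
  other than \<open>l\<close> are exactly the preimage of a set of vertices, hence closed; so they
  would contain \<open>l\<close>.\<close>

lemma finite_vertex_times:
  assumes G: "simple_graph V E" and cont: "continuous_map (top_of_set {0..1}) (one_complex V E) \<gamma>"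
    and inj: "inj_on \<gamma> {0..1::real}"
  shows "finite {t \<in> {0..1}. \<gamma> t \<in> vertex_pt ` V}" (is "finite ?T")
proof (rule ccontr)
  assume "infinite ?T"
  then obtain l where l: "l islimpt ?T"
    using Heine_Borel_imp_Bolzano_Weierstrass[of "{0..1::real}" ?T] by (metis (no_types, lifting)
      compact_Icc mem_Collect_eq subsetI)
  define T' where "T' = ?T - {l}"
  have "\<gamma> ` T' \<subseteq> vertex_pt ` V" by (auto simp: T'_def)
  then obtain U where U: "U \<subseteq> V" "\<gamma> ` T' = vertex_pt ` U" by (metis subset_imageE)
  have "closedin (top_of_set {0..1}) {t \<in> {0..1}. \<gamma> t \<in> \<gamma> ` T'}"
    using cont closedin_vertices[OF G U(1)] U(2) unfolding continuous_map_closedin by simp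
  moreover have "{t \<in> {0..1}. \<gamma> t \<in> \<gamma> ` T'} = T'"
    using inj by (auto simp: T'_def dest: inj_onD)
  ultimately have "closed T'" by (simp add: closedin_closed_eq)
  moreover have "l islimpt T'" using l unfolding islimpt_def T'_def by blast
  ultimately have "l \<in> T'" using closed_limpt by blast
  then show False by (simp add: T'_def)
qed

text \<open>The open interval is connected and is covered by two disjoint open sets, the times in
  \<open>open_edge e\<close> and the times in other open edges. The end times stay in the closed
  edge because that is closed.\<close>

lemma between_vertex_times:
  assumes G: "simple_graph V E" and cont: "continuous_map (top_of_set {0..1}) (one_complex V E) \<gamma>"
    and ab: "0 \<le> a" "a < b" "b \<le> (1::real)"
    and nv: "\<forall>t\<in>{a<..<b}. \<gamma> t \<notin> vertex_pt ` V"
  shows "\<exists>e\<in>E. (\<forall>t\<in>{a<..<b}. \<gamma> t \<in> open_edge e) \<and> (\<forall>t\<in>{a..b}. \<gamma> t \<in> vertex_pt ` e \<union> open_edge e)"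
proof -
  let ?X = "one_complex V E"
  have top: "\<gamma> t \<in> topspace ?X" if "t \<in> {0..1}" for t
    using continuous_map_image_subset_topspace[OF cont] that by auto
  have ex: "\<exists>e\<in>E. \<gamma> t \<in> open_edge e" if "t \<in> {a<..<b}" for t
    using top[of t] nv that ab unfolding topspace_one_complex[OF G] by auto
  have "(a + b) / 2 \<in> {a<..<b}" using ab by auto
  then obtain e where e: "e \<in> E" "\<gamma> ((a + b) / 2) \<in> open_edge e" using ex by blast
  have "\<exists>P. open P \<and> {t \<in> {0..1}. \<gamma> t \<in> (\<Union>e\<in>F. open_edge e)} = {0..1} \<inter> P" if "F \<subseteq> E" for F
  proof -
    have "openin (top_of_set {0..1}) {t \<in> {0..1}. \<gamma> t \<in> (\<Union>e\<in>F. open_edge e)}"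
      using openin_continuous_map_preimage[OF cont openin_open_edge[OF G that]] by simp
    then show ?thesis by (meson openin_open)
  qed
  from this[of "{e}"] this[of "E - {e}"] e(1) obtain P Q where PQ: "open P" "open Q"
    "{t \<in> {0..1}. \<gamma> t \<in> open_edge e} = {0..1} \<inter> P"
    "{t \<in> {0..1}. \<gamma> t \<in> (\<Union>e\<in>E - {e}. open_edge e)} = {0..1} \<inter> Q" by auto
  have P: "t \<in> P \<longleftrightarrow> \<gamma> t \<in> open_edge e" and Q: "t \<in> Q \<longleftrightarrow> (\<exists>e'\<in>E-{e}. \<gamma> t \<in> open_edge e')"
    if "t \<in> {a<..<b}" for t
  proof -
    have t: "t \<in> {0..1}" using that ab by auto
    show "t \<in> P \<longleftrightarrow> \<gamma> t \<in> open_edge e"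
      using arg_cong[OF PQ(3), of "\<lambda>S. t \<in> S"] t by simp
    show "t \<in> Q \<longleftrightarrow> (\<exists>e'\<in>E-{e}. \<gamma> t \<in> open_edge e')"
      using arg_cong[OF PQ(4), of "\<lambda>S. t \<in> S"] t by simp
  qed
  have "P \<inter> {a<..<b} = {} \<or> Q \<inter> {a<..<b} = {}"
  proof (rule connectedD[OF _ PQ(1,2)])
    show "P \<inter> Q \<inter> {a<..<b} = {}" using P Q open_edge_disjoint by blast
    show "{a<..<b} \<subseteq> P \<union> Q" using P Q ex by blast
  qed simp
  then have Q0: "Q \<inter> {a<..<b} = {}" using P e(2) \<open>(a + b) / 2 \<in> {a<..<b}\<close> by blast
  have in_e: "\<gamma> t \<in> open_edge e" if "t \<in> {a<..<b}" for t
    using ex[OF that] Q[OF that] Q0 that by blast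
  have "closedin (top_of_set {0..1}) {t \<in> {0..1}. \<gamma> t \<in> vertex_pt ` e \<union> open_edge e}"
    using closedin_continuous_map_preimage[OF cont closedin_closed_edge[OF G e(1)]] by simp
  then have "closed {t \<in> {0..1}. \<gamma> t \<in> vertex_pt ` e \<union> open_edge e}"
    by (simp add: closedin_closed_eq)
  moreover have "{a<..<b} \<subseteq> {t \<in> {0..1}. \<gamma> t \<in> vertex_pt ` e \<union> open_edge e}"
    using in_e ab by auto
  ultimately have "{a..b} \<subseteq> {t \<in> {0..1}. \<gamma> t \<in> vertex_pt ` e \<union> open_edge e}"
    using closure_minimal closure_greaterThanLessThan[OF ab(2)] by metis
  then show ?thesis using e(1) in_e by blast
qed

text \<open>Induction on the number of vertex times strictly between \<open>a\<close> and
  \<open>b\<close>. With none, the curve runs in one edge, whose two ends it reaches by injectivity.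
  Otherwise it is cut at a vertex time \<open>c\<close>, and injectivity shows that the two walks
  share only the vertex at \<open>c\<close>.\<close>

lemma walk_between_vertex_times:
  assumes G: "simple_graph V E" and cont: "continuous_map (top_of_set {0..1}) (one_complex V E) \<gamma>"
    and inj: "inj_on \<gamma> {0..1::real}"
    and "0 \<le> a" "a \<le> b" "b \<le> 1" "\<gamma> a \<in> vertex_pt ` V" "\<gamma> b \<in> vertex_pt ` V"
  shows "\<exists>ws. ws \<noteq> [] \<and> distinct ws \<and> wedges ws \<subseteq> E \<and> \<gamma> a = vertex_pt (hd ws) \<and> \<gamma> b = vertex_pt (last ws) \<and>
     vertex_pt ` set ws = \<gamma> ` {a..b} \<inter> vertex_pt ` V \<and> (\<forall>t\<in>{a..b}. \<forall>e. \<gamma> t \<in> open_edge e \<longrightarrow> e \<in> wedges ws)"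
  using assms(4-)
proof (induction "card {t \<in> {a<..<b}. \<gamma> t \<in> vertex_pt ` V}" arbitrary: a b rule: less_induct)
  case less
  have fin: "finite {t \<in> {a<..<b}. \<gamma> t \<in> vertex_pt ` V}" if "0 \<le> a" "b \<le> 1" for a b
    by (rule finite_subset[OF _ finite_vertex_times[OF G cont inj]]) (use that in auto)
  obtain v w where vw: "\<gamma> a = vertex_pt v" "\<gamma> b = vertex_pt w" "v \<in> V" "w \<in> V"
    using less.prems by blast
  consider "a = b" | "a < b" "{t \<in> {a<..<b}. \<gamma> t \<in> vertex_pt ` V} = {}"
    | c where "c \<in> {a<..<b}" "\<gamma> c \<in> vertex_pt ` V"
    using less.prems(2) by fastforce
  then show ?case
  proof cases
    case 1
    then show ?thesis using vw by (intro exI[of _ "[v]"]) auto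
  next
    case 2
    then have "\<forall>t\<in>{a<..<b}. \<gamma> t \<notin> vertex_pt ` V" by blast
    then obtain e where e: "e \<in> E" "\<And>t. t \<in> {a<..<b} \<Longrightarrow> \<gamma> t \<in> open_edge e"
      "\<And>t. t \<in> {a..b} \<Longrightarrow> \<gamma> t \<in> vertex_pt ` e \<union> open_edge e"
      using between_vertex_times[OF G cont less.prems(1) 2(1) less.prems(3)] by blast
    have "v \<in> e" "w \<in> e" using e(3)[of a] e(3)[of b] vw 2(1) by auto
    moreover have "v \<noteq> w" using vw inj_onD[OF inj, of a b] 2(1) less.prems by auto
    moreover obtain x y where "e = {x, y}" using simple_graph_edgeE[OF G e(1)] .
    ultimately have evw: "e = {v, w}" by auto
    have ends: "t = a \<or> t = b \<or> t \<in> {a<..<b}" if "t \<in> {a..b}" for t using that by auto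
    have "{a..b} = {a, b} \<union> {a<..<b}" using 2(1) by auto
    moreover have "\<gamma> ` {a<..<b} \<inter> vertex_pt ` V = {}" using 2(2) by blast
    ultimately have "\<gamma> ` {a..b} \<inter> vertex_pt ` V = {\<gamma> a, \<gamma> b}"
      using less.prems(4,5) by (auto simp: image_Un Int_Un_distrib2)
    moreover have "e' \<in> wedges [v, w]" if t: "t \<in> {a..b}" "\<gamma> t \<in> open_edge e'" for t e'
    proof -
      have "t \<in> {a<..<b}" using ends[OF t(1)] t(2) vw by auto
      then have "e = e'" using e(2) t(2) open_edge_disjoint by blast
      then show ?thesis using evw by simp
    qed
    ultimately show ?thesis
      using vw \<open>v \<noteq> w\<close> evw e(1) by (intro exI[of _ "[v, w]"]) auto
  next
    case 3
    have sub: "card {t \<in> {a'<..<b'}. \<gamma> t \<in> vertex_pt ` V} < card {t \<in> {a<..<b}. \<gamma> t \<in> vertex_pt ` V}"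
      if "a \<le> a'" "b' \<le> b" "c \<notin> {a'<..<b'}" for a' b'
    proof (rule psubset_card_mono)
      show "finite {t \<in> {a<..<b}. \<gamma> t \<in> vertex_pt ` V}" using fin less.prems by blast
      show "{t \<in> {a'<..<b'}. \<gamma> t \<in> vertex_pt ` V} \<subset> {t \<in> {a<..<b}. \<gamma> t \<in> vertex_pt ` V}"
        using that 3 by fastforce
    qed
    obtain ws1 where 1: "ws1 \<noteq> []" "distinct ws1" "wedges ws1 \<subseteq> E" "\<gamma> a = vertex_pt (hd ws1)"
      "\<gamma> c = vertex_pt (last ws1)" "vertex_pt ` set ws1 = \<gamma> ` {a..c} \<inter> vertex_pt ` V"
      "\<And>t e. t \<in> {a..c} \<Longrightarrow> \<gamma> t \<in> open_edge e \<Longrightarrow> e \<in> wedges ws1"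
      using less.hyps[of a c, OF sub] less.prems 3 by fastforce
    obtain ws2 where 2: "ws2 \<noteq> []" "distinct ws2" "wedges ws2 \<subseteq> E" "\<gamma> c = vertex_pt (hd ws2)"
      "\<gamma> b = vertex_pt (last ws2)" "vertex_pt ` set ws2 = \<gamma> ` {c..b} \<inter> vertex_pt ` V"
      "\<And>t e. t \<in> {c..b} \<Longrightarrow> \<gamma> t \<in> open_edge e \<Longrightarrow> e \<in> wedges ws2"
      using less.hyps[of c b, OF sub] less.prems 3 by fastforce
    define x where "x = hd ws2"
    have w1: "ws1 = butlast ws1 @ [x]" using 1(1,5) 2(4) by (simp add: x_def)
    have w2: "ws2 = x # tl ws2" using 2(1) by (simp add: x_def)
    let ?ws = "butlast ws1 @ x # tl ws2"
    have w: "wedges ?ws = wedges ws1 \<union> wedges ws2"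
      using wedges_append_Cons[of "butlast ws1" x "tl ws2"] w1 w2 by simp
    have s: "set ?ws = set ws1 \<union> set ws2"
      using arg_cong[OF w1, of set] arg_cong[OF w2, of set] by auto
    have common: "y = x" if y: "y \<in> set ws1" "y \<in> set ws2" for y
    proof -
      obtain t1 t2 where t: "t1 \<in> {a..c}" "t2 \<in> {c..b}" "vertex_pt y = \<gamma> t1" "vertex_pt y = \<gamma> t2"
        using y 1(6) 2(6) by blast
      then have "t1 = t2" using inj less.prems 3 by (auto dest: inj_onD[of _ _ t1 t2])
      then have "t1 = c" using t by auto
      then show ?thesis using t(3) 2(4) by (simp add: x_def)
    qed
    have ab: "{a..b} = {a..c} \<union> {c..b}" using 3 by auto
    have d1: "distinct (butlast ws1 @ [x])" using 1(2) w1 by metis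
    have d2: "distinct (x # tl ws2)" using 2(2) w2 by metis
    have "x \<notin> set (butlast ws1)" using d1 by simp
    moreover have "y \<notin> set (tl ws2)" if "y \<in> set (butlast ws1)" for y
      using that common in_set_butlastD[OF that] \<open>x \<notin> set (butlast ws1)\<close> 2(1) by (metis list.set_sel(2))
    ultimately have "distinct ?ws" using d1 d2 by auto
    moreover have "hd ?ws = hd ws1" using w1 by (metis append_is_Nil_conv hd_append list.sel(1))
    moreover have "last ?ws = last ws2" using w2 by (metis last_appendR list.discI)
    moreover have "vertex_pt ` set ?ws = \<gamma> ` {a..b} \<inter> vertex_pt ` V"
      unfolding s ab image_Un 1(6) 2(6) by blast
    ultimately show ?thesis
      using 1(3,4,7) 2(3,5,7) w ab by (intro exI[of _ ?ws]) auto
  qed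
qed

lemma is_arc_inE:
  assumes "is_arc_in X A"
  obtains \<gamma> where "continuous_map (top_of_set {0..1::real}) X \<gamma>" "inj_on \<gamma> {0..1}" "\<gamma> ` {0..1} = A"
proof -
  obtain \<gamma> where "homeomorphic_map (top_of_set {0..1::real}) (subtopology X A) \<gamma>"
    using assms unfolding is_arc_in_def by (meson homeomorphic_space homeomorphic_space_sym)
  then show ?thesis
    using that assms homeomorphic_eq_everything_map[of "top_of_set {0..1}" "subtopology X A" \<gamma>]
    by (auto simp: continuous_map_in_subtopology is_arc_in_def Int_absorb1)
qed

text \<open>Between its first and last vertex time the arc follows a path \<open>m\<close>. Before
  and after it lies within one edge each; the other ends of these edges are \<open>s\<close> and
  \<open>t\<close>.\<close>

lemma arc_walk:
  assumes G: "simple_graph V E" and iso: "\<forall>v\<in>V. \<exists>y. {v, y} \<in> E" and A: "is_arc_in (one_complex V E) A"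
  shows "\<exists>s m t. distinct m \<and> m \<noteq> [] \<and> wedges (s # m @ [t]) \<subseteq> E \<and>
    (\<forall>e. A \<inter> open_edge e \<noteq> {} \<longrightarrow> e \<in> wedges (s # m @ [t]))"
proof -
  obtain \<gamma> where cont: "continuous_map (top_of_set {0..1::real}) (one_complex V E) \<gamma>"
    and inj: "inj_on \<gamma> {0..1}" and im: "\<gamma> ` {0..1} = A"
    using is_arc_inE[OF A] .
  define T where "T = {t \<in> {0..1}. \<gamma> t \<in> vertex_pt ` V}"
  have fin: "finite T" unfolding T_def by (rule finite_vertex_times[OF G cont inj])
  show ?thesis
  proof (cases "T = {}")
    case True
    then have nv: "\<gamma> t \<notin> vertex_pt ` V" if "t \<in> {0..1}" for t using that by (auto simp: T_def)
    then have "\<forall>t\<in>{0<..<1}. \<gamma> t \<notin> vertex_pt ` V" by simp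
    then obtain e where e: "e \<in> E" "\<And>t. t \<in> {0..1} \<Longrightarrow> \<gamma> t \<in> vertex_pt ` e \<union> open_edge e"
      using between_vertex_times[OF G cont, of 0 1] by fastforce
    obtain x y where xy: "e = {x, y}" "x \<in> V" "y \<in> V" using simple_graph_edgeE[OF G e(1)] .
    have "e' = e" if hit: "A \<inter> open_edge e' \<noteq> {}" for e'
    proof -
      obtain t where t: "t \<in> {0..1}" "\<gamma> t \<in> open_edge e'" using hit im by blast
      then have "\<gamma> t \<in> open_edge e" using e(2)[OF t(1)] by auto
      then show ?thesis using t(2) open_edge_disjoint by blast
    qed
    \<comment> \<open>An arc inside one open edge is recorded by the walk from \<open>x\<close> to
      \<open>y\<close> and back.\<close>
    then show ?thesis using e(1) xy
      by (intro exI[of _ x] exI[of _ "[y]"]) (auto simp: insert_commute)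
  next
    case False
    define a b where "a = Min T" and "b = Max T"
    have aT: "a \<in> T" "b \<in> T" using False fin by (simp_all add: a_def b_def)
    have le: "a \<le> t" "t \<le> b" if "t \<in> T" for t using that fin by (simp_all add: a_def b_def)
    obtain ws where ws: "ws \<noteq> []" "distinct ws" "wedges ws \<subseteq> E" "\<gamma> a = vertex_pt (hd ws)"
      "\<gamma> b = vertex_pt (last ws)" "vertex_pt ` set ws = \<gamma> ` {a..b} \<inter> vertex_pt ` V"
      "\<And>t e. t \<in> {a..b} \<Longrightarrow> \<gamma> t \<in> open_edge e \<Longrightarrow> e \<in> wedges ws"
      using walk_between_vertex_times[OF G cont inj, of a b] aT le(1)[OF aT(2)] unfolding T_def by auto
    \<comment> \<open>If \<open>c = d\<close>, the arc begins or ends at the vertex itself and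
      \<open>iso\<close> supplies an arbitrary edge there; otherwise the piece lies in a single
      edge, which contains \<open>v\<close>.\<close>
    have ends: "\<exists>s. {s, v} \<in> E \<and> (\<forall>t\<in>{c..d}. \<forall>e. \<gamma> t \<in> open_edge e \<longrightarrow> e = {s, v})"
      if cd: "0 \<le> c" "c \<le> d" "d \<le> 1" "vertex_pt v \<in> {\<gamma> c, \<gamma> d}" "v \<in> V" and nT: "\<And>t. t \<in> {c<..<d} \<Longrightarrow> t \<notin> T"
        and cdT: "c \<noteq> d \<Longrightarrow> c \<in> T \<Longrightarrow> d \<notin> T" for c d v
    proof (cases "c = d")
      case True
      obtain s where "{s, v} \<in> E" using iso cd(5) by (metis insert_commute)
      moreover have "\<gamma> t \<notin> open_edge e" if "t \<in> {c..d}" for t e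
        using that cd(4) True vertex_pt_notin_open_edge by (metis atLeastAtMost_singleton insert_absorb2 singletonD)
      ultimately show ?thesis by blast
    next
      case False
      have nv: "\<forall>t\<in>{c<..<d}. \<gamma> t \<notin> vertex_pt ` V"
        using nT cd by (auto simp: T_def)
      have "c < d" using False cd(2) by simp
      obtain e where e: "e \<in> E" "\<And>t. t \<in> {c..d} \<Longrightarrow> \<gamma> t \<in> vertex_pt ` e \<union> open_edge e"
        using between_vertex_times[OF G cont cd(1) \<open>c < d\<close> cd(3) nv] by blast
      have "vertex_pt v \<in> vertex_pt ` e \<union> open_edge e" using e(2) cd(2,4) by (metis atLeastAtMost_iff insertE order_refl singletonD)
      then have "v \<in> e" by auto
      then obtain s where s: "e = {s, v}" using simple_graph_edgeE[OF G e(1)] by (metis empty_iff insert_commute insert_iff)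
      have "e' = e" if "t \<in> {c..d}" "\<gamma> t \<in> open_edge e'" for t e'
      proof -
        have "\<gamma> t \<in> open_edge e" using e(2)[OF that(1)] that(2) by auto
        then show ?thesis using that(2) open_edge_disjoint by blast
      qed
      then show ?thesis using s e(1) by blast
    qed
    have "x \<in> V" if "x \<in> set ws" for x
    proof -
      have "vertex_pt x \<in> vertex_pt ` V" using ws(6) that by blast
      then show ?thesis by auto
    qed
    then have hV: "hd ws \<in> V" "last ws \<in> V"
      using hd_in_set[OF ws(1)] last_in_set[OF ws(1)] by blast+
    have ab01: "0 \<le> a" "a \<le> b" "b \<le> 1" using aT le(1)[OF aT(2)] by (auto simp: T_def)
    obtain s where s: "{s, hd ws} \<in> E" "\<And>t e. t \<in> {0..a} \<Longrightarrow> \<gamma> t \<in> open_edge e \<Longrightarrow> e = {s, hd ws}"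
    proof -
      have "\<exists>s. {s, hd ws} \<in> E \<and> (\<forall>t\<in>{0..a}. \<forall>e. \<gamma> t \<in> open_edge e \<longrightarrow> e = {s, hd ws})"
        by (rule ends) (use ab01 ws(4) hV le in force)+
      then show ?thesis using that by blast
    qed
    obtain u where u: "{u, last ws} \<in> E" "\<And>t e. t \<in> {b..1} \<Longrightarrow> \<gamma> t \<in> open_edge e \<Longrightarrow> e = {u, last ws}"
    proof -
      have "\<exists>s. {s, last ws} \<in> E \<and> (\<forall>t\<in>{b..1}. \<forall>e. \<gamma> t \<in> open_edge e \<longrightarrow> e = {s, last ws})"
        by (rule ends) (use ab01 ws(5) hV le in force)+
      then show ?thesis using that by blast
    qed
    have w: "wedges (s # ws @ [u]) = insert {s, hd ws} (insert {u, last ws} (wedges ws))"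
      using ws(1) by (simp add: wedges_Cons wedges_snoc insert_commute)
    have "e \<in> wedges (s # ws @ [u])" if hit: "A \<inter> open_edge e \<noteq> {}" for e
    proof -
      obtain t where t: "t \<in> {0..1}" "\<gamma> t \<in> open_edge e" using hit im by blast
      then have "t \<in> {0..a} \<or> t \<in> {a..b} \<or> t \<in> {b..1}" by auto
      then show ?thesis using s(2) u(2) ws(7) t(2) w by blast
    qed
    then show ?thesis using ws(1-3) s(1) u(1) w
      by (intro exI[of _ s] exI[of _ ws] exI[of _ u]) auto
  qed
qed

text \<open>The walk traced by an arc cannot leave a set closed under adjacency, so an arc between a
  vertex inside and one outside is impossible.\<close>

lemma n_ac_connected_graph:
  assumes G: "simple_graph V E" and ac: "n_ac n V E" "2 \<le> n"
  shows "connected_graph V E"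
  unfolding connected_graph_def
proof (intro allI impI, rule ccontr)
  fix S assume S: "S \<subseteq> V" "S \<noteq> {} \<and> (\<forall>x\<in>S. \<forall>y. {x, y} \<in> E \<longrightarrow> y \<in> S)" "S \<noteq> V"
  then obtain v w where vw: "v \<in> S" "w \<in> V" "w \<notin> S" by blast
  have "card {vertex_pt v, vertex_pt w} \<le> n" using card_length[of "[vertex_pt v, vertex_pt w]"] ac(2) by simp
  moreover have "{vertex_pt v, vertex_pt w} \<subseteq> topspace (one_complex V E)"
    using vw S(1) topspace_one_complex[OF G] by auto
  ultimately obtain A where A: "is_arc_in (one_complex V E) A" "{vertex_pt v, vertex_pt w} \<subseteq> A"
    using ac(1) unfolding n_ac_def n_arc_connected_def by (metis finite.emptyI finite_insert)
  obtain \<gamma> where cont: "continuous_map (top_of_set {0..1::real}) (one_complex V E) \<gamma>"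
    and inj: "inj_on \<gamma> {0..1}" and im: "\<gamma> ` {0..1} = A"
    using is_arc_inE[OF A(1)] .
  obtain a b where ab: "a \<in> {0..1}" "b \<in> {0..1}" "\<gamma> a = vertex_pt v" "\<gamma> b = vertex_pt w"
    using A(2) im by (metis imageE insert_subset)
  have "\<exists>ws. ws \<noteq> [] \<and> wedges ws \<subseteq> E \<and> hd ws = v \<and> last ws = w"
  proof (cases "a \<le> b")
    case True
    then show ?thesis
      using walk_between_vertex_times[OF G cont inj, of a b] ab vw S(1) by fastforce
  next
    case False
    then obtain ws where "ws \<noteq> []" "wedges ws \<subseteq> E" "hd ws = w" "last ws = v"
      using walk_between_vertex_times[OF G cont inj, of b a] ab vw S(1) by fastforce
    then show ?thesis by (intro exI[of _ "rev ws"]) (auto simp: wedges_rev hd_rev last_rev)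
  qed
  then obtain ws where ws: "ws \<noteq> []" "wedges ws \<subseteq> E" "hd ws = v" "last ws = w" by blast
  then have "set ws \<subseteq> S" using walk_stays[of ws E S] S(2) vw(1) by blast
  then show False using ws(1,4) vw(3) last_in_set by blast
qed

text \<open>The midpoint of each edge of \<open>F\<close> is sampled. Any interior point would do,
  since \<open>arc_walk\<close> records only which open edges the arc meets.\<close>

lemma n_ac_walk_connected:
  assumes G: "simple_graph V E" and iso: "\<forall>v\<in>V. \<exists>y. {v, y} \<in> E" and ac: "n_ac n V E"
  shows "walk_connected n E"
  unfolding walk_connected_def
proof (intro allI impI)
  fix F assume F: "F \<subseteq> E" "finite F \<and> F \<noteq> {} \<and> card F \<le> n"
  let ?S = "(\<lambda>e. (Inr e, 1/2 :: real)) ` F"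
  have "card ?S \<le> n" using F(2) card_image_le by (metis order_trans)
  moreover have "?S \<subseteq> topspace (one_complex V E)"
    using F(1) by (auto simp: topspace_one_complex[OF G])
  ultimately obtain A where A: "is_arc_in (one_complex V E) A" "?S \<subseteq> A"
    using ac F(2) unfolding n_ac_def n_arc_connected_def by (metis finite_imageI)
  have "A \<inter> open_edge e \<noteq> {}" if "e \<in> F" for e
  proof -
    have "(Inr e, 1/2) \<in> A \<inter> open_edge e" using A(2) that by auto
    then show ?thesis by blast
  qed
  then show "\<exists>s m t. distinct m \<and> m \<noteq> [] \<and> wedges (s # m @ [t]) \<subseteq> E \<and> F \<subseteq> wedges (s # m @ [t])"
    using arc_walk[OF G iso A(1)] by blast
qed

subsection \<open>Paths, rays and cycles\<close>

lemma homeomorphic_map_euclideanI: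
  assumes "continuous_on S f" "f ` S = T" "continuous_on T g" "\<And>x. x \<in> S \<Longrightarrow> g (f x) = x"
  shows "homeomorphic_map (top_of_set S) (top_of_set T) f"
proof (rule homeomorphic_maps_imp_map)
  show "homeomorphic_maps (top_of_set S) (top_of_set T) f g"
    unfolding homeomorphic_maps_def continuous_map_in_subtopology
    using assms by auto
qed

lemma homeomorphic_map_compact:
  fixes f :: "'a::metric_space \<Rightarrow> 'b::metric_space"
  assumes "compact S" "continuous_on S f" "inj_on f S" "f ` S = T"
  shows "homeomorphic_map (top_of_set S) (top_of_set T) f"
  using assms
  by (intro continuous_imp_homeomorphic_map)
    (auto simp: compact_space_subtopology Hausdorff_space_subtopology[OF Hausdorff_space_euclidean] continuous_map_in_subtopology)

text \<open>To the left of any bound only finitely many \<open>C i\<close> occur, so the union is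
  locally finite. This stands in for compactness in the case of a ray.\<close>

lemma closed_UN_unit_intervals:
  fixes C :: "nat \<Rightarrow> real set"
  assumes "\<And>i. i \<in> J \<Longrightarrow> closed (C i)" "\<And>i. i \<in> J \<Longrightarrow> C i \<subseteq> {real i..}"
  shows "closed (\<Union>i\<in>J. C i)"
proof -
  let ?S = "\<Union>i\<in>J. C i"
  have "closure ?S \<subseteq> ?S"
  proof
    fix x assume x: "x \<in> closure ?S"
    obtain n :: nat where n: "x < real n" using reals_Archimedean2 by blast
    have "x \<in> closure ({..<real n} \<inter> ?S)"
      using open_Int_closure_subset[of "{..<real n}" ?S] x n by auto
    moreover have "{..<real n} \<inter> ?S \<subseteq> (\<Union>i\<in>J \<inter> {..n}. C i)"
    proof
      fix y assume "y \<in> {..<real n} \<inter> ?S"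
      then obtain i where i: "i \<in> J" "y \<in> C i" "y < real n" by auto
      then have "real i < real n" using assms(2)[OF i(1)] by fastforce
      then show "y \<in> (\<Union>i\<in>J \<inter> {..n}. C i)" using i by auto
    qed
    moreover have "closed (\<Union>i\<in>J \<inter> {..n}. C i)"
      by (rule closed_UN) (use assms in auto)
    ultimately have "x \<in> (\<Union>i\<in>J \<inter> {..n}. C i)" using closure_minimal by blast
    then show "x \<in> ?S" by blast
  qed
  then show ?thesis using closure_subset_eq by blast
qed

text \<open>Treats paths (\<open>J = {..<n}\<close>) and rays (\<open>J = UNIV\<close>) together:
  \<open>v i\<close> goes to \<open>i\<close>, and the edge from \<open>v i\<close> to
  \<open>v (Suc i)\<close> linearly onto the interval from \<open>i\<close> to \<open>Suc i\<close>.
  Edges are oriented arbitrarily, whence the two alternatives in \<open>phi\<close>.\<close>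

lemma homeomorphic_map_linear:
  fixes v :: "nat \<Rightarrow> 'v" and J :: "nat set"
  defines "W \<equiv> J \<union> Suc ` J"
  assumes G: "simple_graph V E" and inj: "inj_on v W"
    and V: "V = v ` W" and E: "E = (\<lambda>i. {v i, v (Suc i)}) ` J"
  shows "\<exists>f. homeomorphic_map (one_complex V E) (top_of_set (\<Union>i\<in>J. {real i..real (Suc i)})) f \<and>
    (\<forall>i\<in>W. f (vertex_pt (v i)) = real i)"
proof -
  let ?X = "one_complex V E" and ?M = "\<Union>i\<in>J. {real i..real (Suc i)}"
  define idx where "idx = (\<lambda>x. real (the_inv_into W v x))"
  have idx: "idx (v i) = real i" if "i \<in> W" for i
    using the_inv_into_f_f[OF inj that] by (simp add: idx_def)
  define f :: "('v + 'v set) \<times> real \<Rightarrow> real" where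
    "f = (\<lambda>(a, t). case a of Inl x \<Rightarrow> idx x | Inr e \<Rightarrow> (1 - t) * idx (edge_end0 e) + t * idx (edge_end1 e))"
  define ed where "ed = (\<lambda>i. {v i, v (Suc i)})"
  have fv: "f (vertex_pt x) = idx x" for x by (simp add: f_def vertex_pt_def)
  have fe: "f (edge_pt e t) = (1 - t) * idx (edge_end0 e) + t * idx (edge_end1 e)" if "t \<in> {0..1}" for e t
    using edge_pt_cases[OF that, of e] by (elim disjE conjE) (simp_all add: fv, simp add: f_def)
  have edE: "ed i \<in> E" if "i \<in> J" for i using E that by (auto simp: ed_def)
  have phi: "(\<forall>t\<in>{0..1}. f (edge_pt (ed i) t) = real i + t) \<or> (\<forall>t\<in>{0..1}. f (edge_pt (ed i) t) = real i + 1 - t)"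
    if i: "i \<in> J" for i
  proof -
    have "ed i = {edge_end0 (ed i), edge_end1 (ed i)}" using edge_ends(1)[OF G edE[OF i]] .
    then have "edge_end0 (ed i) = v i \<and> edge_end1 (ed i) = v (Suc i) \<or>
        edge_end0 (ed i) = v (Suc i) \<and> edge_end1 (ed i) = v i"
      unfolding ed_def doubleton_eq_iff by auto
    moreover have "idx (v i) = real i" "idx (v (Suc i)) = real i + 1"
      using idx i by (auto simp: W_def)
    ultimately show ?thesis
    proof (elim disjE conjE)
      assume *: "edge_end0 (ed i) = v i" "edge_end1 (ed i) = v (Suc i)"
        "idx (v i) = real i" "idx (v (Suc i)) = real i + 1"
      have "f (edge_pt (ed i) t) = real i + t" if "t \<in> {0..1}" for t
        using fe[OF that, of "ed i"] unfolding * by (simp add: algebra_simps)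
      then show ?thesis by blast
    next
      assume *: "edge_end0 (ed i) = v (Suc i)" "edge_end1 (ed i) = v i"
        "idx (v i) = real i" "idx (v (Suc i)) = real i + 1"
      have "f (edge_pt (ed i) t) = real i + 1 - t" if "t \<in> {0..1}" for t
        using fe[OF that, of "ed i"] unfolding * by (simp add: algebra_simps)
      then show ?thesis by blast
    qed
  qed
  have phi_cont: "continuous_on {0..1} (\<lambda>t. f (edge_pt (ed i) t))" if "i \<in> J" for i
    using phi[OF that]
  proof
    assume *: "\<forall>t\<in>{0..1}. f (edge_pt (ed i) t) = real i + t"
    have "continuous_on {0..1} (\<lambda>t::real. real i + t)" by (intro continuous_intros)
    then show ?thesis using * by (subst continuous_on_cong[OF refl]) auto
  next
    assume *: "\<forall>t\<in>{0..1}. f (edge_pt (ed i) t) = real i + 1 - t"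
    have "continuous_on {0..1} (\<lambda>t::real. real i + 1 - t)" by (intro continuous_intros)
    then show ?thesis using * by (subst continuous_on_cong[OF refl]) auto
  qed
  have phi_im: "(\<lambda>t. f (edge_pt (ed i) t)) ` {0..1} = {real i..real (Suc i)}" if "i \<in> J" for i
    using phi[OF that]
  proof
    assume *: "\<forall>t\<in>{0..1}. f (edge_pt (ed i) t) = real i + t"
    have "x \<in> (\<lambda>t. f (edge_pt (ed i) t)) ` {0..1}" if "x \<in> {real i..real (Suc i)}" for x
      using that * by (intro image_eqI[of _ _ "x - real i"]) auto
    then show ?thesis using * by auto
  next
    assume *: "\<forall>t\<in>{0..1}. f (edge_pt (ed i) t) = real i + 1 - t"
    have "x \<in> (\<lambda>t. f (edge_pt (ed i) t)) ` {0..1}" if "x \<in> {real i..real (Suc i)}" for x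
      using that * by (intro image_eqI[of _ _ "real i + 1 - x"]) auto
    then show ?thesis using * by auto
  qed
  have top: "topspace ?X = (\<Union>i\<in>J. edge_pt (ed i) ` {0..1})"
  proof
    show "(\<Union>i\<in>J. edge_pt (ed i) ` {0..1}) \<subseteq> topspace ?X"
      using edge_pt_in_topspace[OF G edE] by blast
    show "topspace ?X \<subseteq> (\<Union>i\<in>J. edge_pt (ed i) ` {0..1})"
    proof
      fix x assume x: "x \<in> topspace ?X"
      show "x \<in> (\<Union>i\<in>J. edge_pt (ed i) ` {0..1})"
      proof (cases "x \<in> vertex_pt ` V")
        case True
        then obtain j where j: "j \<in> W" "x = vertex_pt (v j)" using V by blast
        then obtain i where i: "i \<in> J" "v j \<in> ed i" unfolding W_def ed_def by blast
        then have "v j = edge_end0 (ed i) \<or> v j = edge_end1 (ed i)"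
          using edge_ends(1)[OF G edE[OF i(1)]] by blast
        then have "x = edge_pt (ed i) 0 \<or> x = edge_pt (ed i) 1" using j(2) by auto
        then have "x \<in> edge_pt (ed i) ` {0..1}" by (metis atLeastAtMost_iff imageI order_refl zero_le_one)
        then show ?thesis using i(1) by blast
      next
        case False
        then obtain e where e: "e \<in> E" "x \<in> open_edge e" using x topspace_one_complex[OF G] by blast
        then obtain i where i: "i \<in> J" "e = ed i" using E by (auto simp: ed_def)
        obtain t where "x = (Inr e, t)" "0 < t" "t < 1" using e(2) by (auto simp: open_edge_def)
        then have "x = edge_pt (ed i) t" "t \<in> {0..1}" using i(2) by auto
        then show ?thesis using i(1) by blast
      qed
    qed
  qed
  have "f ` topspace ?X = (\<Union>i\<in>J. (\<lambda>t. f (edge_pt (ed i) t)) ` {0..1})"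
    unfolding top by (simp add: image_UN image_image)
  also have "\<dots> = ?M" using phi_im by simp
  finally have im: "f ` topspace ?X = ?M" .
  have "homeomorphic_map ?X (top_of_set ?M) f"
  proof (rule bijective_closed_imp_homeomorphic_map)
    show "f ` topspace ?X = topspace (top_of_set ?M)" using im by simp
    show "continuous_map ?X (top_of_set ?M) f"
    proof (rule continuous_map_one_complex[OF G])
      show "f \<in> topspace ?X \<rightarrow> topspace (top_of_set ?M)" using im by auto
      fix e assume "e \<in> E"
      then obtain i where i: "i \<in> J" "e = ed i" using E by (auto simp: ed_def)
      then show "continuous_map (top_of_set {0..1}) (top_of_set ?M) (f \<circ> edge_pt e)"
        using phi_cont[OF i(1)] phi_im[OF i(1)] unfolding continuous_map_in_subtopology
        by (auto simp: o_def)
    qed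
    show "closed_map ?X (top_of_set ?M) f"
      unfolding closed_map_def
    proof (intro allI impI)
      fix K assume K: "closedin ?X K"
      define C where "C = (\<lambda>i. (\<lambda>t. f (edge_pt (ed i) t)) ` {t \<in> {0..1}. edge_pt (ed i) t \<in> K})"
      have "f ` K = (\<Union>i\<in>J. C i)"
      proof -
        have "K = (\<Union>i\<in>J. edge_pt (ed i) ` {t \<in> {0..1}. edge_pt (ed i) t \<in> K})"
        proof (intro equalityI subsetI)
          fix x assume "x \<in> K"
          then obtain i t where "i \<in> J" "t \<in> {0..1}" "x = edge_pt (ed i) t"
            using closedin_subset[OF K] unfolding top by blast
          then show "x \<in> (\<Union>i\<in>J. edge_pt (ed i) ` {t \<in> {0..1}. edge_pt (ed i) t \<in> K})"
            using \<open>x \<in> K\<close> by blast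
        qed blast
        then have "f ` K = f ` (\<Union>i\<in>J. edge_pt (ed i) ` {t \<in> {0..1}. edge_pt (ed i) t \<in> K})"
          by (rule arg_cong)
        then show ?thesis unfolding C_def by (simp add: image_UN image_image)
      qed
      moreover have "closed (\<Union>i\<in>J. C i)"
      proof (rule closed_UN_unit_intervals)
        fix i assume i: "i \<in> J"
        have "closed {t \<in> {0..1}. edge_pt (ed i) t \<in> K}"
          using K edE[OF i] closedin_one_complex[OF G] by blast
        then have "compact ({0..1} \<inter> {t \<in> {0..1}. edge_pt (ed i) t \<in> K})"
          by (intro compact_Int_closed) auto
        moreover have "{0..1} \<inter> {t \<in> {0..1}. edge_pt (ed i) t \<in> K} = {t \<in> {0..1}. edge_pt (ed i) t \<in> K}" by blast
        ultimately have "compact {t \<in> {0..1}. edge_pt (ed i) t \<in> K}" by metis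
        then have "compact (C i)"
          unfolding C_def using phi_cont[OF i] by (intro compact_continuous_image) (auto intro: continuous_on_subset)
        then show "closed (C i)" by (rule compact_imp_closed)
        show "C i \<subseteq> {real i..}" using phi_im[OF i] unfolding C_def by fastforce
      qed
      moreover have "f ` K \<subseteq> ?M" using closedin_subset[OF K] im by blast
      ultimately show "closedin (top_of_set ?M) (f ` K)"
        by (simp add: closed_subset)
    qed
    \<comment> \<open>For injectivity: vertices go to natural numbers, interior points of edges
      strictly between consecutive ones.\<close>
    have vert_f: "f x \<in> \<nat>" if "x \<in> vertex_pt ` V" for x
      using that V idx fv by auto
    have open_f: "\<exists>i\<in>J. \<exists>t. x = edge_pt (ed i) t \<and> 0 < t \<and> t < 1 \<and> real i < f x \<and> f x < real i + 1"
      if x: "x \<in> topspace ?X" "x \<notin> vertex_pt ` V" for x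
    proof -
      obtain i t where it: "i \<in> J" "x = edge_pt (ed i) t" "t \<in> {0..1}" using x(1) unfolding top by blast
      have "t \<noteq> 0" "t \<noteq> 1" using x(2) it edge_ends(3,4)[OF G edE[OF it(1)]] by auto
      then have t: "0 < t" "t < 1" using it(3) by auto
      have "f x = real i + t \<or> f x = real i + 1 - t" using phi[OF it(1)] it(2,3) by blast
      then have "real i < f x \<and> f x < real i + 1" using t by auto
      then show ?thesis using it t by blast
    qed
    have not_Nats: "y \<notin> \<nat>" if "real i < y" "y < real i + 1" for i y
    proof
      assume "y \<in> \<nat>"
      then obtain n where "y = real n" by (auto elim: Nats_cases)
      then show False using that by simp
    qed
    show "inj_on f (topspace ?X)"
    proof (rule inj_onI)
      fix x y assume xy: "x \<in> topspace ?X" "y \<in> topspace ?X" "f x = f y"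
      show "x = y"
      proof (cases "x \<in> vertex_pt ` V")
        case True
        then have "y \<in> vertex_pt ` V" using vert_f open_f[OF xy(2)] not_Nats xy(3) by metis
        then show ?thesis using True V xy(3) fv idx by auto
      next
        case False
        then have y: "y \<notin> vertex_pt ` V" using vert_f open_f[OF xy(1)] not_Nats xy(3) by metis
        obtain i t where i: "i \<in> J" "x = edge_pt (ed i) t" "0 < t" "t < 1" "real i < f x" "f x < real i + 1"
          using open_f[OF xy(1) False] by blast
        obtain j s where j: "j \<in> J" "y = edge_pt (ed j) s" "0 < s" "s < 1" "real j < f y" "f y < real j + 1"
          using open_f[OF xy(2) y] by blast
        have "real i < real j + 1" "real j < real i + 1" using i j xy(3) by linarith+
        then have "i = j" by simp
        moreover have "t \<in> {0..1}" "s \<in> {0..1}" using i(3,4) j(3,4) by auto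
        ultimately have "f x = real i + t \<and> f y = real i + s \<or> f x = real i + 1 - t \<and> f y = real i + 1 - s"
          using phi[OF i(1)] i(2) j(2) by blast
        then have "t = s" using xy(3) by auto
        then show ?thesis using i(2) j(2) \<open>i = j\<close> by simp
      qed
    qed
  qed
  then show ?thesis using fv idx by metis
qed

lemma UN_unit_intervals_lessThan: "0 < n \<Longrightarrow> (\<Union>i\<in>{..<n}. {real i..real (Suc i)}) = {0..real n}"
proof (induction n)
  case (Suc n)
  then show ?case by (cases "n = 0") (auto simp: lessThan_Suc)
qed simp

lemma UN_unit_intervals: "(\<Union>i. {real i..real (Suc i)}) = {0..}"
proof -
  have "x \<in> (\<Union>i. {real i..real (Suc i)})" if "0 \<le> x" for x :: real
    using that by (intro UN_I[of "nat \<lfloor>x\<rfloor>"]) (auto, linarith+)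
  then show ?thesis by auto
qed

lemma path_homeomorphic_map:
  assumes G: "simple_graph V E" and P: "path_from_to p q V E"
  shows "\<exists>f. homeomorphic_map (one_complex V E) (top_of_set {0..1::real}) f \<and>
    f (vertex_pt p) = 0 \<and> f (vertex_pt q) = 1"
proof -
  obtain vs where vs: "distinct vs" "2 \<le> length vs" "hd vs = p" "last vs = q" "V = set vs" "E = wedges vs"
    using P unfolding path_from_to_def by blast
  define n where "n = length vs - 1"
  have n: "0 < n" "length vs = Suc n" using vs(2) by (auto simp: n_def)
  have W: "{..<n} \<union> Suc ` {..<n} = {..<length vs}"
  proof -
    have "i \<in> {..<n} \<union> Suc ` {..<n} \<longleftrightarrow> i < Suc n" for i
      using n(1) by (cases i) auto
    then show ?thesis unfolding n(2) by blast
  qed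
  have "vs \<noteq> []" using vs(2) by auto
  then have pq: "vs ! 0 = p" "vs ! n = q" "vs \<noteq> []"
    using vs(3,4) hd_conv_nth last_conv_nth n_def by metis+
  have "inj_on ((!) vs) ({..<n} \<union> Suc ` {..<n})" using vs(1) unfolding W by (auto simp: inj_on_nth)
  moreover have "V = (!) vs ` ({..<n} \<union> Suc ` {..<n})"
    using vs(5) unfolding W by (auto simp: set_conv_nth)
  moreover have "E = (\<lambda>i. {vs ! i, vs ! Suc i}) ` {..<n}"
    using vs(6) n by (auto simp: wedges_nth)
  ultimately obtain f where f: "homeomorphic_map (one_complex V E) (top_of_set (\<Union>i\<in>{..<n}. {real i..real (Suc i)})) f"
    "\<forall>i\<in>{..<n} \<union> Suc ` {..<n}. f (vertex_pt (vs ! i)) = real i"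
    using homeomorphic_map_linear[OF G] by blast
  have g: "homeomorphic_map (top_of_set {0..real n}) (top_of_set {0..1}) (\<lambda>x. x / real n)"
    by (rule homeomorphic_map_euclideanI[where g = "\<lambda>x. x * real n"])
      (use n(1) in \<open>auto intro!: continuous_intros image_eqI[of _ _ "_ * real n"] simp: mult_left_le_one_le\<close>)
  have "f (vertex_pt p) = 0" "f (vertex_pt q) = real n"
    using f(2) pq(1,2) n unfolding W by force+
  then show ?thesis
    using homeomorphic_map_compose[OF f(1)[unfolded UN_unit_intervals_lessThan[OF n(1)]] g] n(1)
    by (intro exI[of _ "(\<lambda>x. x / real n) \<circ> f"]) simp
qed

lemma ray_homeomorphic_map:
  assumes G: "simple_graph V E" and P: "ray_from p V E"
  shows "\<exists>f. homeomorphic_map (one_complex V E) (top_of_set {0..<1::real}) f \<and> f (vertex_pt p) = 0"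
proof -
  obtain v :: "nat \<Rightarrow> 'a" where v: "inj v" "v 0 = p" "V = range v" "E = range (\<lambda>i. {v i, v (Suc i)})"
    using P unfolding ray_from_def by blast
  then obtain f where f: "homeomorphic_map (one_complex V E) (top_of_set (\<Union>i. {real i..real (Suc i)})) f"
    "f (vertex_pt p) = 0"
    using homeomorphic_map_linear[OF G, of v UNIV] by force
  have g: "homeomorphic_map (top_of_set {0..}) (top_of_set {0..<1}) (\<lambda>x::real. x / (1 + x))"
  proof (rule homeomorphic_map_euclideanI[where g = "\<lambda>y. y / (1 - y)"])
    show "(\<lambda>x::real. x / (1 + x)) ` {0..} = {0..<1}"
    proof
      show "{0..<1} \<subseteq> (\<lambda>x::real. x / (1 + x)) ` {0..}"
      proof
        fix y :: real assume "y \<in> {0..<1}"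
        then show "y \<in> (\<lambda>x. x / (1 + x)) ` {0..}"
          by (intro image_eqI[of _ _ "y / (1 - y)"]) (auto simp: field_simps)
      qed
    qed (auto simp: field_simps)
  qed (auto intro!: continuous_intros simp: field_simps)
  show ?thesis
    using homeomorphic_map_compose[OF f(1)[unfolded UN_unit_intervals] g] f(2)
    by (intro exI[of _ "(\<lambda>x. x / (1 + x)) \<circ> f"]) simp
qed

text \<open>On each half circle the cosine determines the point; a common point of both halves has
  sine zero.\<close>

lemma cis_half_circles:
  defines "C \<equiv> (\<lambda>t. cis (pi * t)) ` {0..1}" and "D \<equiv> (\<lambda>t. cis (- (pi * t))) ` {0..1}"
  shows "homeomorphic_map (top_of_set {0..1}) (top_of_set C) (\<lambda>t. cis (pi * t))"
    "homeomorphic_map (top_of_set {0..1}) (top_of_set D) (\<lambda>t. cis (- (pi * t)))"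
    "C \<union> D = sphere 0 1" "C \<inter> D \<subseteq> {1, -1}" "closed C" "closed D"
proof -
  have contC: "continuous_on {0..1} (\<lambda>t. cis (pi * t))" and contD: "continuous_on {0..1} (\<lambda>t. cis (- (pi * t)))"
    by (intro continuous_intros)+
  have eq: "s = t" if "s \<in> {0..1}" "t \<in> {0..1}" "cos (pi * s) = cos (pi * t)" for s t
  proof -
    have "pi * s \<le> pi" "pi * t \<le> pi" "0 \<le> pi * s" "0 \<le> pi * t" using that(1,2) by simp_all
    then have "pi * s = pi * t"
      using that(3) cos_inj_pi by blast
    then show ?thesis by simp
  qed
  have "inj_on (\<lambda>t. cis (pi * t)) {0..1}" "inj_on (\<lambda>t. cis (- (pi * t))) {0..1}"
    using eq by (auto intro!: inj_onI simp: complex_eq_iff)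
  then show "homeomorphic_map (top_of_set {0..1}) (top_of_set C) (\<lambda>t. cis (pi * t))"
    "homeomorphic_map (top_of_set {0..1}) (top_of_set D) (\<lambda>t. cis (- (pi * t)))"
    using contC contD unfolding C_def D_def by (intro homeomorphic_map_compact; simp)+
  show "closed C" "closed D"
    unfolding C_def D_def using contC contD by (intro compact_imp_closed compact_continuous_image; simp)+
  show "C \<inter> D \<subseteq> {1, -1}"
  proof
    fix z assume "z \<in> C \<inter> D"
    then obtain s t where st: "s \<in> {0..1}" "t \<in> {0..1}" "z = cis (pi * s)" "z = cis (- (pi * t))"
      unfolding C_def D_def by blast
    then have "cis (pi * s) = cis (- (pi * t))" by simp
    then have "cos (pi * s) = cos (pi * t)" "sin (pi * s) = - sin (pi * t)" by (auto simp: complex_eq_iff)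
    then have "sin (pi * s) = 0" using eq[OF st(1,2)] by simp
    then have "Im z = 0" "cmod z = 1" using st(3) by auto
    then show "z \<in> {1, -1}" by (auto simp: complex_eq_iff cmod_def)
  qed
  show "C \<union> D = sphere 0 1"
  proof
    show "C \<union> D \<subseteq> sphere 0 1" unfolding C_def D_def by auto
    show "sphere 0 1 \<subseteq> C \<union> D"
    proof
      fix z :: complex assume "z \<in> sphere 0 1"
      then have z: "z = cis (Arg z)" "- pi < Arg z" "Arg z \<le> pi"
        using rcis_cmod_Arg[of z] Arg_bounded[of z] by (auto simp: rcis_def)
      show "z \<in> C \<union> D"
      proof (cases "0 \<le> Arg z")
        case True
        then have "z \<in> C" unfolding C_def using z by (intro image_eqI[of _ _ "Arg z / pi"]) auto
        then show ?thesis by simp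
      next
        case False
        then have "z \<in> D" unfolding D_def using z by (intro image_eqI[of _ _ "- Arg z / pi"]) (auto simp: field_simps)
        then show ?thesis by simp
      qed
    qed
  qed
qed

text \<open>The path \<open>p # m\<close> goes to the upper half circle and the closing edge to the
  lower one, both with \<open>p\<close> at 1 and \<open>q\<close> at -1. Since
  \<open>2 \<le> length m\<close>, the closing edge is not on the path.\<close>

lemma cycle_homeomorphic_map:
  assumes G: "simple_graph V E" and P: "cycle_at p V E"
  shows "\<exists>f. homeomorphic_map (one_complex V E) (top_of_set (sphere (0::complex) 1)) f \<and> f (vertex_pt p) = 1"
proof -
  obtain m where m: "distinct (p # m)" "2 \<le> length m" "V = set (p # m)" "E = wedges (p # m @ [p])"
    using P unfolding cycle_at_def by blast
  define q where "q = last m"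
  have ne: "m \<noteq> []" using m(2) by auto
  then have q: "q \<in> set m" "q \<noteq> p" using m(1) by (auto simp: q_def)
  have E: "E = wedges (p # m) \<union> {{p, q}}"
    using wedges_snoc[of "p # m" p] ne unfolding m(4) q_def by (simp add: insert_commute)
  let ?V1 = "set (p # m)" and ?E1 = "wedges (p # m)"
  have P1: "path_from_to p q ?V1 ?E1"
    unfolding path_from_to_def using m ne by (intro exI[of _ "p # m"]) (auto simp: q_def)
  have P2: "path_from_to p q {p, q} {{p, q}}"
    unfolding path_from_to_def using q by (intro exI[of _ "[p, q]"]) auto
  have G1: "simple_graph ?V1 ?E1" using G unfolding m(3) E by (simp add: simple_graph_def)
  have G2: "simple_graph {p, q} {{p, q}}" using q by (auto simp: simple_graph_def nsets_2_eq)
  have disj: "?E1 \<inter> {{p, q}} = {}"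
  proof -
    have "{p, q} \<notin> wedges m" using m(1) wedges_subset[of "{p, q}" m] by auto
    moreover have "q \<noteq> hd m" using m(1,2) ne last_in_set[of "tl m"] unfolding q_def
      by (cases m) (auto split: if_splits)
    ultimately show ?thesis using ne by (auto simp: wedges_Cons doubleton_eq_iff)
  qed
  obtain f1 where f1: "homeomorphic_map (one_complex ?V1 ?E1) (top_of_set {0..1::real}) f1"
    "f1 (vertex_pt p) = 0" "f1 (vertex_pt q) = 1" using path_homeomorphic_map[OF G1 P1] by blast
  obtain f2 where f2: "homeomorphic_map (one_complex {p, q} {{p, q}}) (top_of_set {0..1::real}) f2"
    "f2 (vertex_pt p) = 0" "f2 (vertex_pt q) = 1" using path_homeomorphic_map[OF G2 P2] by blast
  have int: "?V1 \<inter> {p, q} = {p, q}" using q by auto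
  let ?C = "(\<lambda>t. cis (pi * t)) ` {0..1}" and ?D = "(\<lambda>t. cis (- (pi * t))) ` {0..1}"
  have "\<exists>h. homeomorphic_map (one_complex (?V1 \<union> {p, q}) (?E1 \<union> {{p, q}})) (top_of_set (?C \<union> ?D)) h \<and>
    (\<forall>v\<in>?V1. h (vertex_pt v) = ((\<lambda>t. cis (pi * t)) \<circ> f1) (vertex_pt v)) \<and>
    (\<forall>v\<in>{p, q}. h (vertex_pt v) = ((\<lambda>t. cis (- (pi * t))) \<circ> f2) (vertex_pt v))"
  proof (rule homeomorphic_map_union_graph[OF G1 G2 disj])
    show "homeomorphic_map (one_complex ?V1 ?E1) (top_of_set ?C) ((\<lambda>t. cis (pi * t)) \<circ> f1)"
      by (rule homeomorphic_map_compose[OF f1(1) cis_half_circles(1)])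
    show "homeomorphic_map (one_complex {p, q} {{p, q}}) (top_of_set ?D) ((\<lambda>t. cis (- (pi * t))) \<circ> f2)"
      by (rule homeomorphic_map_compose[OF f2(1) cis_half_circles(2)])
    show "((\<lambda>t. cis (pi * t)) \<circ> f1) (vertex_pt v) = ((\<lambda>t. cis (- (pi * t))) \<circ> f2) (vertex_pt v)"
      if "v \<in> ?V1 \<inter> {p, q}" for v
      using that f1(2,3) f2(2,3) unfolding int by (auto simp: complex_eq_iff)
    show "?C \<inter> ?D \<subseteq> ((\<lambda>t. cis (pi * t)) \<circ> f1) ` vertex_pt ` (?V1 \<inter> {p, q})"
      using cis_half_circles(4) f1(2,3) unfolding int by auto
    show "closedin (top_of_set (?C \<union> ?D)) ?C" "closedin (top_of_set (?C \<union> ?D)) ?D"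
      using cis_half_circles(5,6) by (simp_all add: closed_subset)
  qed
  then obtain h where h: "homeomorphic_map (one_complex (?V1 \<union> {p, q}) (?E1 \<union> {{p, q}})) (top_of_set (sphere (0::complex) 1)) h"
    "h (vertex_pt p) = 1"
    unfolding cis_half_circles(3) using f2(2) by fastforce
  moreover have "?V1 \<union> {p, q} = V" using m(3) q by auto
  ultimately show ?thesis using E by metis
qed

subsection \<open>Gluing at a vertex\<close>

lemma amalgam_sym: "amalgam p V1 E1 V2 E2 V E \<Longrightarrow> amalgam p V2 E2 V1 E1 V E"
  by (auto simp: amalgam_def)

lemma amalgam_homeomorphic_map:
  assumes A: "amalgam p V1 E1 V2 E2 V E"
    and f: "homeomorphic_map (one_complex V1 E1) (top_of_set C) f" "f (vertex_pt p) = c"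
    and g: "homeomorphic_map (one_complex V2 E2) (top_of_set D) g" "g (vertex_pt p) = c"
    and CD: "C \<inter> D \<subseteq> {c}" "closedin (top_of_set (C \<union> D)) C" "closedin (top_of_set (C \<union> D)) D"
  shows "\<exists>h. homeomorphic_map (one_complex V E) (top_of_set (C \<union> D)) h \<and>
    (\<forall>v\<in>V1. h (vertex_pt v) = f (vertex_pt v))"
proof -
  have G: "simple_graph V1 E1" "simple_graph V2 E2" and VE: "V = V1 \<union> V2" "E = E1 \<union> E2" "V1 \<inter> V2 = {p}"
    using A by (auto simp: amalgam_def)
  have "E1 \<inter> E2 = {}"
  proof (rule ccontr)
    assume "E1 \<inter> E2 \<noteq> {}"
    then obtain e where e: "e \<in> E1" "e \<in> E2" by blast
    have "e \<subseteq> V1 \<inter> V2" using e G by (auto simp: simple_graph_def nsets_def)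
    then have "e \<subseteq> {p}" unfolding VE(3) .
    moreover obtain x y where "e = {x, y}" "x \<noteq> y" using simple_graph_edgeE[OF G(1) e(1)] .
    ultimately show False by simp
  qed
  moreover have "f (vertex_pt v) = g (vertex_pt v)" if "v \<in> V1 \<inter> V2" for v
    using that f(2) g(2) unfolding VE(3) by simp
  moreover have "C \<inter> D \<subseteq> f ` vertex_pt ` (V1 \<inter> V2)"
    using CD(1) f(2) unfolding VE(3) by simp
  ultimately show ?thesis
    using homeomorphic_map_union_graph[OF G _ f(1) g(1) _ _ CD(2,3)]
    unfolding VE(1,2) by blast
qed

lemma homeomorphic_map_affine:
  fixes S :: "'a::real_normed_field set"
  assumes "u \<noteq> 0" "(\<lambda>x. c + u * x) ` S = T"
  shows "homeomorphic_map (top_of_set S) (top_of_set T) (\<lambda>x. c + u * x)"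
  by (rule homeomorphic_map_euclideanI[where g = "\<lambda>y. (y - c) / u"])
    (use assms in \<open>auto intro!: continuous_intros\<close>)

lemma affine_image_eqI:
  fixes c u :: "'a::field"
  assumes "u \<noteq> 0" "\<And>x. x \<in> S \<longleftrightarrow> c + u * x \<in> T"
  shows "(\<lambda>x. c + u * x) ` S = T"
proof
  show "T \<subseteq> (\<lambda>x. c + u * x) ` S"
  proof
    fix y assume "y \<in> T"
    then show "y \<in> (\<lambda>x. c + u * x) ` S"
      using assms by (intro image_eqI[of _ _ "(y - c) / u"]) auto
  qed
qed (use assms in auto)

lemma homeomorphic_map_of_real:
  fixes c u :: real
  assumes "u \<noteq> 0" "(\<lambda>x. c + u * x) ` S = T"
  shows "homeomorphic_map (top_of_set S) (top_of_set (complex_of_real ` T)) (\<lambda>x. complex_of_real (c + u * x))"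
  by (rule homeomorphic_map_euclideanI[where g = "\<lambda>y. (Re y - c) / u"])
    (use assms in \<open>auto intro!: continuous_intros simp: image_image\<close>)

lemma closed_segment_1_2: "closed_segment 1 2 = complex_of_real ` {1..2}"
  using closed_segment_of_real[of 1 2] by (simp add: closed_segment_eq_real_ivl)

lemma sphere_Int_segment: "sphere 0 1 \<inter> closed_segment 1 2 \<subseteq> {1 :: complex}"
  unfolding closed_segment_1_2 by auto

text \<open>By the triangle inequality the unit circle has distance at least 2 from 3; on the
  segment only the point 2 has distance 1.\<close>

lemma lollipop_Int_sphere: "lollipop \<inter> sphere 3 1 \<subseteq> {2}"
proof
  fix z assume z: "z \<in> lollipop \<inter> sphere 3 1"
  show "z \<in> {2}"
  proof (cases "cmod z = 1")
    case True
    have "3 \<le> cmod z + dist 3 z" using norm_triangle_ineq[of z "3 - z"] by (simp add: dist_norm)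
    then show ?thesis using True z by simp
  next
    case False
    then obtain x where x: "z = complex_of_real x" "1 \<le> x" "x \<le> 2"
      using z unfolding lollipop_def closed_segment_1_2 by auto
    have "cmod (complex_of_real (3 - x)) = 1" using z x(1) by (simp add: dist_norm)
    then show ?thesis using x unfolding norm_of_real by simp
  qed
qed

lemma sphere_Int_sphere: "sphere (-1) 1 \<inter> sphere 1 1 \<subseteq> {0 :: complex}"
proof -
  have "z = 0" if "cmod (z + 1) = 1" "cmod (z - 1) = 1" for z
  proof -
    have eq: "(Re z + 1)\<^sup>2 + (Im z)\<^sup>2 = 1" "(Re z - 1)\<^sup>2 + (Im z)\<^sup>2 = 1"
      using that by (auto simp: cmod_def)
    then have Re: "Re z = 0" by (auto simp: power2_eq_square algebra_simps)
    then have "Im z = 0" using eq(1) by simp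
    then show ?thesis using Re by (simp add: complex_eq_iff)
  qed
  then show ?thesis by (auto simp: dist_norm norm_minus_commute)
qed

lemma sphere_affine:
  fixes c u :: complex
  assumes "cmod u = 1"
  shows "(\<lambda>z. c + u * z) ` sphere 0 1 = sphere c 1"
  using assms by (intro affine_image_eqI) (auto simp: dist_norm norm_mult norm_minus_commute)

text \<open>The rotation \<open>u\<close> brings the gluing vertex to the point where the model
  circle is attached.\<close>

lemma cycle_homeomorphic_map_sphere:
  assumes "simple_graph V E" "cycle_at p V E" "cmod u = 1"
  shows "\<exists>f. homeomorphic_map (one_complex V E) (top_of_set (sphere c 1)) f \<and> f (vertex_pt p) = c + u"
proof -
  obtain f where f: "homeomorphic_map (one_complex V E) (top_of_set (sphere (0::complex) 1)) f" "f (vertex_pt p) = 1"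
    using cycle_homeomorphic_map[OF assms(1,2)] by blast
  have "homeomorphic_map (top_of_set (sphere 0 1)) (top_of_set (sphere c 1)) (\<lambda>z. c + u * z)"
    using assms(3) by (intro homeomorphic_map_affine sphere_affine) auto
  from homeomorphic_map_compose[OF f(1) this] f(2) show ?thesis
    by (intro exI[of _ "(\<lambda>z. c + u * z) \<circ> f"]) simp
qed

text \<open>Both orientations occur: the segment meets the circle at 1, and \<open>p\<close> is that
  point if the circle is attached at \<open>p\<close>, but the far end in
  \<open>lollipop_from\<close>.\<close>

lemma path_homeomorphic_map_segment:
  assumes "simple_graph V E" "path_from_to p q V E"
  shows "\<exists>f. homeomorphic_map (one_complex V E) (top_of_set (closed_segment 1 (2::complex))) f \<and>
    f (vertex_pt p) = 1 \<and> f (vertex_pt q) = 2"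
    and "\<exists>f. homeomorphic_map (one_complex V E) (top_of_set (closed_segment 1 (2::complex))) f \<and>
    f (vertex_pt p) = 2 \<and> f (vertex_pt q) = 1"
proof -
  obtain f where f: "homeomorphic_map (one_complex V E) (top_of_set {0..1::real}) f"
    "f (vertex_pt p) = 0" "f (vertex_pt q) = 1" using path_homeomorphic_map[OF assms] by blast
  have 1: "homeomorphic_map (top_of_set {0..1}) (top_of_set (closed_segment 1 2)) (\<lambda>x. complex_of_real (1 + 1 * x))"
    unfolding closed_segment_1_2 by (intro homeomorphic_map_of_real affine_image_eqI) auto
  have 2: "homeomorphic_map (top_of_set {0..1}) (top_of_set (closed_segment 1 2)) (\<lambda>x. complex_of_real (2 + (-1) * x))"
    unfolding closed_segment_1_2 by (intro homeomorphic_map_of_real affine_image_eqI) auto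
  show "\<exists>f. homeomorphic_map (one_complex V E) (top_of_set (closed_segment 1 (2::complex))) f \<and>
    f (vertex_pt p) = 1 \<and> f (vertex_pt q) = 2"
    using homeomorphic_map_compose[OF f(1) 1] f(2,3) by (intro exI[of _ "(\<lambda>x. complex_of_real (1 + 1 * x)) \<circ> f"]) simp
  show "\<exists>f. homeomorphic_map (one_complex V E) (top_of_set (closed_segment 1 (2::complex))) f \<and>
    f (vertex_pt p) = 2 \<and> f (vertex_pt q) = 1"
    using homeomorphic_map_compose[OF f(1) 2] f(2,3) by (intro exI[of _ "(\<lambda>x. complex_of_real (2 + (-1) * x)) \<circ> f"]) simp
qed

lemma lollipop_homeomorphic_map:
  assumes "lollipop_from p V E"
  shows "\<exists>f. homeomorphic_map (one_complex V E) (top_of_set lollipop) f \<and> f (vertex_pt p) = 2"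
proof -
  obtain a V1 E1 V2 E2 where A: "path_from_to p a V1 E1" "cycle_at a V2 E2" "amalgam a V1 E1 V2 E2 V E"
    using assms unfolding lollipop_from_def by blast
  have G: "simple_graph V1 E1" "simple_graph V2 E2" using A(3) by (auto simp: amalgam_def)
  have p: "p \<in> V1" using A(1) unfolding path_from_to_def by (metis hd_in_set list.size(3) not_numeral_le_zero)
  obtain f where f: "homeomorphic_map (one_complex V1 E1) (top_of_set (closed_segment 1 (2::complex))) f"
    "f (vertex_pt p) = 2" "f (vertex_pt a) = 1"
    using path_homeomorphic_map_segment(2)[OF G(1) A(1)] by blast
  obtain g where g: "homeomorphic_map (one_complex V2 E2) (top_of_set (sphere (0::complex) 1)) g" "g (vertex_pt a) = 1"
    using cycle_homeomorphic_map[OF G(2) A(2)] by blast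
  have "\<exists>h. homeomorphic_map (one_complex V E) (top_of_set (closed_segment 1 2 \<union> sphere 0 1)) h \<and>
    (\<forall>v\<in>V1. h (vertex_pt v) = f (vertex_pt v))"
    by (rule amalgam_homeomorphic_map[OF A(3) f(1,3) g])
      (use sphere_Int_segment in \<open>auto simp: closed_subset\<close>)
  then show ?thesis using f(2) p unfolding lollipop_def by (metis sup_commute)
qed

lemma cycle_amalgam_homeomorphic:
  assumes A: "amalgam p V1 E1 V2 E2 V E" and C: "cycle_at p V1 E1"
  shows "cycle_at p V2 E2 \<Longrightarrow> one_complex V E homeomorphic_space top_of_set figure_of_eight"
    "path_from_to p a V2 E2 \<Longrightarrow> one_complex V E homeomorphic_space top_of_set lollipop"
    "ray_from p V2 E2 \<Longrightarrow> one_complex V E homeomorphic_space top_of_set lollipop_without_endpoint"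
    "lollipop_from p V2 E2 \<Longrightarrow> one_complex V E homeomorphic_space top_of_set dumbbell"
proof -
  have G: "simple_graph V1 E1" "simple_graph V2 E2" using A by (auto simp: amalgam_def)
  obtain f where f: "homeomorphic_map (one_complex V1 E1) (top_of_set (sphere (0::complex) 1)) f" "f (vertex_pt p) = 1"
    using cycle_homeomorphic_map[OF G(1) C] by blast
  have hs: "X homeomorphic_space Y" if "\<exists>h. homeomorphic_map X Y h \<and> P h" for X :: "(('a + 'a set) \<times> real) topology" and Y :: "complex topology" and P
    using that homeomorphic_map_imp_homeomorphic_space by blast
  show "one_complex V E homeomorphic_space top_of_set figure_of_eight" if C2: "cycle_at p V2 E2"
  proof -
    obtain f where f: "homeomorphic_map (one_complex V1 E1) (top_of_set (sphere (-1::complex) 1)) f" "f (vertex_pt p) = 0"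
      using cycle_homeomorphic_map_sphere[OF G(1) C, of 1 "-1"] by auto
    obtain g where g: "homeomorphic_map (one_complex V2 E2) (top_of_set (sphere (1::complex) 1)) g" "g (vertex_pt p) = 0"
      using cycle_homeomorphic_map_sphere[OF G(2) C2, of "-1" 1] by auto
    show ?thesis
      unfolding figure_of_eight_def
      by (rule hs, rule amalgam_homeomorphic_map[OF A f g sphere_Int_sphere]) (auto simp: closed_subset)
  qed
  show "one_complex V E homeomorphic_space top_of_set lollipop" if P: "path_from_to p a V2 E2"
  proof -
    obtain g where g: "homeomorphic_map (one_complex V2 E2) (top_of_set (closed_segment 1 (2::complex))) g" "g (vertex_pt p) = 1"
      using path_homeomorphic_map_segment(1)[OF G(2) P] by blast
    show ?thesis
      unfolding lollipop_def
      by (rule hs, rule amalgam_homeomorphic_map[OF A f g sphere_Int_segment]) (auto simp: closed_subset)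
  qed
  show "one_complex V E homeomorphic_space top_of_set lollipop_without_endpoint" if R: "ray_from p V2 E2"
  proof -
    obtain g where g: "homeomorphic_map (one_complex V2 E2) (top_of_set {0..<1::real}) g" "g (vertex_pt p) = 0"
      using ray_homeomorphic_map[OF G(2) R] by blast
    have h: "homeomorphic_map (top_of_set {0..<1}) (top_of_set (complex_of_real ` {1..<2})) (\<lambda>x. complex_of_real (1 + 1 * x))"
      by (intro homeomorphic_map_of_real affine_image_eqI) auto
    let ?g = "(\<lambda>x. complex_of_real (1 + 1 * x)) \<circ> g"
    have eq: "lollipop_without_endpoint = sphere 0 1 \<union> complex_of_real ` {1..<2}"
    proof -
      have "complex_of_real ` {1..2} = insert 2 (complex_of_real ` {1..<2})"
      proof -
        have "{1..2} = insert 2 {1..<2::real}" by auto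
        then show ?thesis by simp
      qed
      moreover have "2 \<notin> complex_of_real ` {1..<2}"
        by (auto simp: complex_eq_iff)
      moreover have "2 \<notin> sphere (0::complex) 1" by simp
      ultimately show ?thesis
        unfolding lollipop_without_endpoint_def lollipop_def closed_segment_1_2 by blast
    qed
    \<comment> \<open>The half-open segment is not closed in the plane. It is relatively closed as
      the trace of the half-plane of real part at least 1, which the unit circle meets only at
      1.\<close>
    have "closedin (top_of_set (sphere 0 1 \<union> complex_of_real ` {1..<2})) (complex_of_real ` {1..<2})"
    proof -
      have "complex_of_real ` {1..<2} = (sphere 0 1 \<union> complex_of_real ` {1..<2}) \<inter> {z. 1 \<le> Re z}"
      proof -
        have "z = complex_of_real 1" if "cmod z = 1" "1 \<le> Re z" for z
        proof -
          have "Re z = 1" using that complex_Re_le_cmod[of z] by simp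
          then show ?thesis using that(1) by (auto simp: complex_eq_iff cmod_def)
        qed
        then show ?thesis by force
      qed
      then show ?thesis by (metis closed_halfspace_Re_ge closedin_closed_Int)
    qed
    moreover have "sphere 0 1 \<inter> complex_of_real ` {1..<2} \<subseteq> {1}" by auto
    ultimately show ?thesis
      unfolding eq
      by (intro hs[OF amalgam_homeomorphic_map[OF A f homeomorphic_map_compose[OF g(1) h]]])
        (auto simp: closed_subset g(2))
  qed
  show "one_complex V E homeomorphic_space top_of_set dumbbell" if L: "lollipop_from p V2 E2"
  proof -
    \<comment> \<open>The cycle at \<open>p\<close> becomes the circle around 3, because the
      lollipop from \<open>p\<close> is mapped with \<open>p\<close> at 2.\<close>
    obtain f where f: "homeomorphic_map (one_complex V1 E1) (top_of_set (sphere (3::complex) 1)) f" "f (vertex_pt p) = 2"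
      using cycle_homeomorphic_map_sphere[OF G(1) C, of "-1" 3] by auto
    obtain g where g: "homeomorphic_map (one_complex V2 E2) (top_of_set lollipop) g" "g (vertex_pt p) = 2"
      using lollipop_homeomorphic_map[OF L] by blast
    have int: "sphere 3 1 \<inter> lollipop \<subseteq> {2}" using lollipop_Int_sphere by blast
    have "closed lollipop" unfolding lollipop_def by (intro closed_Un) auto
    then have "one_complex V E homeomorphic_space top_of_set (sphere 3 1 \<union> lollipop)"
      by (intro hs[OF amalgam_homeomorphic_map[OF A f g int]]) (auto simp: closed_subset)
    moreover have "sphere 3 1 \<union> lollipop = dumbbell" by (auto simp: dumbbell_def lollipop_def)
    ultimately show ?thesis by simp
  qed
qed

text \<open>Both parts are scaled by one half and laid to the left and to the right of 1/2, with
  \<open>p\<close> at 1/2. The open end of a ray becomes a missing endpoint of the interval.\<close>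

lemma line_amalgam_homeomorphic:
  assumes A: "amalgam p V1 E1 V2 E2 V E"
  shows "path_from_to p a V1 E1 \<Longrightarrow> path_from_to p b V2 E2 \<Longrightarrow> one_complex V E homeomorphic_space top_of_set {0..1::real}"
    "path_from_to p a V1 E1 \<Longrightarrow> ray_from p V2 E2 \<Longrightarrow> one_complex V E homeomorphic_space top_of_set {0..<1::real}"
    "ray_from p V1 E1 \<Longrightarrow> ray_from p V2 E2 \<Longrightarrow> one_complex V E homeomorphic_space top_of_set {0<..<1::real}"
proof -
  have G: "simple_graph V1 E1" "simple_graph V2 E2" using A by (auto simp: amalgam_def)
  have lower: "homeomorphic_map (top_of_set S) (top_of_set ((\<lambda>x. 1/2 + (-1/2) * x) ` S)) (\<lambda>x::real. 1/2 + (-1/2) * x)"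
    and upper: "homeomorphic_map (top_of_set S) (top_of_set ((\<lambda>x. 1/2 + 1/2 * x) ` S)) (\<lambda>x::real. 1/2 + 1/2 * x)" for S
    by (rule homeomorphic_map_affine[OF _ refl]; simp)+
  have images: "(\<lambda>x. 1/2 + (-1/2) * x) ` {0..1} = {0..1/2::real}" "(\<lambda>x. 1/2 + (-1/2) * x) ` {0..<1} = {0<..1/2::real}"
    "(\<lambda>x. 1/2 + 1/2 * x) ` {0..1} = {1/2..1::real}" "(\<lambda>x. 1/2 + 1/2 * x) ` {0..<1} = {1/2..<1::real}"
    by (rule affine_image_eqI; auto simp: field_simps)+
  have glue: "one_complex V E homeomorphic_space top_of_set M"
    if f: "homeomorphic_map (one_complex V1 E1) (top_of_set S) f" "f (vertex_pt p) = 0"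
      and g: "homeomorphic_map (one_complex V2 E2) (top_of_set T) g" "g (vertex_pt p) = 0"
      and C: "(\<lambda>x. 1/2 + (-1/2) * x) ` S = M \<inter> {..1/2::real}" and D: "(\<lambda>x. 1/2 + 1/2 * x) ` T = M \<inter> {1/2..}"
    for S T M f g
  proof -
    have "\<exists>h. homeomorphic_map (one_complex V E) (top_of_set ((M \<inter> {..1/2}) \<union> (M \<inter> {1/2..}))) h \<and>
      (\<forall>v\<in>V1. h (vertex_pt v) = ((\<lambda>x. 1/2 + (-1/2) * x) \<circ> f) (vertex_pt v))"
    proof (rule amalgam_homeomorphic_map[OF A, where c = "1/2"])
      show "homeomorphic_map (one_complex V1 E1) (top_of_set (M \<inter> {..1/2})) ((\<lambda>x. 1/2 + (-1/2) * x) \<circ> f)"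
        using homeomorphic_map_compose[OF f(1) lower] unfolding C .
      show "homeomorphic_map (one_complex V2 E2) (top_of_set (M \<inter> {1/2..})) ((\<lambda>x. 1/2 + 1/2 * x) \<circ> g)"
        using homeomorphic_map_compose[OF g(1) upper] unfolding D .
      have M: "(M \<inter> {..1/2}) \<union> (M \<inter> {1/2..}) = M" by auto
      show "closedin (top_of_set ((M \<inter> {..1/2}) \<union> (M \<inter> {1/2..}))) (M \<inter> {..1/2})"
        "closedin (top_of_set ((M \<inter> {..1/2}) \<union> (M \<inter> {1/2..}))) (M \<inter> {1/2..})"
        unfolding M by (rule closedin_closed_Int; simp)+
    qed (use f g in auto)
    moreover have "(M \<inter> {..1/2}) \<union> (M \<inter> {1/2..}) = M" by auto
    ultimately show ?thesis using homeomorphic_map_imp_homeomorphic_space by metis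
  qed
  show "one_complex V E homeomorphic_space top_of_set {0..1::real}"
    if P: "path_from_to p a V1 E1" "path_from_to p b V2 E2"
  proof -
    obtain f where f: "homeomorphic_map (one_complex V1 E1) (top_of_set {0..1::real}) f" "f (vertex_pt p) = 0"
      using path_homeomorphic_map[OF G(1) P(1)] by blast
    obtain g where g: "homeomorphic_map (one_complex V2 E2) (top_of_set {0..1::real}) g" "g (vertex_pt p) = 0"
      using path_homeomorphic_map[OF G(2) P(2)] by blast
    show ?thesis by (rule glue[OF f g]; unfold images; auto)
  qed
  show "one_complex V E homeomorphic_space top_of_set {0..<1::real}"
    if P: "path_from_to p a V1 E1" "ray_from p V2 E2"
  proof -
    obtain f where f: "homeomorphic_map (one_complex V1 E1) (top_of_set {0..1::real}) f" "f (vertex_pt p) = 0"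
      using path_homeomorphic_map[OF G(1) P(1)] by blast
    obtain g where g: "homeomorphic_map (one_complex V2 E2) (top_of_set {0..<1::real}) g" "g (vertex_pt p) = 0"
      using ray_homeomorphic_map[OF G(2) P(2)] by blast
    show ?thesis by (rule glue[OF f g]; unfold images; auto)
  qed
  show "one_complex V E homeomorphic_space top_of_set {0<..<1::real}"
    if P: "ray_from p V1 E1" "ray_from p V2 E2"
  proof -
    obtain f where f: "homeomorphic_map (one_complex V1 E1) (top_of_set {0..<1::real}) f" "f (vertex_pt p) = 0"
      using ray_homeomorphic_map[OF G(1) P(1)] by blast
    obtain g where g: "homeomorphic_map (one_complex V2 E2) (top_of_set {0..<1::real}) g" "g (vertex_pt p) = 0"
      using ray_homeomorphic_map[OF G(2) P(2)] by blast
    show ?thesis by (rule glue[OF f g]; unfold images; auto)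
  qed
qed

subsection \<open>The model spaces are arc-connected through finitely many points\<close>

lemma is_arc_in_path_image:
  fixes g :: "real \<Rightarrow> 'a::euclidean_space"
  assumes "arc g" "path_image g \<subseteq> M"
  shows "is_arc_in (top_of_set M) (path_image g)"
proof -
  have "homeomorphic_map (top_of_set {0..1}) (top_of_set (path_image g)) g"
    using assms(1) unfolding arc_def path_def path_image_def by (intro homeomorphic_map_compact) auto
  then have "top_of_set (path_image g) homeomorphic_space top_of_set {0..1::real}"
    using homeomorphic_map_imp_homeomorphic_space homeomorphic_space_sym by blast
  then show ?thesis
    using assms(2) by (simp add: is_arc_in_def subtopology_subtopology Int_absorb1)
qed

lemma n_arc_connected_homeomorphic:
  assumes "X homeomorphic_space Y" "n_arc_connected n Y"
  shows "n_arc_connected n X"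
  unfolding n_arc_connected_def
proof (intro allI impI)
  fix S assume S: "S \<subseteq> topspace X \<and> finite S \<and> card S \<le> n"
  obtain f g where fg: "homeomorphic_maps X Y f g" using assms(1) unfolding homeomorphic_space_def by blast
  have map: "f x \<in> topspace Y" "g (f x) = x" if "x \<in> topspace X" for x
    using fg that unfolding homeomorphic_maps_def continuous_map_def by auto
  have map': "g y \<in> topspace X" "f (g y) = y" if "y \<in> topspace Y" for y
    using fg that unfolding homeomorphic_maps_def continuous_map_def by auto
  have "f ` S \<subseteq> topspace Y" "finite (f ` S)" using S map by auto
  moreover have "card (f ` S) \<le> n" using S card_image_le[of S f] by linarith
  ultimately obtain B where B: "is_arc_in Y B" "f ` S \<subseteq> B"
    using assms(2) unfolding n_arc_connected_def by blast
  have BY: "B \<subseteq> topspace Y" using B(1) by (simp add: is_arc_in_def)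
  have "homeomorphic_maps Y X g f" using fg homeomorphic_maps_sym by blast
  moreover have "g ` (topspace Y \<inter> B) = topspace X \<inter> g ` B" using BY map'(1) by auto
  ultimately have "homeomorphic_maps (subtopology Y B) (subtopology X (g ` B)) g f"
    using homeomorphic_maps_subtopologies by blast
  then have "subtopology X (g ` B) homeomorphic_space top_of_set {0..1::real}"
    using B(1) unfolding is_arc_in_def
    by (metis homeomorphic_maps_imp_homeomorphic_space homeomorphic_space_sym homeomorphic_space_trans)
  then have "is_arc_in X (g ` B)"
    using BY map'(1) by (auto simp: is_arc_in_def)
  moreover have "S \<subseteq> g ` B"
  proof
    fix x assume "x \<in> S"
    then have "f x \<in> B" "g (f x) = x" using B(2) S map(2) by auto
    then show "x \<in> g ` B" by (metis imageI)
  qed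
  ultimately show "\<exists>A. is_arc_in X A \<and> S \<subseteq> A" by blast
qed

text \<open>The criterion admits arbitrary finite sets: the model spaces are arc-connected through
  any number of points.\<close>

lemma n_arc_connectedI:
  fixes M :: "'a::euclidean_space set"
  assumes "\<And>S. finite S \<Longrightarrow> S \<subseteq> M \<Longrightarrow> \<exists>g. arc g \<and> path_image g \<subseteq> M \<and> S \<subseteq> path_image g"
  shows "n_arc_connected n (top_of_set M)"
  unfolding n_arc_connected_def using assms is_arc_in_path_image by (metis topspace_euclidean_subtopology)

lemma n_arc_connected_interval:
  fixes M :: "real set"
  assumes "is_interval M" "x \<in> M" "y \<in> M" "x < y"
  shows "n_arc_connected n (top_of_set M)"
proof (rule n_arc_connectedI)
  fix S assume S: "finite S" "S \<subseteq> M"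
  \<comment> \<open>Inserting \<open>x\<close> and \<open>y\<close> keeps the segment nondegenerate
    when \<open>S\<close> has fewer than two points.\<close>
  define a b where "a = Min (insert x S)" and "b = Max (insert y S)"
  have "a \<in> insert x S" "b \<in> insert y S" unfolding a_def b_def using S by (intro Min_in Max_in; simp)+
  then have ab: "a \<in> M" "b \<in> M" using S assms by auto
  have le: "a \<le> x" "y \<le> b" "\<And>z. z \<in> S \<Longrightarrow> a \<le> z \<and> z \<le> b"
    unfolding a_def b_def using S(1) by simp_all
  have "{a..b} \<subseteq> M" using mem_is_interval_1_I[OF assms(1) ab] by (meson atLeastAtMost_iff subsetI)
  moreover have "path_image (linepath a b) = {a..b}"
    using le assms(4) by (simp add: closed_segment_eq_real_ivl)
  ultimately show "\<exists>g. arc g \<and> path_image g \<subseteq> M \<and> S \<subseteq> path_image g"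
    using le assms(4) by (intro exI[of _ "linepath a b"]) auto
qed

text \<open>From the gluing point \<open>c + u\<close> the arc runs counterclockwise up to the
  largest angle occurring in \<open>S\<close>. The 1 in the definition of \<open>b\<close> keeps it
  nondegenerate, and \<open>b < 2 * pi\<close> keeps it injective.\<close>

lemma arc_in_circle:
  fixes c u :: complex
  assumes "finite S" "cmod u = 1"
  shows "\<exists>g. arc g \<and> pathstart g = c + u \<and> path_image g \<subseteq> sphere c 1 \<and> S \<inter> sphere c 1 \<subseteq> path_image g"
proof -
  define b where "b = Max (insert 1 ((\<lambda>z. Arg2pi ((z - c) / u)) ` S))"
  have u: "u \<noteq> 0" using assms(2) by auto
  have b: "1 \<le> b" "b < 2 * pi" "\<And>z. z \<in> S \<Longrightarrow> Arg2pi ((z - c) / u) \<le> b"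
    using assms(1) Arg2pi_lt_2pi pi_gt3 by (auto simp: b_def)
  define g where "g = (\<lambda>t. c + u * cis (b * t))"
  have "s = t" if st: "s \<in> {0..1}" "t \<in> {0..1}" "g s = g t" for s t
  proof -
    have range: "0 \<le> b * x" "b * x < 2 * pi" if "x \<in> {0..1}" for x
    proof -
      show "0 \<le> b * x" using that b(1) by simp
      have "b * x \<le> b * 1" using that b(1) by (intro mult_left_mono) auto
      then show "b * x < 2 * pi" using b(2) by simp
    qed
    have "cis (b * s) = cis (b * t)" using st(3) u by (simp add: g_def)
    then have "b * s = b * t"
      using Arg2pi_unique[of 1 "b * s" "cis (b * s)"] Arg2pi_unique[of 1 "b * t" "cis (b * t)"]
        range[OF st(1)] range[OF st(2)] by (simp add: cis_conv_exp)
    then show ?thesis using b(1) by simp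
  qed
  then have "arc g"
    unfolding arc_def path_def by (auto simp: g_def inj_on_def intro!: continuous_intros)
  moreover have "pathstart g = c + u" by (simp add: g_def pathstart_def)
  moreover have "path_image g \<subseteq> sphere c 1"
    using assms(2) by (auto simp: path_image_def g_def dist_norm norm_mult)
  moreover have "S \<inter> sphere c 1 \<subseteq> path_image g"
  proof
    fix z assume z: "z \<in> S \<inter> sphere c 1"
    let ?a = "Arg2pi ((z - c) / u)"
    have "cmod ((z - c) / u) = 1" using z assms(2) by (simp add: norm_divide dist_norm norm_minus_commute)
    then have "(z - c) / u = cis ?a"
      using Arg2pi_eq[of "(z - c) / u"] by (simp add: cis_conv_exp)
    then have "z = c + u * cis ?a" using u by (simp add: field_simps)
    moreover have "0 \<le> ?a" "?a \<le> b" using b(3) z Arg2pi_ge_0 by auto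
    ultimately show "z \<in> path_image g"
      unfolding path_image_def g_def using b(1) by (intro image_eqI[of _ _ "?a / b"]) auto
  qed
  ultimately show ?thesis by blast
qed

text \<open>The lollipop uses \<open>r = 2\<close>. Without the endpoint some \<open>r < 2\<close>
  is used, since a finite set stays away from the missing point.\<close>

lemma arc_circle_segment:
  assumes S: "finite S" and r: "1 < r" "r \<le> 2"
  shows "\<exists>g. arc g \<and> pathfinish g = complex_of_real r \<and> path_image g \<subseteq> sphere 0 1 \<union> complex_of_real ` {1..r} \<and>
    S \<inter> (sphere 0 1 \<union> complex_of_real ` {1..r}) \<subseteq> path_image g"
proof -
  obtain h where h: "arc h" "pathstart h = 1" "path_image h \<subseteq> sphere 0 1" "S \<inter> sphere 0 1 \<subseteq> path_image h"
    using arc_in_circle[OF S, of 1 0] by auto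
  have seg: "path_image (linepath 1 (complex_of_real r)) = complex_of_real ` {1..r}"
    using closed_segment_of_real[of 1 r] r by (simp add: closed_segment_eq_real_ivl)
  let ?g = "reversepath h +++ linepath 1 (complex_of_real r)"
  have "arc ?g"
  proof (rule arc_join)
    show "arc (linepath 1 (complex_of_real r))" using r by (intro arc_linepath) auto
    show "path_image (reversepath h) \<inter> path_image (linepath 1 (complex_of_real r)) \<subseteq> {pathstart (linepath 1 (complex_of_real r))}"
      unfolding seg using h(3) by auto
  qed (use h in \<open>auto simp: arc_reversepath\<close>)
  moreover have "path_image ?g = path_image h \<union> complex_of_real ` {1..r}"
    using path_image_join[of "reversepath h" "linepath 1 (complex_of_real r)"] h(2) seg by simp
  ultimately show ?thesis using h(3,4) by (intro exI[of _ ?g]) auto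
qed

lemma n_arc_connected_lollipop: "n_arc_connected n (top_of_set lollipop)"
proof (rule n_arc_connectedI)
  fix S assume "finite S" "S \<subseteq> lollipop"
  then show "\<exists>g. arc g \<and> path_image g \<subseteq> lollipop \<and> S \<subseteq> path_image g"
    using arc_circle_segment[of S 2] unfolding lollipop_def closed_segment_1_2
    by (auto simp: Int_absorb2)
qed

lemma n_arc_connected_lollipop_without_endpoint: "n_arc_connected n (top_of_set lollipop_without_endpoint)"
proof (rule n_arc_connectedI)
  fix S assume S: "finite S" "S \<subseteq> lollipop_without_endpoint"
  \<comment> \<open>The value 3/2 is an arbitrary number between 1 and 2: the segment has to be
    nondegenerate and to stop short of the missing endpoint.\<close>
  define r where "r = Max (insert (3/2) (Re ` S))"
  have Re: "Re z < 2" if "z \<in> lollipop_without_endpoint" for z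
  proof -
    have "z \<noteq> 2" "cmod z = 1 \<or> (\<exists>x\<in>{1..2}. z = complex_of_real x)"
      using that unfolding lollipop_without_endpoint_def lollipop_def closed_segment_1_2 by auto
    then show ?thesis using complex_Re_le_cmod[of z] by (auto simp: less_le)
  qed
  have r: "1 < r" "r < 2" "\<And>z. z \<in> S \<Longrightarrow> Re z \<le> r"
  proof -
    show "r < 2" using S Re by (auto simp: r_def)
    show "Re z \<le> r" if "z \<in> S" for z using S that by (auto simp: r_def)
    have "3/2 \<le> r" unfolding r_def using S(1) by (intro Max_ge) auto
    then show "1 < r" by simp
  qed
  have sub: "sphere 0 1 \<union> complex_of_real ` {1..r} \<subseteq> lollipop_without_endpoint"
    using r(2) unfolding lollipop_without_endpoint_def lollipop_def closed_segment_1_2 by (auto simp: complex_eq_iff)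
  have "S \<subseteq> sphere 0 1 \<union> complex_of_real ` {1..r}"
  proof
    fix z assume z: "z \<in> S"
    then have "z \<in> sphere 0 1 \<or> (\<exists>x. z = complex_of_real x \<and> 1 \<le> x)"
      using S(2) unfolding lollipop_without_endpoint_def lollipop_def closed_segment_1_2 by auto
    then show "z \<in> sphere 0 1 \<union> complex_of_real ` {1..r}" using r(3)[OF z] by auto
  qed
  then show "\<exists>g. arc g \<and> path_image g \<subseteq> lollipop_without_endpoint \<and> S \<subseteq> path_image g"
    using arc_circle_segment[OF S(1) r(1) less_imp_le[OF r(2)]] sub by (metis Int_absorb2 order_trans)
qed

text \<open>An arc that ends at the gluing point is continued into the attached circle;
  \<open>int\<close> keeps the joined path injective.\<close>

lemma arc_join_circle:
  fixes c u :: complex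
  assumes S: "finite S" and u: "cmod u = 1" and g: "arc g" "pathfinish g = c + u" "path_image g \<subseteq> M" "S \<inter> M \<subseteq> path_image g"
    and int: "M \<inter> sphere c 1 \<subseteq> {c + u}"
  shows "\<exists>h. arc h \<and> path_image h \<subseteq> M \<union> sphere c 1 \<and> S \<inter> (M \<union> sphere c 1) \<subseteq> path_image h"
proof -
  obtain k where k: "arc k" "pathstart k = c + u" "path_image k \<subseteq> sphere c 1" "S \<inter> sphere c 1 \<subseteq> path_image k"
    using arc_in_circle[OF S u] by blast
  have "arc (g +++ k)"
    using g k int by (intro arc_join) auto
  moreover have "path_image (g +++ k) = path_image g \<union> path_image k"
    using g(2) k(2) by (intro path_image_join) simp
  ultimately show ?thesis using g(3,4) k(3,4) by (intro exI[of _ "g +++ k"]) auto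
qed

lemma n_arc_connected_dumbbell: "n_arc_connected n (top_of_set dumbbell)"
proof (rule n_arc_connectedI)
  fix S assume S: "finite S" "S \<subseteq> dumbbell"
  have M: "sphere 0 1 \<union> complex_of_real ` {1..2} = lollipop"
    unfolding lollipop_def closed_segment_1_2 ..
  obtain g where g: "arc g" "pathfinish g = 2" "path_image g \<subseteq> lollipop" "S \<inter> lollipop \<subseteq> path_image g"
    using arc_circle_segment[OF S(1), of 2] unfolding M by auto
  have "dumbbell = lollipop \<union> sphere 3 1" by (auto simp: dumbbell_def lollipop_def)
  then show "\<exists>g. arc g \<and> path_image g \<subseteq> dumbbell \<and> S \<subseteq> path_image g"
    using arc_join_circle[OF S(1), of "-1" g 3 lollipop] g lollipop_Int_sphere S(2) by (simp add: Int_absorb2)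
qed

lemma n_arc_connected_figure_of_eight: "n_arc_connected n (top_of_set figure_of_eight)"
proof (rule n_arc_connectedI)
  fix S assume S: "finite S" "S \<subseteq> figure_of_eight"
  obtain g where g: "arc g" "pathstart g = 0" "path_image g \<subseteq> sphere (-1) 1" "S \<inter> sphere (-1) 1 \<subseteq> path_image g"
    using arc_in_circle[OF S(1), of 1 "-1"] by auto
  then show "\<exists>g. arc g \<and> path_image g \<subseteq> figure_of_eight \<and> S \<subseteq> path_image g"
    using arc_join_circle[OF S(1), of "-1" "reversepath g" 1 "sphere (-1) 1"] sphere_Int_sphere S(2)
    unfolding figure_of_eight_def by (simp add: arc_reversepath Int_absorb2)
qed

theorem theorem3p3p1:
  fixes V :: "'v set" and E :: "'v set set"
  assumes "simple_graph V E"
    and "\<not> cyclically_connected V E"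
  shows "n_ac 5 V E \<longleftrightarrow>
      one_complex V E homeomorphic_space top_of_set {0..1::real}
    \<or> one_complex V E homeomorphic_space top_of_set {0..<1::real}
    \<or> one_complex V E homeomorphic_space top_of_set {0<..<1::real}
    \<or> one_complex V E homeomorphic_space top_of_set lollipop
    \<or> one_complex V E homeomorphic_space top_of_set lollipop_without_endpoint
    \<or> one_complex V E homeomorphic_space top_of_set dumbbell
    \<or> one_complex V E homeomorphic_space top_of_set figure_of_eight"
proof
  assume ac: "n_ac 5 V E"
  have con: "connected_graph V E" using n_ac_connected_graph[OF assms(1) ac] by simp
  have iso: "\<forall>v\<in>V. \<exists>y. {v, y} \<in> E"
  proof (intro ballI, rule ccontr)
    fix v assume v: "v \<in> V" "\<nexists>y. {v, y} \<in> E"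
    have "{v} = V"
      by (rule con[unfolded connected_graph_def, rule_format]) (use v in auto)
    \<comment> \<open>A graph with a single vertex is vacuously cyclically connected.\<close>
    then show False using assms(2) unfolding cyclically_connected_def by (metis singletonD)
  qed
  from walk_connected_cases[OF assms(1) con assms(2) n_ac_walk_connected[OF assms(1) iso ac]]
  show "one_complex V E homeomorphic_space top_of_set {0..1::real}
    \<or> one_complex V E homeomorphic_space top_of_set {0..<1::real}
    \<or> one_complex V E homeomorphic_space top_of_set {0<..<1::real}
    \<or> one_complex V E homeomorphic_space top_of_set lollipop
    \<or> one_complex V E homeomorphic_space top_of_set lollipop_without_endpoint
    \<or> one_complex V E homeomorphic_space top_of_set dumbbell
    \<or> one_complex V E homeomorphic_space top_of_set figure_of_eight"
  proof cases
    case (1 u v)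
    then obtain f where "homeomorphic_map (one_complex V E) (top_of_set {0..1::real}) f"
      using path_homeomorphic_map[OF assms(1)] by blast
    then show ?thesis using homeomorphic_map_imp_homeomorphic_space by blast
  next
    case (2 p V1 E1 V2 E2)
    note * = cycle_amalgam_homeomorphic[OF 2(1,2)]
    from 2(3) show ?thesis
      by (elim disjE exE) (simp_all add: *)
  next
    case (3 p V1 E1 V2 E2)
    \<comment> \<open>The path and the ray may come in either order; the symmetric amalgam covers
      the second one.\<close>
    note * = line_amalgam_homeomorphic[OF 3(1)] line_amalgam_homeomorphic[OF amalgam_sym[OF 3(1)]]
    from 3(2,3) show ?thesis
      by (elim disjE exE) (use * in metis)+
  qed
next
  assume "one_complex V E homeomorphic_space top_of_set {0..1::real}
    \<or> one_complex V E homeomorphic_space top_of_set {0..<1::real}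
    \<or> one_complex V E homeomorphic_space top_of_set {0<..<1::real}
    \<or> one_complex V E homeomorphic_space top_of_set lollipop
    \<or> one_complex V E homeomorphic_space top_of_set lollipop_without_endpoint
    \<or> one_complex V E homeomorphic_space top_of_set dumbbell
    \<or> one_complex V E homeomorphic_space top_of_set figure_of_eight"
  moreover have "n_arc_connected 5 (top_of_set {0..1::real})" "n_arc_connected 5 (top_of_set {0..<1::real})"
    "n_arc_connected 5 (top_of_set {0<..<1::real})"
    by (rule n_arc_connected_interval[of _ "1/3" "2/3"]; simp add: is_interval_1)+
  ultimately show "n_ac 5 V E"
    unfolding n_ac_def
    by (elim disjE) (auto intro: n_arc_connected_homeomorphic n_arc_connected_lollipop
      n_arc_connected_lollipop_without_endpoint n_arc_connected_dumbbell n_arc_connected_figure_of_eight)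
qed

end
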